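(* Let $N/K$ be a fully (totally) ramified Galois extension with $G=\mathrm{Gal}(N/K)=\langle\gamma,\sigma\rangle\cong C_p^2$ and with one ramification break, at $b$. Pick any $\rho\in N$ with $v_N(\rho)=b$. Define $\omega$ to be the unique $(p^f-1)$-th root of unity such that $v_N((\gamma-1)\rho+\omega(\sigma-1)\rho)>2b$, and let $\Theta=\gamma\sigma^{[\omega]}\in\mathfrak O_T[G]$. Then the refined ramification filtration has exactly two breaks, $b$ and $b_*=v_N((\Theta-1)\rho)-v_N(\rho)$, so that $$G^{\mathbb F}=\langle\Theta,\sigma\rangle=G^{\mathcal F,\rho}_b\supsetneq G^{\mathcal F,\rho}_{b+1}=\langle\Theta\rangle=G^{\mathcal F,\rho}_{b_*}\supsetneq G^{\mathcal F,\rho}_{b_*+1}=\{e\},$$ where $\langle\cdot\rangle$ denotes the $\mathbb F_q$-span of the images in $G^{\mathbb F}$. Moreover $b_*$ satisfies $b<b_*\le pb$ and is independent of the choices made (of the generators $\gamma,\sigma$ of $G$ and of the element $\rho$).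
   Context: $p$ is a prime; $K$ is a finite extension of $\mathbb Q_p$ with absolute ramification index $e_K$, inertia degree $f$, and residue field $\mathbb F_q$, $q=p^f$. $T$ is the maximal unramified extension of $\mathbb Q_p$ inside $K$. For a local field $F$, $\mathfrak O_F$ is its valuation ring, $\mathfrak P_F$ its maximal ideal, $v_F$ its normalized valuation. The ramification groups are $G_i=\{g\in G:(g-1)\mathfrak P_N\subset\mathfrak P_N^{i+1}\}$; "one ramification break at $b$" means $G_b=G$ and $G_{b+1}=\{1\}$. Truncated exponentiation: $(1+X)^{[Y]}:=\sum_{i=0}^{p-1}\binom{Y}{i}X^i\in\mathbb Z_{(p)}[X,Y]$. Thus $\sigma^{[\omega]}=\sum_{i=0}^{p-1}\binom{\omega}{i}(\sigma-1)^i$. $\mathcal A=(g-1:g\in G)$ is the augmentation ideal of $\mathfrak O_T[G]$, and $\mathcal G=(1+\mathcal A)/(1+\mathcal A^p)$. The map $(\omega,x)\mapsto x^{[\omega]}$ (lifting $\omega\in\mathbb F_q$ to $\mathfrak O_T$) makes the multiplicative group $\mathcal G$ an $\mathbb F_q$-vector space. $G^{\mathbb F}$ is the $\mathbb F_q$-span of the image of $G$ in $\mathcal G$; its identity element is denoted $e$. For $\alpha\in N$ with $v_N(\alpha)=b$ and $\bar x\in G^{\mathbb F}$ put $i_\alpha(\bar x)=\sup\{v_N((x-1)\alpha): x\in 1+\mathcal A,\ x\cdot(1+\mathcal A^p)=\bar x\}$. The refined ramification filtration is $G^{\mathcal F,\alpha}_j=\{\bar x\in G^{\mathbb F}: i_\alpha(\bar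 x)\ge v_N(\alpha)+j\}$. Refined breaks are the integers $j$ with $G^{\mathcal F,\alpha}_j\supsetneq G^{\mathcal F,\alpha}_{j+1}$. *)

theory Defs
  imports
    "HOL-Library.Extended_Real"
    "HOL-Algebra.Elementary_Groups"
    "HOL-Algebra.Algebraic_Closure_Type"
    "HOL-Algebra.Ideal_Product"
begin

section \<open>Local fields of characteristic zero\<close>

text \<open>
  The top field \<open>N\<close> is the whole of a type of class \<^class>\<open>field_char_0\<close>; smaller fields are subsets
  of that type which are subfields of \<^const>\<open>ring_of_type_algebra\<close>.  Valuations take values in
  \<^typ>\<open>ereal\<close>, so that the value of \<open>0\<close> is \<open>\<infinity>\<close> and suprema always exist.
\<close>

abbreviation is_subfield :: "'a::field set \<Rightarrow> bool" where
  "is_subfield F \<equiv> subfield F (ring_of_type_algebra :: 'a ring)"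

abbreviation is_finite_ext :: "'a::field set \<Rightarrow> 'a set \<Rightarrow> bool" where
  "is_finite_ext E F \<equiv> ring.finite_dimension (ring_of_type_algebra :: 'a ring) E F"

definition normalized_valuation :: "'a::field set \<Rightarrow> ('a \<Rightarrow> ereal) \<Rightarrow> bool" where
  "normalized_valuation F v \<longleftrightarrow>
     (\<forall>x\<in>F. v x = \<infinity> \<longleftrightarrow> x = 0) \<and>
     v ` (F - {0}) = range (\<lambda>n::int. ereal (of_int n)) \<and>
     (\<forall>x\<in>F. \<forall>y\<in>F. v (x * y) = v x + v y) \<and>
     (\<forall>x\<in>F. \<forall>y\<in>F. v (x + y) \<ge> min (v x) (v y))"

definition rat_padic_val :: "nat \<Rightarrow> rat \<Rightarrow> ereal" where
  "rat_padic_val p r =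
     (if r = 0 then \<infinity>
      else ereal (real (multiplicity (int p) (fst (quotient_of r)))
                - real (multiplicity (int p) (snd (quotient_of r)))))"

text \<open>
  \<open>(E, w)\<close> is the field of \<open>p\<close>-adic numbers with its valuation, that is, the completion of the
  rationals with respect to the \<open>p\<close>-adic valuation.
\<close>

definition padic_numbers :: "nat \<Rightarrow> 'a::field_char_0 set \<Rightarrow> ('a \<Rightarrow> ereal) \<Rightarrow> bool" where
  "padic_numbers p E w \<longleftrightarrow>
     is_subfield E \<and> normalized_valuation E w \<and>
     (\<forall>r. w (of_rat r) = rat_padic_val p r) \<and>
     (\<forall>x\<in>E. \<forall>M::int. \<exists>r. w (x - of_rat r) \<ge> ereal (of_int M)) \<and>
     (\<forall>s::nat \<Rightarrow> 'a.
        range s \<subseteq> E \<and>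
        (\<forall>M::int. \<exists>k. \<forall>m\<ge>k. \<forall>n\<ge>k. w (s m - s n) \<ge> ereal (of_int M)) \<longrightarrow>
        (\<exists>l\<in>E. \<forall>M::int. \<exists>k. \<forall>n\<ge>k. w (s n - l) \<ge> ereal (of_int M)))"

text \<open>
  In the following, \<open>v\<close> is a valuation on an extension of \<open>F\<close>; a positive multiple of the normalized
  valuation of \<open>F\<close> gives the same valuation ring and maximal ideal.
\<close>

definition val_ring :: "('a::field \<Rightarrow> ereal) \<Rightarrow> 'a set \<Rightarrow> 'a set" where
  "val_ring v F = {x \<in> F. v x \<ge> 0}"

definition val_max_ideal :: "('a::field \<Rightarrow> ereal) \<Rightarrow> 'a set \<Rightarrow> 'a set" where
  "val_max_ideal v F = {x \<in> F. v x > 0}"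

definition residue_field :: "('a::field \<Rightarrow> ereal) \<Rightarrow> 'a set \<Rightarrow> 'a set ring" where
  "residue_field v F = (ring_of_type_algebra\<lparr>carrier := val_ring v F\<rparr>) Quot val_max_ideal v F"

text \<open>Ramification index one; residue extensions are separable here, the residue fields being finite.\<close>

definition unramified_ext :: "('a::field \<Rightarrow> ereal) \<Rightarrow> 'a set \<Rightarrow> 'a set \<Rightarrow> bool" where
  "unramified_ext v E F \<longleftrightarrow> v ` (F - {0}) = v ` (E - {0})"

definition max_unramified_ext ::
    "('a::field \<Rightarrow> ereal) \<Rightarrow> 'a set \<Rightarrow> 'a set \<Rightarrow> 'a set \<Rightarrow> bool" where
  "max_unramified_ext v E K T \<longleftrightarrow>
     is_subfield T \<and> E \<subseteq> T \<and> T \<subseteq> K \<and> unramified_ext v E T \<and>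
     (\<forall>F. is_subfield F \<and> E \<subseteq> F \<and> F \<subseteq> K \<and> unramified_ext v E F \<longrightarrow> F \<subseteq> T)"

text \<open>Residue degree one.\<close>

definition totally_ramified_ext :: "('a::field \<Rightarrow> ereal) \<Rightarrow> 'a set \<Rightarrow> 'a set \<Rightarrow> bool" where
  "totally_ramified_ext v E F \<longleftrightarrow>
     (\<forall>x\<in>val_ring v F. \<exists>y\<in>val_ring v E. x - y \<in> val_max_ideal v F)"

definition galois_group :: "'a::field set \<Rightarrow> ('a \<Rightarrow> 'a) monoid" where
  "galois_group K =
     \<lparr>carrier = {g \<in> ring_iso (ring_of_type_algebra :: 'a ring) ring_of_type_algebra. \<forall>x\<in>K. g x = x},
      monoid.mult = (\<circ>), one = id\<rparr>"

definition galois_ext :: "'a::field set \<Rightarrow> bool" where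
  "galois_ext K \<longleftrightarrow>
     is_subfield K \<and> is_finite_ext K UNIV \<and> {x. \<forall>g\<in>carrier (galois_group K). g x = x} = K"

text \<open>
  For the normalized valuation \<open>v\<close> of the top field, the \<open>i\<close>-th power of its maximal ideal is
  \<open>{x. v x \<ge> i}\<close>.
\<close>

definition ramification_group :: "('a::field \<Rightarrow> ereal) \<Rightarrow> 'a set \<Rightarrow> int \<Rightarrow> ('a \<Rightarrow> 'a) set" where
  "ramification_group v K i =
     {g \<in> carrier (galois_group K).
        \<forall>x\<in>val_max_ideal v UNIV. v (g x - x) \<ge> ereal (of_int (i + 1))}"

section \<open>Truncated exponentiation in group rings\<close>

text \<open>The group ring of a finite group \<open>G\<close> over the subring \<open>R\<close>.\<close>

definition group_ring ::
    "'a::comm_ring_1 set \<Rightarrow> ('g, 'm) monoid_scheme \<Rightarrow> ('g \<Rightarrow> 'a) ring" where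
  "group_ring R G =
     \<lparr>carrier = {x. (\<forall>g\<in>carrier G. x g \<in> R) \<and> (\<forall>g. g \<notin> carrier G \<longrightarrow> x g = 0)},
      monoid.mult = (\<lambda>x y g. if g \<in> carrier G
                             then \<Sum>h\<in>carrier G. x h * y (inv\<^bsub>G\<^esub> h \<otimes>\<^bsub>G\<^esub> g) else 0),
      one = (\<lambda>g. if g = \<one>\<^bsub>G\<^esub> then 1 else 0),
      ring.zero = (\<lambda>g. 0),
      add = (\<lambda>x y g. x g + y g)\<rparr>"

definition group_ring_of :: "'g \<Rightarrow> 'g \<Rightarrow> 'a::comm_ring_1" where
  "group_ring_of g = (\<lambda>h. if h = g then 1 else 0)"

definition group_ring_act ::
    "('a \<Rightarrow> 'a, 'm) monoid_scheme \<Rightarrow> (('a \<Rightarrow> 'a) \<Rightarrow> 'a) \<Rightarrow> 'a::comm_ring_1 \<Rightarrow> 'a" where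
  "group_ring_act G x \<alpha> = (\<Sum>g\<in>carrier G. x g * g \<alpha>)"

definition aug_ideal ::
    "'a::comm_ring_1 set \<Rightarrow> ('g, 'm) monoid_scheme \<Rightarrow> ('g \<Rightarrow> 'a) set" where
  "aug_ideal R G =
     Idl\<^bsub>group_ring R G\<^esub>
       ((\<lambda>g. group_ring_of g \<ominus>\<^bsub>group_ring R G\<^esub> \<one>\<^bsub>group_ring R G\<^esub>) ` carrier G)"

definition one_plus_aug ::
    "'a::comm_ring_1 set \<Rightarrow> ('g, 'm) monoid_scheme \<Rightarrow> ('g \<Rightarrow> 'a) monoid" where
  "one_plus_aug R G =
     \<lparr>carrier = \<one>\<^bsub>group_ring R G\<^esub> <+\<^bsub>group_ring R G\<^esub> aug_ideal R G,
      monoid.mult = monoid.mult (group_ring R G),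
      one = \<one>\<^bsub>group_ring R G\<^esub>\<rparr>"

definition one_plus_aug_pow ::
    "nat \<Rightarrow> 'a::comm_ring_1 set \<Rightarrow> ('g, 'm) monoid_scheme \<Rightarrow> ('g \<Rightarrow> 'a) set" where
  "one_plus_aug_pow p R G =
     \<one>\<^bsub>group_ring R G\<^esub> <+\<^bsub>group_ring R G\<^esub> (aug_ideal R G [^]\<^bsub>ideals_set (group_ring R G)\<^esub> p)"

definition trunc_group ::
    "nat \<Rightarrow> 'a::comm_ring_1 set \<Rightarrow> ('g, 'm) monoid_scheme \<Rightarrow> ('g \<Rightarrow> 'a) set monoid" where
  "trunc_group p R G = one_plus_aug R G Mod one_plus_aug_pow p R G"

definition trunc_class ::
    "nat \<Rightarrow> 'a::comm_ring_1 set \<Rightarrow> ('g, 'm) monoid_scheme \<Rightarrow> ('g \<Rightarrow> 'a) \<Rightarrow> ('g \<Rightarrow> 'a) set" where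
  "trunc_class p R G x = one_plus_aug_pow p R G #>\<^bsub>one_plus_aug R G\<^esub> x"

definition trunc_exp ::
    "nat \<Rightarrow> 'a::field_char_0 set \<Rightarrow> ('g, 'm) monoid_scheme \<Rightarrow> ('g \<Rightarrow> 'a) \<Rightarrow> 'a \<Rightarrow> ('g \<Rightarrow> 'a)" where
  "trunc_exp p R G x \<omega> =
     (\<lambda>g. \<Sum>i<p. (\<omega> gchoose i) *
        ((x \<ominus>\<^bsub>group_ring R G\<^esub> \<one>\<^bsub>group_ring R G\<^esub>) [^]\<^bsub>group_ring R G\<^esub> i) g)"

text \<open>
  The span over the residue field of \<open>R\<close>, whose elements act on the class of \<open>x\<close> through their
  lifts \<open>\<omega> \<in> R\<close>, sending it to the class of \<open>trunc_exp p R G x \<omega>\<close>.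
\<close>

definition trunc_span ::
    "nat \<Rightarrow> 'a::field_char_0 set \<Rightarrow> ('g, 'm) monoid_scheme \<Rightarrow>
     ('g \<Rightarrow> 'a) set set \<Rightarrow> ('g \<Rightarrow> 'a) set set" where
  "trunc_span p R G S =
     \<Inter>{H. subgroup H (trunc_group p R G) \<and> S \<subseteq> H \<and>
          (\<forall>\<omega>\<in>R. \<forall>x\<in>carrier (one_plus_aug R G).
             trunc_class p R G x \<in> H \<longrightarrow> trunc_class p R G (trunc_exp p R G x \<omega>) \<in> H)}"

section \<open>The refined ramification filtration\<close>

definition refined_group ::
    "nat \<Rightarrow> 'a::field_char_0 set \<Rightarrow> ('g, 'm) monoid_scheme \<Rightarrow> ('g \<Rightarrow> 'a) set set" where
  "refined_group p R G = trunc_span p R G ((\<lambda>g. trunc_class p R G (group_ring_of g)) ` carrier G)"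

definition refined_index ::
    "nat \<Rightarrow> 'a::field_char_0 set \<Rightarrow> ('a \<Rightarrow> 'a, 'm) monoid_scheme \<Rightarrow> ('a \<Rightarrow> ereal) \<Rightarrow> 'a \<Rightarrow>
     (('a \<Rightarrow> 'a) \<Rightarrow> 'a) set \<Rightarrow> ereal" where
  "refined_index p R G v \<alpha> C =
     Sup {v (group_ring_act G (x \<ominus>\<^bsub>group_ring R G\<^esub> \<one>\<^bsub>group_ring R G\<^esub>) \<alpha>) | x.
           x \<in> carrier (one_plus_aug R G) \<and> trunc_class p R G x = C}"

definition refined_filtration ::
    "nat \<Rightarrow> 'a::field_char_0 set \<Rightarrow> ('a \<Rightarrow> 'a, 'm) monoid_scheme \<Rightarrow> ('a \<Rightarrow> ereal) \<Rightarrow> 'a \<Rightarrow>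
     int \<Rightarrow> (('a \<Rightarrow> 'a) \<Rightarrow> 'a) set set" where
  "refined_filtration p R G v \<alpha> j =
     {C \<in> refined_group p R G. refined_index p R G v \<alpha> C \<ge> v \<alpha> + ereal (of_int j)}"

definition refined_breaks ::
    "nat \<Rightarrow> 'a::field_char_0 set \<Rightarrow> ('a \<Rightarrow> 'a, 'm) monoid_scheme \<Rightarrow> ('a \<Rightarrow> ereal) \<Rightarrow> 'a \<Rightarrow> int set" where
  "refined_breaks p R G v \<alpha> =
     {j. refined_filtration p R G v \<alpha> (j + 1) \<subset> refined_filtration p R G v \<alpha> j}"

end

theory Submission
  imports
    Defs
    "HOL-Computational_Algebra.Computational_Algebra"
    "HOL-Number_Theory.Number_Theory"
begin

text \<open>
  Write \<open>Y = \<sigma> - 1\<close> and \<open>D = \<Theta> - 1\<close>, where \<open>\<Theta>\<close> acts on the top field through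
  \<open>\<gamma> (\<Sum>i<p. (\<omega> gchoose i) * Y ^^ i)\<close>, and say that an operator raises an element \<open>x\<close> by \<open>s\<close> if it
  maps it to an element of value at least \<open>v x + s\<close>.

  One ramification break means that \<open>g - 1\<close>, for \<open>g \<noteq> id\<close> in the Galois group, raises everything by
  \<open>b\<close>, raises elements of value prime to \<open>p\<close> by exactly \<open>b\<close>, and raises elements of value divisible
  by \<open>p\<close> by more than \<open>b\<close> (\<open>raise_b\<close>, \<open>raise_not_dvd\<close>, \<open>raise_dvd\<close>).  Because the group is not
  cyclic, \<open>p\<close> does not divide \<open>b\<close> (\<open>not_dvd_b\<close>).  Hence \<open>(\<gamma> - 1) \<rho>\<close> and \<open>(\<sigma> - 1) \<rho>\<close> both have value
  \<open>2 b\<close>, the Teichmueller representative of minus their quotient is \<open>\<omega>\<close>, and this choice cancels the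
  leading term of \<open>D \<rho>\<close>, so that \<open>D\<close> raises \<open>\<rho>\<close> by some \<open>b' > b\<close>.

  The main point is that \<open>\<Theta>\<close> is nearly a ring homomorphism.  An automorphism is multiplicative, so
  its powers \<open>\<sigma> ^^ n\<close> are; expanding \<open>\<sigma> ^^ n\<close> by Newton's formula and replacing \<open>n\<close> by \<open>\<omega>\<close>, the
  failure of multiplicativity is a combination of the products \<open>(Y ^^ i) x * (Y ^^ j) y\<close> with
  integral coefficients that vanish unless \<open>i + j \<ge> p\<close> (\<open>trunc_defect\<close>).  Such products are raised by
  \<open>p b\<close>.  Consequently, for \<open>s \<le> p b\<close> the elements that \<open>D\<close> raises by \<open>s\<close> are closed under
  multiplication.  The powers of \<open>\<rho>\<close>, scaled by \<open>K\<close>, take every value, as \<open>p\<close> does not divide \<open>b\<close>;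
  so \<open>D\<close> raises everything by \<open>s\<close> once it raises \<open>\<rho>\<close> by \<open>s\<close> (\<open>vge_D_all\<close>).  This makes
  \<open>b'\<close> independent of \<open>\<rho>\<close>.  The same defect gives \<open>b' \<le> p b\<close> (\<open>D_bound\<close>): its leading coefficient
  for the pair \<open>\<rho>\<close>, \<open>(Y ^^ (p - 2)) \<rho>\<close> is \<open>p * (\<omega> gchoose p)\<close>, a unit because \<open>\<omega>\<close> is not congruent
  to an integer, and all the other terms of the product rule would be too small if \<open>b'\<close> exceeded
  \<open>p b\<close>.

  In the group ring the same identity, now read modulo the \<open>p\<close>-th power of the augmentation ideal,
  turns truncated exponentiation into a vector space structure (\<open>te_add\<close>, \<open>te_mult\<close>, \<open>te_te\<close>,
  \<open>te_p_mult\<close>), so the refined group consists of the classes of \<open>\<Theta>^[a] \<sigma>^[c]\<close>.  The \<open>p\<close>-th power of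
  the augmentation ideal maps \<open>\<rho>\<close> to elements of value greater than \<open>b + p b\<close> (\<open>act_I\<close>), which is
  too much to change anything up to \<open>b'\<close>; so the value of \<open>(x - 1) \<rho>\<close> depends only on the class of
  \<open>x\<close>.  It is \<open>2 b\<close> if \<open>c\<close> is a unit (\<open>rindex_transversal\<close>), and \<open>b + b'\<close> if \<open>c = 0\<close> and \<open>a\<close> is a unit
  (\<open>rindex_line\<close>).  This is the asserted filtration.  Its breaks are \<open>b\<close> and \<open>b'\<close>, and since the set
  of breaks does not involve the generators, \<open>b'\<close> does not depend on them either.
\<close>

section \<open>Valuations\<close>

locale valued =
  fixes v :: "'a::field_char_0 \<Rightarrow> ereal"
  assumes nv: "normalized_valuation UNIV v"
begin

text \<open>
  Comparisons of values are stated with integers, so that linear arithmetic over \<open>int\<close> applies; the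
  value \<open>\<infinity>\<close> of \<open>0\<close> is covered by \<open>vge\<close> and excluded by \<open>veq\<close>.
\<close>

definition vge :: "int \<Rightarrow> 'a \<Rightarrow> bool" where
  "vge n x \<longleftrightarrow> ereal (of_int n) \<le> v x"

definition veq :: "int \<Rightarrow> 'a \<Rightarrow> bool" where
  "veq n x \<longleftrightarrow> v x = ereal (of_int n)"

lemma v_zero_iff: "v x = \<infinity> \<longleftrightarrow> x = 0"
  using nv by (simp add: normalized_valuation_def)

lemma v_0 [simp]: "v 0 = \<infinity>"
  by (simp add: v_zero_iff)

lemma v_mult: "v (x * y) = v x + v y"
  using nv by (simp add: normalized_valuation_def)

lemma v_add: "min (v x) (v y) \<le> v (x + y)"
  using nv by (simp add: normalized_valuation_def)

lemma ex_veq: "x \<noteq> 0 \<Longrightarrow> \<exists>n. veq n x"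
proof -
  assume "x \<noteq> 0"
  hence "v x \<in> v ` (UNIV - {0})" by blast
  also have "\<dots> = range (\<lambda>n::int. ereal (of_int n))"
    using nv by (simp add: normalized_valuation_def)
  finally show "\<exists>n. veq n x" by (auto simp: veq_def)
qed

lemma veq_surj: "\<exists>x. veq n x"
proof -
  have "ereal (of_int n) \<in> v ` (UNIV - {0})"
    using nv by (simp add: normalized_valuation_def)
  thus ?thesis by (auto simp: veq_def)
qed

lemma veq_nonzero: "veq n x \<Longrightarrow> x \<noteq> 0"
  by (auto simp: veq_def)

lemma veq_unique: "veq n x \<Longrightarrow> veq m x \<Longrightarrow> n = m"
  by (auto simp: veq_def)

lemma veq_vge: "veq n x \<Longrightarrow> vge n x"
  by (simp add: veq_def vge_def)

lemma vge_0 [simp]: "vge n 0"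
  by (simp add: vge_def)

lemma vge_mono: "vge n x \<Longrightarrow> m \<le> n \<Longrightarrow> vge m x"
  unfolding vge_def by (erule order_trans[rotated]) simp

lemma vge_veq_iff: "veq n x \<Longrightarrow> vge m x \<longleftrightarrow> m \<le> n"
  by (simp add: veq_def vge_def)

lemma veq_iff: "veq n x \<longleftrightarrow> vge n x \<and> \<not> vge (n + 1) x"
proof (cases "x = 0")
  case False
  then obtain m where "veq m x" using ex_veq by blast
  thus ?thesis by (auto simp: veq_def vge_def)
qed (auto dest: veq_nonzero)

lemma vge_add: "vge n x \<Longrightarrow> vge n y \<Longrightarrow> vge n (x + y)"
  unfolding vge_def by (rule order_trans[OF _ v_add]) simp

lemma vge_mult: "vge n x \<Longrightarrow> vge m y \<Longrightarrow> vge (n + m) (x * y)"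
  unfolding vge_def v_mult of_int_add plus_ereal.simps(1)[symmetric] by (rule add_mono)

lemma veq_mult: "veq n x \<Longrightarrow> veq m y \<Longrightarrow> veq (n + m) (x * y)"
  unfolding veq_def v_mult by simp

lemma veq_1 [simp]: "veq 0 1"
proof -
  obtain n where n: "veq n 1" using ex_veq[of 1] by auto
  from veq_mult[OF n n] have "veq (n + n) 1" by simp
  with n have "n + n = n" using veq_unique by blast
  with n show ?thesis by simp
qed

lemma veq_m1: "veq 0 (-1)"
proof -
  obtain n where n: "veq n (-1)" using ex_veq[of "-1"] by auto
  from veq_mult[OF n n] have "veq (n + n) 1" by simp
  with veq_1 have "n + n = 0" using veq_unique by blast
  with n show ?thesis by simp
qed

lemma v_uminus: "v (- x) = v x"
  using v_mult[of "-1" x] veq_m1 by (simp add: veq_def zero_ereal_def[symmetric])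

lemma vge_uminus [simp]: "vge n (- x) \<longleftrightarrow> vge n x"
  by (simp add: vge_def v_uminus)

lemma veq_uminus [simp]: "veq n (- x) \<longleftrightarrow> veq n x"
  by (simp add: veq_def v_uminus)

lemma vge_diff: "vge n x \<Longrightarrow> vge n y \<Longrightarrow> vge n (x - y)"
  using vge_add[of n x "- y"] by simp

lemma vge_minus_commute: "vge n (x - y) \<longleftrightarrow> vge n (y - x)"
  by (metis minus_diff_eq vge_uminus)

lemma vge_sum: "(\<And>i. i \<in> I \<Longrightarrow> vge n (f i)) \<Longrightarrow> vge n (sum f I)"
  by (induction I rule: infinite_finite_induct) (auto intro: vge_add)

lemma vge_1 [simp]: "vge 0 1"
  by (rule veq_vge) simp

lemma vge_of_nat [simp]: "vge 0 (of_nat k)"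
  by (induction k) (auto intro: vge_add)

lemma vge_of_int [simp]: "vge 0 (of_int k)"
  by (cases k rule: int_cases2) auto

lemma vge_numeral [simp]: "vge 0 (numeral k)"
  by (metis of_nat_numeral vge_of_nat)

lemma vge_mult0: "vge 0 c \<Longrightarrow> vge n x \<Longrightarrow> vge n (c * x)"
  using vge_mult[of 0 c n x] by simp

lemma vge_mult0': "vge n x \<Longrightarrow> vge 0 c \<Longrightarrow> vge n (x * c)"
  using vge_mult[of n x 0 c] by simp

lemma vge_power: "vge n x \<Longrightarrow> vge (int k * n) (x ^ k)"
proof (induction k)
  case (Suc k)
  from vge_mult[OF Suc.prems Suc.IH[OF Suc.prems]] show ?case by (simp add: algebra_simps)
qed simp

lemma vge_power0: "vge 0 x \<Longrightarrow> vge 0 (x ^ k)"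
  using vge_power[of 0 x k] by simp

lemma veq_power: "veq n x \<Longrightarrow> veq (int k * n) (x ^ k)"
proof (induction k)
  case (Suc k)
  from veq_mult[OF Suc.prems Suc.IH[OF Suc.prems]] show ?case by (simp add: algebra_simps)
qed simp

lemma vge_prod0: "(\<And>i. i \<in> I \<Longrightarrow> vge 0 (f i)) \<Longrightarrow> vge 0 (prod f I)"
  by (induction I rule: infinite_finite_induct) (auto intro: vge_mult0)

lemma veq_prod0: "(\<And>i. i \<in> I \<Longrightarrow> veq 0 (f i)) \<Longrightarrow> veq 0 (prod f I)"
proof (induction I rule: infinite_finite_induct)
  case (insert x F) thus ?case using veq_mult[of 0 "f x" 0 "prod f F"] by simp
qed auto

lemma veq_inverse: assumes "veq n x" shows "veq (- n) (inverse x)"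
proof -
  have x: "x \<noteq> 0" using assms veq_nonzero by blast
  then obtain m where m: "veq m (inverse x)" using ex_veq[of "inverse x"] by auto
  from veq_mult[OF assms m] x have "veq (n + m) 1" by simp
  hence "n + m = 0" using veq_1 veq_unique by blast
  thus ?thesis using m by (simp add: add_eq_0_iff)
qed

lemma vge_divide: "vge n x \<Longrightarrow> veq m y \<Longrightarrow> vge (n - m) (x / y)"
  using vge_mult[of n x "- m" "inverse y"] veq_vge[OF veq_inverse[of m y]]
  by (simp add: divide_inverse)

lemma veq_divide: "veq n x \<Longrightarrow> veq m y \<Longrightarrow> veq (n - m) (x / y)"
  using veq_mult[of n x "- m" "inverse y"] veq_inverse[of m y]
  by (simp add: divide_inverse)

lemma vge_cancel: assumes "veq m y" "vge (m + n) (y * x)" shows "vge n x"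
  using vge_divide[OF assms(2,1)] veq_nonzero[OF assms(1)] by simp

lemma veq_add: assumes "veq n x" "vge (n + 1) y" shows "veq n (x + y)"
proof -
  have "vge n (x + y)" using assms by (intro vge_add) (auto intro: veq_vge vge_mono)
  moreover have "\<not> vge (n + 1) (x + y)"
  proof
    assume "vge (n + 1) (x + y)"
    hence "vge (n + 1) (x + y - y)" using assms(2) by (rule vge_diff)
    thus False using assms(1) by (simp add: veq_iff)
  qed
  ultimately show ?thesis by (simp add: veq_iff)
qed

lemma veq_cong: "veq n x \<Longrightarrow> vge (n + 1) (y - x) \<Longrightarrow> veq n y"
  using veq_add[of n x "y - x"] by simp

lemma vge_all_imp_0: assumes "\<And>n. vge n x" shows "x = 0"
  using assms ex_veq veq_iff by blast

lemma vge_imp_veq: assumes "vge n x" "\<not> vge (n + 1) x" shows "veq n x"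
  using assms by (simp add: veq_iff)

end

section \<open>Truncated binomial series\<close>

definition binomial_mult_coeff :: "nat \<Rightarrow> nat \<Rightarrow> nat \<Rightarrow> nat" where
  "binomial_mult_coeff i j k = (if k \<le> i + j then (k choose i) * (i choose (i + j - k)) else 0)"

text \<open>
  Vandermonde's identity for \<open>(a - i) + i\<close> combined with trinomial revision; the coefficients are
  natural numbers independent of \<open>a\<close>.
\<close>

lemma gbinomial_mult:
  fixes a :: "'a::field_char_0"
  shows "(a gchoose i) * (a gchoose j) = (\<Sum>k\<le>i + j. (a gchoose k) * of_nat (binomial_mult_coeff i j k))"
proof -
  have "(a gchoose j) = (a - of_nat i) + of_nat i gchoose j" by simp
  also have "\<dots> = (\<Sum>m=0..j. (a - of_nat i gchoose m) * (of_nat i gchoose (j - m)))"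
    by (rule gbinomial_Vandermonde[symmetric])
  finally have "(a gchoose i) * (a gchoose j) =
      (\<Sum>m=0..j. (a gchoose i) * ((a - of_nat i gchoose m) * (of_nat i gchoose (j - m))))"
    by (simp add: sum_distrib_left)
  also have "\<dots> = (\<Sum>m=0..j. (a gchoose (m + i)) * of_nat (binomial_mult_coeff i j (m + i)))"
  proof (rule sum.cong[OF refl])
    fix m assume "m \<in> {0..j}"
    hence m: "m \<le> j" by simp
    have "(a gchoose (m + i)) * (of_nat (m + i) gchoose i) = (a gchoose i) * (a - of_nat i gchoose m)"
      using gbinomial_trinomial_revision[of i "m + i" a] by simp
    moreover have "(of_nat i gchoose (j - m) :: 'a) = of_nat (i choose (j - m))"
      by (rule binomial_gbinomial[symmetric])
    moreover have "(of_nat (m + i) gchoose i :: 'a) = of_nat (m + i choose i)"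
      by (rule binomial_gbinomial[symmetric])
    moreover have "binomial_mult_coeff i j (m + i) = (m + i choose i) * (i choose (j - m))"
      using m by (simp add: binomial_mult_coeff_def)
    ultimately show "(a gchoose i) * ((a - of_nat i gchoose m) * (of_nat i gchoose (j - m))) =
        (a gchoose (m + i)) * of_nat (binomial_mult_coeff i j (m + i))"
      by (simp only: of_nat_mult) (simp only: mult.assoc[symmetric])
  qed
  also have "\<dots> = (\<Sum>k=i..j + i. (a gchoose k) * of_nat (binomial_mult_coeff i j k))"
    using sum.shift_bounds_cl_nat_ivl[of "\<lambda>k. (a gchoose k) * of_nat (binomial_mult_coeff i j k)" 0 i j]
    by simp
  also have "\<dots> = (\<Sum>k\<le>i + j. (a gchoose k) * of_nat (binomial_mult_coeff i j k))"
    by (rule sum.mono_neutral_left) (auto simp: binomial_mult_coeff_def)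
  finally show ?thesis .
qed

text \<open>
  The matrix of the numbers \<open>n choose k\<close> is unitriangular.
\<close>

lemma newton_coeffs_zero:
  fixes c :: "nat \<Rightarrow> 'a::comm_ring_1"
  assumes "m \<le> N" and "\<And>n. n < m \<Longrightarrow> (\<Sum>k<N. of_nat (n choose k) * c k) = 0" and "k < m"
  shows "c k = 0"
  using assms(3)
proof (induction k rule: less_induct)
  case (less k)
  have "0 = (\<Sum>i<N. of_nat (k choose i) * c i)" using assms(2) less.prems by simp
  also have "\<dots> = (\<Sum>i\<in>{k}. of_nat (k choose i) * c i)"
  proof (rule sum.mono_neutral_right)
    show "\<forall>i\<in>{..<N} - {k}. of_nat (k choose i) * c i = 0"
    proof
      fix i assume i: "i \<in> {..<N} - {k}"
      show "of_nat (k choose i) * c i = 0"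
        using less.IH[of i] less.prems i by (cases "i < k") (auto simp: not_less binomial_eq_0)
    qed
  qed (use assms(1) less.prems in auto)
  finally show ?case by simp
qed

text \<open>
  The part of \<open>gbinomial_mult\<close> that truncation at \<open>p\<close> cuts off.
\<close>

definition trunc_defect_coeff :: "nat \<Rightarrow> 'a::field_char_0 \<Rightarrow> nat \<Rightarrow> nat \<Rightarrow> 'a" where
  "trunc_defect_coeff p a i j = (\<Sum>k=p..<2*p. (a gchoose k) * of_nat (binomial_mult_coeff i j k))"

text \<open>
  The identity behind all multiplicativity statements.  The hypothesis says that two expressions
  in binomial coefficients agree at the integers \<open>n < p\<close>, where the full Newton series coincide with
  the truncated ones.  By \<open>gbinomial_mult\<close> the left-hand side is a combination of \<open>a gchoose k\<close> with
  \<open>k < 2 * p\<close> whose coefficients do not depend on \<open>a\<close>; those with \<open>k < p\<close> vanish since they vanish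
  at all \<open>n < p\<close>, and only the tail remains.
\<close>

lemma trunc_defect:
  fixes M :: "nat \<Rightarrow> nat \<Rightarrow> 'a::field_char_0"
  assumes nat: "\<And>n. n < p \<Longrightarrow>
      (\<Sum>i<p. \<Sum>j<p. of_nat (n choose i) * of_nat (n choose j) * M i j) =
      (\<Sum>k<p. of_nat (n choose k) * W k)"
  shows "(\<Sum>i<p. \<Sum>j<p. (a gchoose i) * (a gchoose j) * M i j) - (\<Sum>k<p. (a gchoose k) * W k) =
         (\<Sum>i<p. \<Sum>j<p. trunc_defect_coeff p a i j * M i j)"
proof -
  define c0 where "c0 = (\<lambda>k. \<Sum>i<p. \<Sum>j<p. of_nat (binomial_mult_coeff i j k) * M i j)"
  define c where "c = (\<lambda>k. c0 k - (if k < p then W k else 0))"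
  have expand: "(\<Sum>i<p. \<Sum>j<p. (a gchoose i) * (a gchoose j) * M i j) = (\<Sum>k<2*p. (a gchoose k) * c0 k)"
    for a
  proof -
    have "(\<Sum>i<p. \<Sum>j<p. (a gchoose i) * (a gchoose j) * M i j) =
        (\<Sum>i<p. \<Sum>j<p. \<Sum>k<2*p. (a gchoose k) * of_nat (binomial_mult_coeff i j k) * M i j)"
    proof (intro sum.cong refl)
      fix i j assume ij: "i \<in> {..<p}" "j \<in> {..<p}"
      have "(\<Sum>k\<le>i + j. (a gchoose k) * of_nat (binomial_mult_coeff i j k)) =
          (\<Sum>k<2*p. (a gchoose k) * of_nat (binomial_mult_coeff i j k))"
        using ij by (intro sum.mono_neutral_left) (auto simp: binomial_mult_coeff_def)
      thus "(a gchoose i) * (a gchoose j) * M i j =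
          (\<Sum>k<2*p. (a gchoose k) * of_nat (binomial_mult_coeff i j k) * M i j)"
        by (simp add: gbinomial_mult sum_distrib_right)
    qed
    also have "\<dots> = (\<Sum>i<p. \<Sum>k<2*p. \<Sum>j<p. (a gchoose k) * of_nat (binomial_mult_coeff i j k) * M i j)"
      by (intro sum.cong refl sum.swap)
    also have "\<dots> = (\<Sum>k<2*p. \<Sum>i<p. \<Sum>j<p. (a gchoose k) * of_nat (binomial_mult_coeff i j k) * M i j)"
      by (rule sum.swap)
    also have "\<dots> = (\<Sum>k<2*p. (a gchoose k) * c0 k)"
      by (simp add: c0_def sum_distrib_left mult.assoc)
    finally show ?thesis .
  qed
  have W: "(\<Sum>k<p. (a gchoose k) * W k) = (\<Sum>k<2*p. (a gchoose k) * (if k < p then W k else 0))" for a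
  proof -
    have "(\<Sum>k<2*p. (a gchoose k) * (if k < p then W k else 0)) =
        (\<Sum>k<p. (a gchoose k) * (if k < p then W k else 0))"
      by (rule sum.mono_neutral_right) auto
    thus ?thesis by simp
  qed
  have diff: "(\<Sum>i<p. \<Sum>j<p. (a gchoose i) * (a gchoose j) * M i j) - (\<Sum>k<p. (a gchoose k) * W k) =
      (\<Sum>k<2*p. (a gchoose k) * c k)" for a
    by (simp add: expand W c_def right_diff_distrib sum_subtractf)
  have zero: "c k = 0" if "k < p" for k
  proof (rule newton_coeffs_zero[of p "2 * p"])
    fix n assume "n < p"
    from nat[OF this] diff[of "of_nat n"] show "(\<Sum>k<2*p. of_nat (n choose k) * c k) = 0"
      by (simp add: binomial_gbinomial[symmetric])
  qed (use that in auto)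
  have "(\<Sum>k<2*p. (a gchoose k) * c k) = (\<Sum>k=p..<2*p. (a gchoose k) * c k)"
    by (rule sum.mono_neutral_right) (auto simp: zero)
  also have "\<dots> = (\<Sum>k=p..<2*p. (a gchoose k) * c0 k)"
    by (rule sum.cong) (auto simp: c_def)
  also have "\<dots> = (\<Sum>k=p..<2*p. \<Sum>i<p. \<Sum>j<p. (a gchoose k) * of_nat (binomial_mult_coeff i j k) * M i j)"
    by (simp add: c0_def sum_distrib_left mult.assoc)
  also have "\<dots> = (\<Sum>i<p. \<Sum>k=p..<2*p. \<Sum>j<p. (a gchoose k) * of_nat (binomial_mult_coeff i j k) * M i j)"
    by (rule sum.swap)
  also have "\<dots> = (\<Sum>i<p. \<Sum>j<p. \<Sum>k=p..<2*p. (a gchoose k) * of_nat (binomial_mult_coeff i j k) * M i j)"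
    by (intro sum.cong refl sum.swap)
  also have "\<dots> = (\<Sum>i<p. \<Sum>j<p. trunc_defect_coeff p a i j * M i j)"
    by (simp add: trunc_defect_coeff_def sum_distrib_right)
  finally show ?thesis using diff by simp
qed

lemma trunc_defect_coeff_eq_0: "i + j < p \<Longrightarrow> trunc_defect_coeff p a i j = 0"
  by (simp add: trunc_defect_coeff_def binomial_mult_coeff_def)

text \<open>
  This coefficient decides \<open>D_bound\<close>, where all other terms of the defect are too small to matter.
\<close>

lemma trunc_defect_coeff_top:
  assumes "1 < p"
  shows "trunc_defect_coeff p a (p - 1) 1 = of_nat p * (a gchoose p)"
proof -
  have "trunc_defect_coeff p a (p - 1) 1 =
      (\<Sum>k\<in>{p}. (a gchoose k) * of_nat (binomial_mult_coeff (p - 1) 1 k))"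
    unfolding trunc_defect_coeff_def
    by (rule sum.mono_neutral_right) (use assms in \<open>auto simp: binomial_mult_coeff_def\<close>)
  moreover have "binomial_mult_coeff (p - 1) 1 p = p"
    using assms binomial_symmetric[of "p - 1" p] by (simp add: binomial_mult_coeff_def)
  ultimately show ?thesis by simp
qed

section \<open>Valuations of residue characteristic p\<close>

locale padic_valued = valued +
  fixes p :: nat and e :: int
  assumes p: "prime p" and e_pos: "0 < e" and veq_p: "veq e (of_nat p)"
begin

lemma p_gt_1: "1 < p"
  using p prime_gt_1_nat by blast

lemma vge_p: "vge 1 (of_nat p)"
  using veq_vge[OF veq_p] e_pos by (auto intro: vge_mono)

lemma vge_of_nat_dvd: "p dvd n \<Longrightarrow> vge 1 (of_nat n)"
  by (auto simp: vge_p vge_mult0')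

lemma veq_of_nat: assumes "\<not> p dvd n" shows "veq 0 (of_nat n)"
proof -
  have "coprime (int n) (int p)"
    using p assms by (metis coprime_commute coprime_int_iff prime_imp_coprime)
  then obtain a b where ab: "a * int n + b * int p = 1"
    using bezout_int[of "int n" "int p"] by (metis coprime_imp_gcd_eq_1)
  have one: "(of_int a * of_nat n + of_int b * of_nat p :: 'a) = 1"
    using arg_cong[OF ab, of "of_int :: int \<Rightarrow> 'a"] by simp
  have "\<not> vge 1 (of_nat n)"
  proof
    assume "vge 1 (of_nat n)"
    hence "vge 1 (of_int a * of_nat n + of_int b * of_nat p)"
      using vge_p by (intro vge_add vge_mult0) auto
    thus False using one veq_1 veq_iff by auto
  qed
  thus ?thesis using vge_imp_veq[of 0 "of_nat n"] by simp
qed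

lemma veq_fact: "k < p \<Longrightarrow> veq 0 (fact k)"
  using veq_of_nat[of "fact k"] prime_dvd_fact_iff[OF p, of k] by simp

lemma vge_gbinomial: assumes "vge 0 a" "k < p" shows "vge 0 (a gchoose k)"
proof -
  have "vge 0 ((\<Prod>i = 0..<k. a - of_nat i))"
    using assms(1) by (intro vge_prod0 vge_diff) auto
  from vge_divide[OF this veq_fact[OF assms(2)]] show ?thesis
    by (simp add: gbinomial_prod_rev)
qed

text \<open>
  For \<open>k < 2 * p\<close> the factorial of \<open>k\<close> contains the factor \<open>p\<close> only once.
\<close>

lemma vge_p_gbinomial: assumes "vge 0 a" "k < 2 * p" shows "vge 0 (of_nat p * (a gchoose k))"
proof (cases "k < p")
  case True thus ?thesis using vge_mult0 vge_gbinomial assms by simp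
next
  case False
  have "veq 0 (\<Prod>i\<in>{p<..k}. of_nat i)"
  proof (rule veq_prod0)
    fix i assume "i \<in> {p<..k}"
    hence i: "p < i" "i < p * 2" using assms(2) by auto
    have "\<not> p dvd i"
    proof
      assume "p dvd i"
      then obtain m where m: "i = p * m" by blast
      with i have "m < 2" "1 < m" by (auto simp: mult_less_cancel1[of p 1 m, simplified])
      thus False by simp
    qed
    thus "veq 0 (of_nat i)" by (rule veq_of_nat)
  qed
  moreover have "fact k = fact (p - 1) * of_nat p * (\<Prod>i\<in>{p<..k}. of_nat i :: 'a)"
  proof -
    have "{1..k} = {1..p} \<union> {p<..k}" using False p_gt_1 by auto
    hence "fact k = (\<Prod>i\<in>{1..p}. of_nat i) * (\<Prod>i\<in>{p<..k}. of_nat i :: 'a)"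
      by (simp add: fact_prod) (subst prod.union_disjoint; auto)
    also have "(\<Prod>i\<in>{1..p}. of_nat i :: 'a) = fact p" by (simp add: fact_prod)
    also have "\<dots> = fact (p - 1) * of_nat p"
      using fact_reduce[of p, where 'a='a] p_gt_1 by simp
    finally show ?thesis .
  qed
  ultimately have e: "of_nat p * (a gchoose k) =
       (\<Prod>i = 0..<k. a - of_nat i) / (fact (p - 1) * (\<Prod>i\<in>{p<..k}. of_nat i))"
    using p_gt_1 by (simp add: gbinomial_prod_rev)
  have "veq (0 + 0) (fact (p - 1) * (\<Prod>i\<in>{p<..k}. of_nat i))"
    using p_gt_1 by (intro veq_mult veq_fact \<open>veq 0 (\<Prod>i\<in>{p<..k}. of_nat i)\<close>) auto
  moreover have "vge 0 (\<Prod>i = 0..<k. a - of_nat i)"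
    using assms(1) by (intro vge_prod0 vge_diff) auto
  ultimately show ?thesis unfolding e using vge_divide by fastforce
qed

lemma veq_p_gbinomial_p:
  assumes "\<And>m. m < p \<Longrightarrow> veq 0 (a - of_nat m)"
  shows "veq 0 (of_nat p * (a gchoose p))"
proof -
  have "fact p = (of_nat p * fact (p - 1) :: 'a)"
    using fact_reduce[of p, where 'a='a] p_gt_1 by simp
  hence "of_nat p * (a gchoose p) = (\<Prod>i = 0..<p. a - of_nat i) / fact (p - 1)"
    using p_gt_1 by (simp add: gbinomial_prod_rev)
  moreover have "veq (0 - 0) ((\<Prod>i = 0..<p. a - of_nat i) / fact (p - 1))"
    using p_gt_1 assms by (intro veq_divide veq_prod0 veq_fact) auto
  ultimately show ?thesis by simp
qed

text \<open>
  The denominator \<open>p\<close> of \<open>a gchoose k\<close> cancels against \<open>k choose i\<close>, which is divisible by \<open>p\<close> when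
  \<open>i < p\<close> and \<open>p \<le> k \<le> i + j\<close>.
\<close>

lemma vge_trunc_defect_coeff:
  assumes "vge 0 a" "i < p" "j < p"
  shows "vge 0 (trunc_defect_coeff p a i j)"
  unfolding trunc_defect_coeff_def
proof (rule vge_sum)
  fix k assume k: "k \<in> {p..<2*p}"
  show "vge 0 ((a gchoose k) * of_nat (binomial_mult_coeff i j k))"
  proof (cases "k \<le> i + j")
    case True
    have "p dvd fact k" using k p prime_dvd_fact_iff by auto
    also have "fact k = fact i * fact (k - i) * (k choose i)"
      using binomial_fact_lemma[of i k] k assms by simp
    finally have "p dvd (k choose i)"
      using True assms p by (auto simp: prime_dvd_mult_iff prime_dvd_fact_iff)
    then obtain m where "k choose i = p * m" by blast
    hence eq: "(a gchoose k) * of_nat (binomial_mult_coeff i j k) =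
        (of_nat p * (a gchoose k)) * of_nat (m * (i choose (i + j - k)))"
      using True by (simp add: binomial_mult_coeff_def mult_ac)
    show ?thesis unfolding eq using k
      by (intro vge_mult0'[OF vge_p_gbinomial[OF assms(1)] vge_of_nat]) simp
  qed (simp add: binomial_mult_coeff_def)
qed

lemma vge_power_p_diff:
  assumes a: "vge n a" and c: "vge n c" and s: "vge (n + s) (a - c)" "1 \<le> s"
  shows "vge (int p * n + s + 1) (a ^ p - c ^ p)"
proof -
  define d where "d = a - c"
  have "a ^ p = (d + c) ^ p" by (simp add: d_def)
  also have "\<dots> = (\<Sum>k\<le>p. of_nat (p choose k) * d ^ k * c ^ (p - k))" by (rule binomial_ring)
  also have "{..p} = insert 0 {1..p}" by auto
  also have "(\<Sum>k\<in>insert 0 {1..p}. of_nat (p choose k) * d ^ k * c ^ (p - k)) =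
      c ^ p + (\<Sum>k\<in>{1..p}. of_nat (p choose k) * d ^ k * c ^ (p - k))" by simp
  finally have eq: "a ^ p - c ^ p = (\<Sum>k\<in>{1..p}. of_nat (p choose k) * d ^ k * c ^ (p - k))" by simp
  show ?thesis unfolding eq
  proof (rule vge_sum)
    fix k assume k: "k \<in> {1..p}"
    have base: "vge (int k * (n + s) + int (p - k) * n) (d ^ k * c ^ (p - k))"
      using s(1) c by (intro vge_mult vge_power) (auto simp: d_def)
    have sum: "int k * (n + s) + int (p - k) * n = int p * n + int k * s"
      using k by (simp add: algebra_simps of_nat_diff)
    show "vge (int p * n + s + 1) (of_nat (p choose k) * d ^ k * c ^ (p - k))"
    proof (cases "k = p")
      case True
      have "2 * s \<le> int p * s" using p_gt_1 s(2) by (intro mult_right_mono) auto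
      hence "s + 1 \<le> int p * s" using s(2) by linarith
      hence "vge (int p * n + s + 1) (d ^ k * c ^ (p - k))"
        using sum True vge_mono[OF base, of "int p * n + s + 1"] s(2) by simp
      thus ?thesis using True by simp
    next
      case False
      hence "p dvd (p choose k)" using k p by (intro dvd_choose_prime) auto
      hence "vge 1 (of_nat (p choose k))" by (rule vge_of_nat_dvd)
      from vge_mult[OF this base] have "vge (1 + (int p * n + int k * s)) (of_nat (p choose k) * (d ^ k * c ^ (p - k)))"
        by (simp add: sum)
      moreover have "1 * s \<le> int k * s" using k s(2) by (intro mult_right_mono) auto
      ultimately show ?thesis by (auto simp: mult.assoc intro: vge_mono)
    qed
  qed
qed

end

section \<open>Subfields and finite extensions\<close>

lemma rta_simps [simp]:
  "carrier (ring_of_type_algebra :: 'a::ring_1 ring) = UNIV"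
  "x \<otimes>\<^bsub>ring_of_type_algebra\<^esub> y = x * y"
  "x \<oplus>\<^bsub>ring_of_type_algebra\<^esub> y = x + y"
  "\<one>\<^bsub>ring_of_type_algebra\<^esub> = 1"
  "\<zero>\<^bsub>ring_of_type_algebra\<^esub> = 0"
  by (simp_all add: ring_of_type_algebra_def)

lemma rta_a_inv [simp]: "\<ominus>\<^bsub>ring_of_type_algebra\<^esub> (x :: 'a::comm_ring_1) = - x"
proof -
  interpret ring "ring_of_type_algebra :: 'a ring" by (rule ring_from_type_algebra)
  show ?thesis using minus_equality[of "- x" x] by simp
qed

lemma is_subfieldD:
  fixes B :: "'a::field set"
  assumes "is_subfield B"
  shows "0 \<in> B" "1 \<in> B" "x \<in> B \<Longrightarrow> y \<in> B \<Longrightarrow> x + y \<in> B" "x \<in> B \<Longrightarrow> y \<in> B \<Longrightarrow> x * y \<in> B"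
    "x \<in> B \<Longrightarrow> - x \<in> B" "x \<in> B \<Longrightarrow> inverse x \<in> B"
    "x \<in> B \<Longrightarrow> y \<in> B \<Longrightarrow> x - y \<in> B" "x \<in> B \<Longrightarrow> y \<in> B \<Longrightarrow> x / y \<in> B"
proof -
  interpret ring "ring_of_type_algebra :: 'a ring" by (rule ring_from_type_algebra)
  note sr = subringE[OF subfieldE(1)[OF assms]]
  show 0: "0 \<in> B" and "1 \<in> B" using sr(2,3) by simp_all
  show add: "x \<in> B \<Longrightarrow> y \<in> B \<Longrightarrow> x + y \<in> B" and mult: "x \<in> B \<Longrightarrow> y \<in> B \<Longrightarrow> x * y \<in> B" for x y
    using sr(6,7)[of x y] by simp_all
  show minus: "x \<in> B \<Longrightarrow> - x \<in> B" for x
    using sr(5)[of x] by simp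
  show inv: "x \<in> B \<Longrightarrow> inverse x \<in> B" for x
  proof (cases "x = 0")
    case False
    assume "x \<in> B"
    with False have x: "x \<in> B - {\<zero>\<^bsub>ring_of_type_algebra\<^esub>}" by simp
    have "x * inv\<^bsub>ring_of_type_algebra\<^esub> x = 1" "inv\<^bsub>ring_of_type_algebra\<^esub> x \<in> B"
      using subfield_m_inv[OF assms x] by simp_all
    thus ?thesis using inverse_unique by metis
  qed (use 0 in simp)
  show "x \<in> B \<Longrightarrow> y \<in> B \<Longrightarrow> x - y \<in> B"
    using add[of x "- y"] minus[of y] by simp
  show "x \<in> B \<Longrightarrow> y \<in> B \<Longrightarrow> x / y \<in> B"
    using mult[of x "inverse y"] inv[of y] by (simp add: divide_inverse)
qed

lemma is_subfield_sum: "is_subfield B \<Longrightarrow> (\<And>i. i \<in> I \<Longrightarrow> f i \<in> B) \<Longrightarrow> sum f I \<in> B"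
  by (induction I rule: infinite_finite_induct) (auto simp: is_subfieldD)

lemma is_subfield_prod: "is_subfield B \<Longrightarrow> (\<And>i. i \<in> I \<Longrightarrow> f i \<in> B) \<Longrightarrow> prod f I \<in> B"
  by (induction I rule: infinite_finite_induct) (auto simp: is_subfieldD)

lemma is_subfield_power: "is_subfield B \<Longrightarrow> x \<in> B \<Longrightarrow> x ^ n \<in> B"
  by (induction n) (auto simp: is_subfieldD)

lemma is_subfield_of_nat: "is_subfield B \<Longrightarrow> of_nat n \<in> B"
  by (induction n) (auto simp: is_subfieldD)

lemma is_subfield_of_int: "is_subfield B \<Longrightarrow> of_int n \<in> B"
  by (cases n rule: int_cases2) (auto simp: is_subfieldD is_subfield_of_nat)

lemma is_subfield_of_rat: "is_subfield B \<Longrightarrow> of_rat r \<in> B"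
  by (cases r) (auto simp: of_rat_rat is_subfieldD is_subfield_of_int)

lemma is_subfield_gbinomial:
  fixes B :: "'a::field_char_0 set"
  assumes B: "is_subfield B" and a: "a \<in> B"
  shows "(a gchoose i) \<in> B"
proof -
  have "(fact i :: 'a) \<in> B" using is_subfield_of_nat[OF B, of "fact i"] by simp
  moreover have "(\<Prod>j = 0..<i. a - of_nat j) \<in> B"
    by (intro is_subfield_prod[OF B] is_subfieldD(7)[OF B] is_subfield_of_nat[OF B] a)
  ultimately show ?thesis unfolding gbinomial_prod_rev by (intro is_subfieldD(8)[OF B])
qed

text \<open>
  A finite extension is built from \<open>{0}\<close> by adjoining lines, one basis vector at a time.
\<close>

lemma is_finite_ext_induct [consumes 1, case_names zero line]:
  fixes B :: "'a::field set"
  assumes "is_finite_ext B E"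
    and P_0: "P {0}"
    and line: "\<And>b E. b \<notin> E \<Longrightarrow> P E \<Longrightarrow> P {c * b + y |c y. c \<in> B \<and> y \<in> E}"
  shows "P E"
proof -
  interpret ring "ring_of_type_algebra :: 'a ring" by (rule ring_from_type_algebra)
  from assms(1) obtain n where n: "dimension n B E" by (auto simp: finite_dimension_def)
  have ext: "line_extension B b E = {c * b + y |c y. c \<in> B \<and> y \<in> E}" for b E
    unfolding set_eq_iff line_extension_mem_iff by (simp only: rta_simps mem_Collect_eq) blast
  have "K = B \<longrightarrow> P E" if "dimension n K E" for n K E
    using that
  proof (induction rule: dimension.induct)
    case (Suc_dim b E n K)
    show ?case
    proof
      assume "K = B"
      with Suc_dim have "P E" "b \<notin> E" by simp_all
      from line[OF this(2,1)] show "P (line_extension K b E)" unfolding \<open>K = B\<close> ext .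
    qed
  qed (use P_0 in simp)
  with n show ?thesis by blast
qed

section \<open>Completeness\<close>

context valued
begin

definition vcomplete :: "'a set \<Rightarrow> bool" where
  "vcomplete B \<longleftrightarrow> (\<forall>s::nat \<Rightarrow> 'a. range s \<subseteq> B \<and>
      (\<forall>M. \<exists>k. \<forall>m\<ge>k. \<forall>n\<ge>k. vge M (s m - s n)) \<longrightarrow>
      (\<exists>l\<in>B. \<forall>M. \<exists>k. \<forall>n\<ge>k. vge M (s n - l)))"

lemma vcompleteD:
  fixes s :: "nat \<Rightarrow> 'a"
  assumes "vcomplete B" "\<And>n. s n \<in> B" "\<And>M. \<exists>k. \<forall>m\<ge>k. \<forall>n\<ge>k. vge M (s m - s n)"
  obtains l where "l \<in> B" "\<And>M. \<exists>k. \<forall>n\<ge>k. vge M (s n - l)"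
proof -
  have "range s \<subseteq> B" using assms(2) by blast
  hence "\<exists>l\<in>B. \<forall>M. \<exists>k. \<forall>n\<ge>k. vge M (s n - l)"
    using assms(1,3) unfolding vcomplete_def by blast
  with that show thesis by blast
qed

lemma vcomplete_geometric:
  assumes "vcomplete B" "\<And>n. s n \<in> B" and step: "\<And>n. vge (int n) (s (Suc n) - s n)"
  obtains l where "l \<in> B" "\<And>n. vge (int n) (s n - l)"
proof -
  have far: "vge (int n) (s (n + d) - s n)" for n d
  proof (induction d)
    case (Suc d)
    have "vge (int n) (s (Suc (n + d)) - s (n + d))"
      by (rule vge_mono[OF step]) simp
    from vge_add[OF this Suc] show ?case by simp
  qed simp
  have "\<exists>k. \<forall>m\<ge>k. \<forall>n\<ge>k. vge M (s m - s n)" for M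
  proof (intro exI[of _ "nat M"] allI impI)
    fix m n assume mn: "nat M \<le> m" "nat M \<le> n"
    have a: "vge (int (nat M)) (s m - s (nat M))" "vge (int (nat M)) (s n - s (nat M))"
      using far[of "nat M" "m - nat M"] far[of "nat M" "n - nat M"] mn by simp_all
    from vge_diff[OF this] have "vge (int (nat M)) (s m - s n)" by simp
    thus "vge M (s m - s n)" by (rule vge_mono) simp
  qed
  then obtain l where l: "l \<in> B" "\<And>M. \<exists>k. \<forall>n\<ge>k. vge M (s n - l)"
    using vcompleteD[OF assms(1), of s] assms(2) by metis
  have "vge (int n) (s n - l)" for n
  proof -
    from l(2)[of "int n"] obtain k where "\<forall>m\<ge>k. vge (int n) (s m - l)" ..
    hence "vge (int n) (s (n + k) - l)" by simp
    from vge_diff[OF this far[of n k]] show ?thesis by simp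
  qed
  show thesis by (rule that[OF l(1)]) fact
qed

text \<open>
  The vector \<open>b\<close> has positive distance from the complete space \<open>E\<close>, hence the coordinate along \<open>b\<close>
  is a bounded function.
\<close>

lemma vcomplete_line_bound:
  assumes B: "is_subfield B" and E: "vcomplete E" "\<And>c y. c \<in> B \<Longrightarrow> y \<in> E \<Longrightarrow> c * y \<in> E"
    and b: "b \<notin> E"
  obtains M where "\<And>n c y. c \<in> B \<Longrightarrow> y \<in> E \<Longrightarrow> vge n (c * b + y) \<Longrightarrow> vge (n - M) c"
proof -
  have "\<exists>M::nat. \<forall>y\<in>E. \<not> vge (int M) (b - y)"
  proof (rule ccontr)
    assume "\<not> ?thesis"
    hence "\<forall>M::nat. \<exists>y\<in>E. vge (int M) (b - y)" by blast
    then obtain s where s: "\<And>M::nat. s M \<in> E" "\<And>M::nat. vge (int M) (b - s M)" by metis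
    have "vge (int n) (s (Suc n) - s n)" for n
    proof -
      have "vge (int n) (b - s (Suc n))" by (rule vge_mono[OF s(2)]) simp
      from vge_diff[OF s(2)[of n] this] show ?thesis by simp
    qed
    then obtain l where l: "l \<in> E" "\<And>n. vge (int n) (s n - l)"
      using vcomplete_geometric[OF E(1), of s] s(1) by blast
    have "vge n (b - l)" for n
    proof -
      have "vge (int (nat n)) (b - l)" using vge_add[OF s(2)[of "nat n"] l(2)[of "nat n"]] by simp
      thus ?thesis by (rule vge_mono) simp
    qed
    hence "b = l" using vge_all_imp_0[of "b - l"] by simp
    with l(1) b show False by simp
  qed
  then obtain M where M: "\<And>y. y \<in> E \<Longrightarrow> \<not> vge (int M) (b - y)" by blast
  show thesis
  proof (rule that)
    fix n c y assume c: "c \<in> B" and y: "y \<in> E" and n: "vge n (c * b + y)"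
    show "vge (n - int M) c"
    proof (cases "c = 0")
      case False
      then obtain k where k: "veq k c" using ex_veq by blast
      have "c * b + y = c * (b - (- 1 / c) * y)" using False by (simp add: field_simps)
      with n have "vge (k + (n - k)) (c * (b - (- 1 / c) * y))" by simp
      hence "vge (n - k) (b - (- 1 / c) * y)" by (rule vge_cancel[OF k])
      moreover have "- 1 / c \<in> B" using B c by (intro is_subfieldD)
      ultimately have "\<not> int M \<le> n - k" using M E(2) y vge_mono by blast
      thus ?thesis using k vge_veq_iff by simp
    qed simp
  qed
qed

lemma vcomplete_singleton_0: "vcomplete {0}"
  by (auto simp: vcomplete_def image_subset_iff)

lemma vcomplete_line:
  assumes B: "is_subfield B" "vcomplete B"
    and E: "vcomplete E" "\<And>c y. c \<in> B \<Longrightarrow> y \<in> E \<Longrightarrow> c * y \<in> E" "\<And>x y. x \<in> E \<Longrightarrow> y \<in> E \<Longrightarrow> x - y \<in> E"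
    and b: "b \<notin> E"
  shows "vcomplete {c * b + y |c y. c \<in> B \<and> y \<in> E}"
  unfolding vcomplete_def
proof (intro allI impI, elim conjE)
  fix s :: "nat \<Rightarrow> 'a"
  assume s: "range s \<subseteq> {c * b + y |c y. c \<in> B \<and> y \<in> E}"
  have "\<exists>c y. s n = c * b + y \<and> c \<in> B \<and> y \<in> E" for n
  proof -
    have "s n \<in> {c * b + y |c y. c \<in> B \<and> y \<in> E}" using s by (rule subsetD) simp
    thus ?thesis by blast
  qed
  then obtain c y where cy: "\<And>n. s n = c n * b + y n" "\<And>n. c n \<in> B" "\<And>n. y n \<in> E" by metis
  assume cauchy: "\<forall>M. \<exists>k. \<forall>m\<ge>k. \<forall>n\<ge>k. vge M (s m - s n)"
  obtain M0 where M0: "\<And>n c y. c \<in> B \<Longrightarrow> y \<in> E \<Longrightarrow> vge n (c * b + y) \<Longrightarrow> vge (n - M0) c"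
    using vcomplete_line_bound[OF B(1) E(1,2) b] by blast
  obtain B0 where B0: "vge B0 b" by (cases "b = 0") (auto dest: ex_veq intro: veq_vge)
  have c_cauchy: "\<exists>k. \<forall>m\<ge>k. \<forall>n\<ge>k. vge M (c m - c n)" for M
  proof -
    obtain k where k: "\<And>m n. m \<ge> k \<Longrightarrow> n \<ge> k \<Longrightarrow> vge (M + M0) (s m - s n)" using cauchy by blast
    have "vge M (c m - c n)" if "m \<ge> k" "n \<ge> k" for m n
    proof -
      have "s m - s n = (c m - c n) * b + (y m - y n)" by (simp add: cy algebra_simps)
      with k[OF that] have "vge (M + M0) ((c m - c n) * b + (y m - y n))" by simp
      from M0[OF _ _ this] show ?thesis using cy E(3) is_subfieldD(7)[OF B(1)] by simp
    qed
    thus ?thesis by blast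
  qed
  have y_cauchy: "\<exists>k. \<forall>m\<ge>k. \<forall>n\<ge>k. vge M (y m - y n)" for M
  proof -
    obtain k1 where k1: "\<And>m n. m \<ge> k1 \<Longrightarrow> n \<ge> k1 \<Longrightarrow> vge M (s m - s n)" using cauchy by blast
    obtain k2 where k2: "\<And>m n. m \<ge> k2 \<Longrightarrow> n \<ge> k2 \<Longrightarrow> vge (M - B0) (c m - c n)" using c_cauchy by blast
    have "vge M (y m - y n)" if "m \<ge> max k1 k2" "n \<ge> max k1 k2" for m n
    proof -
      have "vge (M - B0 + B0) ((c m - c n) * b)" using that by (intro vge_mult k2 B0) auto
      moreover have "y m - y n = (s m - s n) - (c m - c n) * b" by (simp add: cy algebra_simps)
      ultimately show ?thesis using vge_diff[OF k1[of m n]] that by simp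
    qed
    thus ?thesis by blast
  qed
  obtain lc where lc: "lc \<in> B" "\<And>M. \<exists>k. \<forall>n\<ge>k. vge M (c n - lc)"
    using vcompleteD[OF B(2) cy(2) c_cauchy] by blast
  obtain ly where ly: "ly \<in> E" "\<And>M. \<exists>k. \<forall>n\<ge>k. vge M (y n - ly)"
    using vcompleteD[OF E(1) cy(3) y_cauchy] by blast
  show "\<exists>l\<in>{c * b + y |c y. c \<in> B \<and> y \<in> E}. \<forall>M. \<exists>k. \<forall>n\<ge>k. vge M (s n - l)"
  proof (intro bexI[of _ "lc * b + ly"] allI)
    fix M
    obtain k1 where k1: "\<And>n. n \<ge> k1 \<Longrightarrow> vge (M - B0) (c n - lc)" using lc(2) by blast
    obtain k2 where k2: "\<And>n. n \<ge> k2 \<Longrightarrow> vge M (y n - ly)" using ly(2) by blast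
    have "vge M (s n - (lc * b + ly))" if n: "n \<ge> max k1 k2" for n
    proof -
      have "vge (M - B0 + B0) ((c n - lc) * b)" using n by (intro vge_mult k1 B0) auto
      from vge_add[OF this, of "y n - ly"] k2[of n] n show ?thesis by (simp add: cy algebra_simps)
    qed
    thus "\<exists>k. \<forall>n\<ge>k. vge M (s n - (lc * b + ly))" by blast
  qed (use lc(1) ly(1) in blast)
qed

text \<open>
  Completeness and boundedness of linear maps are proved by one induction, since both rest on the
  boundedness of the coordinates.
\<close>

lemma vcomplete_finite_ext_aux:
  assumes B: "is_subfield B" "vcomplete B" and E: "is_finite_ext B E"
    and g: "\<And>x y. g (x + y) = g x + g y" "\<And>c x. c \<in> B \<Longrightarrow> g (c * x) = c * g x"
  shows "vcomplete E \<and> (\<forall>c\<in>B. \<forall>y\<in>E. c * y \<in> E) \<and> (\<forall>x\<in>E. \<forall>y\<in>E. x - y \<in> E) \<and>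
         (\<exists>M. \<forall>n. \<forall>x\<in>E. vge n x \<longrightarrow> vge (n - M) (g x))"
    (is "?Q E")
  using E
proof (induction rule: is_finite_ext_induct[where P = ?Q])
  case zero
  have "g 0 = 0" using g(1)[of 0 0] by simp
  thus ?case by (auto simp: vcomplete_singleton_0)
next
  case (line b E)
  let ?E = "{c * b + y |c y. c \<in> B \<and> y \<in> E}"
  have E: "vcomplete E" "\<And>c y. c \<in> B \<Longrightarrow> y \<in> E \<Longrightarrow> c * y \<in> E" "\<And>x y. x \<in> E \<Longrightarrow> y \<in> E \<Longrightarrow> x - y \<in> E"
    using line by blast+
  obtain M where M: "\<And>n x. x \<in> E \<Longrightarrow> vge n x \<Longrightarrow> vge (n - M) (g x)" using line by blast
  have "vcomplete ?E" by (rule vcomplete_line[OF B E line(1)])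
  moreover have "c * x \<in> ?E" if "c \<in> B" "x \<in> ?E" for c x
  proof -
    from that(2) obtain d y where "x = d * b + y" "d \<in> B" "y \<in> E" by blast
    hence "c * x = (c * d) * b + c * y" "c * d \<in> B" "c * y \<in> E"
      using that(1) E(2) is_subfieldD(4)[OF B(1)] by (auto simp: algebra_simps)
    thus ?thesis by blast
  qed
  moreover have "x - x' \<in> ?E" if "x \<in> ?E" "x' \<in> ?E" for x x'
  proof -
    from that obtain d y d' y' where "x = d * b + y" "d \<in> B" "y \<in> E" "x' = d' * b + y'" "d' \<in> B" "y' \<in> E"
      by blast
    hence "x - x' = (d - d') * b + (y - y')" "d - d' \<in> B" "y - y' \<in> E"
      using E(3) is_subfieldD(7)[OF B(1)] by (auto simp: algebra_simps)
    thus ?thesis by blast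
  qed
  moreover have "\<exists>M. \<forall>n. \<forall>x\<in>?E. vge n x \<longrightarrow> vge (n - M) (g x)"
  proof -
    obtain M0 where M0: "\<And>n c y. c \<in> B \<Longrightarrow> y \<in> E \<Longrightarrow> vge n (c * b + y) \<Longrightarrow> vge (n - M0) c"
      using vcomplete_line_bound[OF B(1) E(1,2) line(1)] by blast
    obtain B0 where B0: "vge B0 b" by (cases "b = 0") (auto dest: ex_veq intro: veq_vge)
    obtain B1 where B1: "vge B1 (g b)" by (cases "g b = 0") (auto dest: ex_veq intro: veq_vge)
    define M1 where "M1 = max (M0 - B1) (M + max 0 (M0 - B0))"
    have "vge (n - M1) (g x)" if "x \<in> ?E" "vge n x" for n x
    proof -
      from that(1) obtain c y where x: "x = c * b + y" "c \<in> B" "y \<in> E" by blast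
      have c: "vge (n - M0) c" using M0[of c y n] x that(2) by simp
      have "vge (n - M0 + B0) (c * b)" by (rule vge_mult[OF c B0])
      hence "vge (n - max 0 (M0 - B0)) (c * b)" by (rule vge_mono) simp
      moreover have "vge (n - max 0 (M0 - B0)) x" by (rule vge_mono[OF that(2)]) simp
      ultimately have "vge (n - max 0 (M0 - B0)) (x - c * b)" by (intro vge_diff)
      hence "vge (n - max 0 (M0 - B0)) y" by (simp add: x)
      hence "vge (n - max 0 (M0 - B0) - M) (g y)" by (rule M[OF x(3)])
      hence 1: "vge (n - M1) (g y)" by (rule vge_mono) (simp add: M1_def)
      have "vge (n - M0 + B1) (c * g b)" by (rule vge_mult[OF c B1])
      hence 2: "vge (n - M1) (c * g b)" by (rule vge_mono) (simp add: M1_def)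
      show ?thesis using vge_add[OF 2 1] by (simp add: x g)
    qed
    thus ?thesis by blast
  qed
  ultimately show ?case by blast
qed

lemma vcomplete_finite_ext:
  "is_subfield B \<Longrightarrow> vcomplete B \<Longrightarrow> is_finite_ext B E \<Longrightarrow> vcomplete E"
  using vcomplete_finite_ext_aux[of B E "\<lambda>x. x"] by simp

lemma finite_ext_aut_bounded:
  assumes "is_subfield B" "vcomplete B" "is_finite_ext B UNIV"
    and "\<And>x y. g (x + y) = g x + g y" "\<And>c x. c \<in> B \<Longrightarrow> g (c * x) = c * g x"
  obtains M where "\<And>n x. vge n x \<Longrightarrow> vge (n - M) (g x)"
  using vcomplete_finite_ext_aux[OF assms] by blast

text \<open>
  An automorphism over a complete field changes values by a bounded amount; applied to the powers of
  \<open>x\<close>, the bound shows that it does not lower the value at all.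
\<close>

lemma finite_ext_aut_vge:
  assumes B: "is_subfield B" "vcomplete B" "is_finite_ext B UNIV"
    and g: "\<And>x y. g (x + y) = g x + g y" "\<And>x y. g (x * y) = g x * g y" "g 1 = 1"
      "\<And>c. c \<in> B \<Longrightarrow> g c = c"
    and x: "vge n x"
  shows "vge n (g x)"
proof -
  obtain M where M: "\<And>n x. vge n x \<Longrightarrow> vge (n - M) (g x)"
  proof (rule finite_ext_aut_bounded[OF B, of g])
    show "g (c * x) = c * g x" if "c \<in> B" for c x using g(2,4) that by simp
  qed (use g(1) that in blast)+
  have pow: "g (x ^ k) = g x ^ k" for k
    by (induction k) (simp_all add: g(2,3))
  show ?thesis
  proof (cases "g x = 0")
    case False
    then obtain m where m: "veq m (g x)" using ex_veq by blast
    have le: "int k * n - M \<le> int k * m" for k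
    proof -
      have "vge (int k * n - M) (g (x ^ k))" by (intro M vge_power x)
      moreover have "veq (int k * m) (g (x ^ k))" unfolding pow by (intro veq_power m)
      ultimately show ?thesis using vge_veq_iff by blast
    qed
    have "n \<le> m"
    proof (rule ccontr)
      assume "\<not> n \<le> m"
      hence "int (Suc (nat M)) * 1 \<le> int (Suc (nat M)) * (n - m)"
        by (intro mult_left_mono) auto
      also have "\<dots> \<le> M" using le[of "Suc (nat M)"] by (simp add: algebra_simps)
      finally show False by (simp split: if_splits)
    qed
    thus ?thesis using m vge_veq_iff by blast
  qed simp
qed

end

section \<open>Residue fields and Teichmueller representatives\<close>

context valued
begin

lemma vge_prod_diff:
  assumes "\<And>i. i \<in> I \<Longrightarrow> vge 0 (f i)" "\<And>i. i \<in> I \<Longrightarrow> vge 0 (g i)" "\<And>i. i \<in> I \<Longrightarrow> vge 1 (f i - g i)"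
  shows "vge 1 (prod f I - prod g I)"
  using assms
proof (induction I rule: infinite_finite_induct)
  case (insert x F)
  have "prod f (insert x F) - prod g (insert x F) = (f x - g x) * prod f F + g x * (prod f F - prod g F)"
    using insert.hyps by (simp add: algebra_simps)
  moreover have "vge 1 ((f x - g x) * prod f F)"
    using insert.prems by (intro vge_mult0' vge_prod0) auto
  moreover have "vge 1 (g x * (prod f F - prod g F))"
    using insert.prems insert.IH by (intro vge_mult0) auto
  ultimately show ?case by (simp add: vge_add)
qed auto

lemma carrier_residue_field:
  "carrier (residue_field v K) = (\<lambda>a. (\<lambda>i. i + a) ` val_max_ideal v K) ` val_ring v K"
  unfolding residue_field_def FactRing_def A_RCOSETS_def' a_r_coset_def'
  by (auto simp: ring_of_type_algebra_def)

text \<open>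
  Multiplication by a unit \<open>a\<close> permutes the \<open>q - 1\<close> nonzero residue classes, so the product of their
  representatives, itself a unit, is congruent to its multiple by \<open>a ^ (q - 1)\<close>.
\<close>

lemma residue_power_card:
  assumes K: "is_subfield K" and q: "card (carrier (residue_field v K)) = q" "q \<noteq> 0"
    and a: "a \<in> K" "vge 0 a"
  shows "vge 1 (a ^ q - a)"
proof -
  define r where "r = (\<lambda>a. (\<lambda>i. i + a) ` val_max_ideal v K)"
  define R where "R = r ` val_ring v K"
  have R: "card R = q" "finite R"
    using q carrier_residue_field[of K] card_ge_0_finite[of R] by (simp_all add: R_def r_def)
  have ring: "x \<in> val_ring v K \<longleftrightarrow> x \<in> K \<and> vge 0 x" for x
    by (simp add: val_ring_def vge_def zero_ereal_def)
  have ideal: "x \<in> val_max_ideal v K \<longleftrightarrow> x \<in> K \<and> vge 1 x" for x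
  proof -
    have "0 < v x \<longleftrightarrow> vge 1 x"
    proof (cases "x = 0")
      case False
      then obtain n where "veq n x" using ex_veq by blast
      thus ?thesis by (auto simp: veq_def vge_def zero_ereal_def)
    qed simp
    thus ?thesis by (simp add: val_max_ideal_def)
  qed
  have r_eq: "r x = r y \<longleftrightarrow> vge 1 (x - y)" if "x \<in> K" "y \<in> K" for x y
  proof
    assume "r x = r y"
    moreover have "x \<in> r x" using K by (auto simp: r_def image_iff ideal is_subfieldD intro: bexI[of _ 0])
    ultimately show "vge 1 (x - y)" by (auto simp: r_def ideal)
  next
    assume d: "vge 1 (x - y)"
    have sub: "r x \<subseteq> r y" if "x \<in> K" "y \<in> K" "vge 1 (x - y)" for x y
    proof
      fix z assume "z \<in> r x"
      then obtain i where i: "i \<in> K" "vge 1 i" "z = i + x" by (auto simp: r_def ideal)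
      hence "i + (x - y) \<in> K" "vge 1 (i + (x - y))" "z = (i + (x - y)) + y"
        using that K by (auto simp: is_subfieldD intro: vge_add)
      thus "z \<in> r y" unfolding r_def using ideal by blast
    qed
    show "r x = r y" using sub[of x y] sub[of y x] that d vge_minus_commute by blast
  qed
  have "\<forall>c\<in>R. \<exists>x. x \<in> K \<and> vge 0 x \<and> r x = c" by (auto simp: R_def ring)
  then obtain rep where rep: "\<And>c. c \<in> R \<Longrightarrow> rep c \<in> K" "\<And>c. c \<in> R \<Longrightarrow> vge 0 (rep c)"
      "\<And>c. c \<in> R \<Longrightarrow> r (rep c) = c" by metis
  have rR: "r x \<in> R" if "x \<in> K" "vge 0 x" for x
    using that ring by (auto simp: R_def)
  show ?thesis
  proof (cases "vge 1 a")
    case True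
    have "a ^ q = a * a ^ (q - 1)" using q(2) by (cases q) auto
    moreover have "vge 1 (a * a ^ (q - 1))" by (intro vge_mult0' True vge_power0 a(2))
    ultimately show ?thesis using True by (simp add: vge_diff)
  next
    case False
    hence a0: "veq 0 a" using vge_imp_veq[of 0 a] a(2) by simp
    define U where "U = R - {r 0}"
    have U0: "veq 0 (rep c)" if "c \<in> U" for c
    proof -
      have "\<not> vge 1 (rep c - 0)"
        using that rep r_eq[of "rep c" 0] is_subfieldD(1)[OF K] by (auto simp: U_def)
      thus ?thesis using vge_imp_veq[of 0 "rep c"] rep that by (auto simp: U_def)
    qed
    define \<phi> where "\<phi> = (\<lambda>c. r (a * rep c))"
    have aK: "a * rep c \<in> K" "vge 0 (a * rep c)" if "c \<in> R" for c
      using that rep a K by (auto simp: is_subfieldD vge_mult0)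
    have \<phi>R: "\<phi> c \<in> U" if "c \<in> U" for c
    proof -
      have "veq (0 + 0) (a * rep c)" by (intro veq_mult a0 U0 that)
      hence "r (a * rep c) \<noteq> r 0"
        using r_eq[of "a * rep c" 0] aK[of c] that is_subfieldD(1)[OF K] by (auto simp: U_def veq_iff)
      thus ?thesis using rR aK that by (auto simp: \<phi>_def U_def)
    qed
    have inj: "inj_on \<phi> U"
    proof (rule inj_onI)
      fix c d assume cd: "c \<in> U" "d \<in> U" "\<phi> c = \<phi> d"
      hence "vge 1 (a * rep c - a * rep d)" using r_eq aK by (auto simp: \<phi>_def U_def)
      hence "vge (0 + 1) (a * (rep c - rep d))" by (simp add: algebra_simps)
      hence "vge 1 (rep c - rep d)" by (rule vge_cancel[OF a0])
      moreover have cdR: "c \<in> R" "d \<in> R" using cd by (simp_all add: U_def)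
      ultimately have "r (rep c) = r (rep d)" using r_eq[of "rep c" "rep d"] rep(1) by simp
      thus "c = d" using rep(3) cdR by simp
    qed
    have fin: "finite U" using R by (simp add: U_def)
    have "\<phi> ` U = U" using \<phi>R inj fin by (intro card_subset_eq) (auto simp: card_image)
    hence bij: "bij_betw \<phi> U U" using inj by (simp add: bij_betw_def)
    have cardU: "card U = q - 1"
      using R rR[of 0] is_subfieldD(1)[OF K] by (simp add: U_def)
    have "vge 1 ((\<Prod>c\<in>U. a * rep c) - (\<Prod>c\<in>U. rep (\<phi> c)))"
    proof (rule vge_prod_diff)
      fix c assume c: "c \<in> U"
      hence "\<phi> c \<in> R" "c \<in> R" using \<phi>R by (auto simp: U_def)
      thus "vge 0 (a * rep c)" "vge 0 (rep (\<phi> c))" using aK rep by auto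
      have "r (a * rep c) = r (rep (\<phi> c))" using rep(3)[OF \<open>\<phi> c \<in> R\<close>] by (simp add: \<phi>_def)
      thus "vge 1 (a * rep c - rep (\<phi> c))" using r_eq aK rep \<open>\<phi> c \<in> R\<close> \<open>c \<in> R\<close> by blast
    qed
    also have "(\<Prod>c\<in>U. rep (\<phi> c)) = prod rep U"
      by (rule prod.reindex_bij_betw[OF bij])
    also have "(\<Prod>c\<in>U. a * rep c) - prod rep U = prod rep U * (a ^ (q - 1) - 1)"
      by (simp add: prod.distrib cardU algebra_simps)
    finally have "vge (0 + 1) (prod rep U * (a ^ (q - 1) - 1))" by simp
    with veq_prod0[of U rep] U0 have "vge 1 (a ^ (q - 1) - 1)" by (blast intro: vge_cancel)
    hence "vge 1 (a * (a ^ (q - 1) - 1))" by (rule vge_mult0[OF a(2)])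
    moreover have "a ^ q = a * a ^ (q - 1)" using q(2) by (cases q) auto
    ultimately show ?thesis by (simp add: algebra_simps)
  qed
qed

end

context padic_valued
begin

lemma vge_power_pp_diff:
  assumes "vge 0 a" "vge 0 c" "vge k (a - c)" "1 \<le> k"
  shows "vge (k + int m) (a ^ (p ^ m) - c ^ (p ^ m))"
proof (induction m)
  case (Suc m)
  have "vge (int p * 0 + (k + int m) + 1) ((a ^ (p ^ m)) ^ p - (c ^ (p ^ m)) ^ p)"
    using assms Suc by (intro vge_power_p_diff vge_power0) auto
  thus ?case by (simp add: power_mult[symmetric] mult.commute algebra_simps)
qed (use assms in simp)

end

locale teichmueller = padic_valued +
  fixes K :: "'a set" and f :: nat
  assumes K: "is_subfield K" "vcomplete K"
    and f: "0 < f"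
    and residue: "\<And>a. a \<in> K \<Longrightarrow> vge 0 a \<Longrightarrow> vge 1 (a ^ (p ^ f) - a)"
begin

definition q :: nat where "q = p ^ f"

lemma residue_q: "a \<in> K \<Longrightarrow> vge 0 a \<Longrightarrow> vge 1 (a ^ q - a)"
  using residue by (simp add: q_def)

lemma q_gt_1: "1 < q"
  unfolding q_def using p_gt_1 f by (rule one_less_power)

lemma vge_power_q_diff:
  assumes "vge 0 a" "vge 0 c" "vge k (a - c)" "1 \<le> k"
  shows "vge (k + 1) (a ^ q - c ^ q)"
  using vge_mono[OF vge_power_pp_diff[OF assms, of f], of "k + 1"] f by (simp add: q_def)

lemma vge_0_if_power_q:
  assumes "t ^ q = t"
  shows "vge 0 t"
proof (cases "t = 0")
  case False
  then obtain n where n: "veq n t" using ex_veq by blast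
  from veq_power[OF this, of q] have "veq (int q * n) t" unfolding assms .
  hence "int q * n = n" using n by (rule veq_unique)
  hence "n = 0" using q_gt_1 by simp
  thus ?thesis using n veq_vge by blast
qed simp

lemma teichmueller_unique:
  assumes t: "t ^ q = t" and u: "u ^ q = u" and tu: "vge 1 (t - u)"
  shows "t = u"
proof -
  have "vge (1 + int n) (t - u)" for n
  proof (induction n)
    case (Suc n)
    from vge_power_q_diff[OF vge_0_if_power_q[OF t] vge_0_if_power_q[OF u] Suc] t u
    show ?case by (simp add: algebra_simps)
  qed (use tu in simp)
  hence "vge (1 + int (nat n)) (t - u)" for n by blast
  hence "vge n (t - u)" for n using vge_mono[of "1 + int (nat n)" "t - u" n] by simp
  thus ?thesis using vge_all_imp_0[of "t - u"] by simp
qed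

text \<open>
  The representative is the limit of \<open>a ^ (q ^ n)\<close>.
\<close>

lemma teichmueller_exists:
  assumes a: "a \<in> K" "vge 0 a"
  obtains t where "t \<in> K" "t ^ q = t" "vge 1 (t - a)"
proof -
  define s where "s = (\<lambda>n. a ^ (q ^ n))"
  have s_Suc: "s (Suc n) = s n ^ q" for n
    by (simp add: s_def power_mult mult.commute[of q])
  have s0: "vge 0 (s n)" for n by (simp add: s_def vge_power0 a(2))
  have sK: "s n \<in> K" for n by (simp add: s_def is_subfield_power K(1) a(1))
  have step: "vge (int n + 1) (s (Suc n) - s n)" for n
  proof (induction n)
    case 0 thus ?case using residue_q[OF a] by (simp add: s_def)
  next
    case (Suc n)
    from vge_power_q_diff[OF s0 s0 Suc] show ?case by (simp add: s_Suc[symmetric] algebra_simps)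
  qed
  obtain t where t: "t \<in> K" "\<And>n. vge (int n) (s n - t)"
  proof (rule vcomplete_geometric[of K s])
    show "vge (int n) (s (Suc n) - s n)" for n by (rule vge_mono[OF step]) simp
  qed (use K(2) sK that in blast)+
  have t0: "vge 0 t" using vge_diff[OF s0[of 0] t(2)[of 0, simplified]] by simp
  have "vge (int n) (t ^ q - t)" for n
  proof (cases "n = 0")
    case True thus ?thesis using t0 by (simp add: vge_diff vge_power0)
  next
    case False
    hence "vge (int n + 1) (s n ^ q - t ^ q)"
      using vge_power_q_diff[OF s0 t0 t(2)[of n]] by simp
    hence 1: "vge (int n) (s n ^ q - t ^ q)" by (rule vge_mono) simp
    have 2: "vge (int n) (s n ^ q - t)" using vge_mono[OF t(2)[of "Suc n"]] by (simp add: s_Suc)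
    from vge_diff[OF 2 1] show ?thesis by simp
  qed
  hence "vge (int (nat n)) (t ^ q - t)" for n by blast
  hence "vge n (t ^ q - t)" for n using vge_mono[of "int (nat n)" "t ^ q - t" n] by simp
  hence "t ^ q = t" using vge_all_imp_0[of "t ^ q - t"] by simp
  moreover have "vge 1 (t - a)"
  proof -
    have "vge 1 (s 1 - t)" using t(2)[of 1] by simp
    moreover have "vge 1 (s 1 - a)" using step[of 0] by (simp add: s_def)
    ultimately have "vge 1 ((s 1 - a) - (s 1 - t))" by (rule vge_diff[rotated])
    thus ?thesis by simp
  qed
  ultimately show thesis using t(1) that by blast
qed

lemma root_of_unity_teichmueller:
  fixes t :: 'a
  assumes "t ^ (q - 1) = 1"
  shows "t ^ q = t" "veq 0 t"
proof -
  have "q = Suc (q - 1)" using q_gt_1 by simp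
  hence "t ^ q = t * t ^ (q - 1)" by (metis power_Suc)
  thus "t ^ q = t" using assms by simp
  have "t \<noteq> 0" using assms q_gt_1 by (auto simp: power_0_left)
  then obtain n where n: "veq n t" using ex_veq by blast
  from veq_power[OF this, of "q - 1"] have "veq (int (q - 1) * n) 1" unfolding assms .
  hence "int (q - 1) * n = 0" using veq_1 by (rule veq_unique)
  hence "n = 0" using q_gt_1 by (simp add: of_nat_diff)
  thus "veq 0 t" using n by simp
qed

lemma teichmueller_root_of_unity:
  fixes t :: 'a
  assumes "t ^ q = t" "t \<noteq> 0"
  shows "t ^ (q - 1) = 1"
proof -
  have "q = Suc (q - 1)" using q_gt_1 by simp
  hence eq: "t ^ q = t * t ^ (q - 1)" by (metis power_Suc)
  hence "t * t ^ (q - 1) = t * 1" using assms(1) by simp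
  thus ?thesis using assms(2) mult_left_cancel by blast
qed

lemma vge_fermat: "vge 1 (of_nat m ^ p - of_nat m)"
proof -
  have "[m ^ p = m] (mod p)"
  proof (cases "p dvd m")
    case True
    hence "p dvd m ^ p" using p_gt_1 by (simp add: dvd_power_le[of p m 1 p, simplified] dvd_trans[OF _ dvd_power])
    thus ?thesis using True by (simp add: cong_def dvd_eq_mod_eq_0)
  next
    case False
    have "m ^ p = m * m ^ (p - 1)" using p_gt_1 by (cases p) auto
    with cong_scalar_left[OF fermat_theorem[OF p False], of m] show ?thesis by simp
  qed
  hence "int p dvd int (m ^ p) - int m" by (metis cong_iff_dvd_diff cong_int_iff)
  then obtain k where "int (m ^ p) - int m = int p * k" by blast
  from arg_cong[OF this, of "of_int :: int \<Rightarrow> 'a"]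
  have "(of_nat m ^ p - of_nat m :: 'a) = of_nat p * of_int k" by simp
  thus ?thesis by (simp add: vge_p vge_mult0')
qed

text \<open>
  In terms of Teichmueller representatives: those of the integers below \<open>p\<close> are \<open>p\<close> roots of the
  polynomial \<open>X ^ p - X\<close>, which therefore has no others.
\<close>

lemma prime_field_residue:
  assumes a: "a \<in> K" "vge 0 a" and ap: "vge 1 (a ^ p - a)"
  obtains m where "m < p" "vge 1 (a - of_nat m)"
proof -
  have teich: "\<exists>t. t ^ p = t \<and> t ^ q = t \<and> vge 1 (t - b)"
    if b: "b \<in> K" "vge 0 b" "vge 1 (b ^ p - b)" for b
  proof -
    obtain t where t: "t \<in> K" "t ^ q = t" "vge 1 (t - b)" using teichmueller_exists[OF b(1,2)] .
    have "vge 1 (t ^ p - b ^ p)"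
      using vge_power_pp_diff[OF vge_0_if_power_q[OF t(2)] b(2) t(3), of 1] by (auto intro: vge_mono)
    from vge_add[OF this b(3)] have "vge 1 (t ^ p - b)" by simp
    from vge_diff[OF this t(3)] have "vge 1 (t ^ p - t)" by simp
    moreover have "(t ^ p) ^ q = t ^ p" using t(2) by (metis power_commutes power_mult mult.commute)
    ultimately have "t ^ p = t" using teichmueller_unique t(2) by blast
    thus ?thesis using t by blast
  qed
  have "\<forall>m. \<exists>t. t ^ p = t \<and> t ^ q = t \<and> vge 1 (t - of_nat m)"
    using teich vge_fermat K(1) by (simp add: is_subfield_of_nat)
  then obtain T where T: "\<And>m. T m ^ p = T m" "\<And>m. T m ^ q = T m" "\<And>m. vge 1 (T m - of_nat m)" by metis
  obtain t where t: "t ^ p = t" "t ^ q = t" "vge 1 (t - a)" using teich[OF a ap] by blast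
  define P where "P = monom 1 p - [:0, 1 :: 'a:]"
  have "coeff P p = 1" using p_gt_1 by (simp add: P_def coeff_pCons split: nat.splits)
  hence P0: "P \<noteq> 0" by auto
  have degP: "degree P \<le> p"
    unfolding P_def using p_gt_1 by (intro degree_diff_le) (auto simp: degree_monom_le)
  have rootP: "poly P x = 0 \<longleftrightarrow> x ^ p = x" for x
    by (simp add: P_def poly_monom)
  have "inj_on T {..<p}"
  proof (rule inj_onI)
    fix m n assume mn: "m \<in> {..<p}" "n \<in> {..<p}" "T m = T n"
    have "\<not> m < n" if "m < p" "n < p" "T m = T n" for m n
    proof
      assume "m < n"
      have "vge 1 ((T m - of_nat m) - (T n - of_nat n))" by (intro vge_diff T)
      hence "vge 1 (of_nat (n - m))" using that \<open>m < n\<close> by (simp add: of_nat_diff)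
      moreover have "\<not> p dvd (n - m)" using that \<open>m < n\<close> by (auto dest: dvd_imp_le)
      ultimately show False using veq_of_nat[of "n - m"] veq_iff by auto
    qed
    from this[of m n] this[of n m] mn show "m = n" by auto
  qed
  hence "card (T ` {..<p}) = p" by (simp add: card_image)
  moreover have "T ` {..<p} \<subseteq> {x. poly P x = 0}" using T(1) rootP by auto
  moreover have fin: "finite {x. poly P x = 0}" using P0 by (rule poly_roots_finite)
  moreover have "card {x. poly P x = 0} \<le> p" using card_poly_roots_bound[OF P0] degP by linarith
  ultimately have "T ` {..<p} = {x. poly P x = 0}"
    by (metis card_mono card_subset_eq le_antisym)
  hence "t \<in> T ` {..<p}" using t(1) rootP by blast
  then obtain m where m: "m < p" "t = T m" by blast
  from vge_diff[OF T(3)[of m] t(3)] have "vge 1 (a - of_nat m)" by (simp add: m)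
  thus thesis using m that by blast
qed

end

section \<open>The p-adic base field and unramified extensions\<close>

text \<open>
  The ring \<open>\<int>[w]\<close>, with Horner's scheme as its induction principle.
\<close>

inductive_set int_adjoin :: "'a::comm_ring_1 \<Rightarrow> 'a set" for w where
  zero: "0 \<in> int_adjoin w"
| step: "x \<in> int_adjoin w \<Longrightarrow> of_int c + w * x \<in> int_adjoin w"

lemma int_adjoin_of_int: "of_int c \<in> int_adjoin w"
  using int_adjoin.step[OF int_adjoin.zero, of c w] by simp

lemma int_adjoin_w_mult: "x \<in> int_adjoin w \<Longrightarrow> w * x \<in> int_adjoin w"
  using int_adjoin.step[of x w 0] by simp

lemma int_adjoin_add: "x \<in> int_adjoin w \<Longrightarrow> y \<in> int_adjoin w \<Longrightarrow> x + y \<in> int_adjoin w"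
proof (induction arbitrary: y rule: int_adjoin.induct)
  case (step x c)
  from step.prems show ?case
  proof (cases rule: int_adjoin.cases)
    case zero thus ?thesis using int_adjoin.step[OF step.hyps] by simp
  next
    case (step y' d)
    have "of_int (c + d) + w * (x + y') \<in> int_adjoin w"
      using step by (intro int_adjoin.step step.IH)
    thus ?thesis by (simp add: step algebra_simps)
  qed
qed simp

lemma int_adjoin_of_int_mult: "x \<in> int_adjoin w \<Longrightarrow> of_int c * x \<in> int_adjoin w"
proof (induction rule: int_adjoin.induct)
  case (step x d)
  from int_adjoin.step[OF step.IH, of "c * d"] show ?case by (simp add: algebra_simps)
qed (simp add: int_adjoin.zero)

lemma int_adjoin_mult: "x \<in> int_adjoin w \<Longrightarrow> y \<in> int_adjoin w \<Longrightarrow> x * y \<in> int_adjoin w"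
proof (induction rule: int_adjoin.induct)
  case (step x c)
  have "of_int c * y + w * (x * y) \<in> int_adjoin w"
    using step by (intro int_adjoin_add int_adjoin_of_int_mult int_adjoin_w_mult)
  thus ?case by (simp add: algebra_simps)
qed (simp add: int_adjoin.zero)

lemma int_adjoin_power: "x \<in> int_adjoin w \<Longrightarrow> x ^ n \<in> int_adjoin w"
  using int_adjoin_of_int[of 1] by (induction n) (auto intro: int_adjoin_mult)

lemma int_adjoin_sum: "(\<And>i. i \<in> I \<Longrightarrow> g i \<in> int_adjoin w) \<Longrightarrow> sum g I \<in> int_adjoin w"
  by (induction I rule: infinite_finite_induct) (auto intro: int_adjoin_add int_adjoin.zero)

lemma int_adjoin_of_nat_mult: "x \<in> int_adjoin w \<Longrightarrow> of_nat n * x \<in> int_adjoin w"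
  using int_adjoin_of_int_mult[of x w "int n"] by simp

lemma int_adjoin_power_p_add:
  assumes p: "prime p" and x: "x \<in> int_adjoin w" and y: "y \<in> int_adjoin w"
  obtains z where "z \<in> int_adjoin w" "(x + y) ^ p = x ^ p + y ^ p + of_nat p * z"
proof -
  have p1: "1 < p" using p prime_gt_1_nat by blast
  define z where "z = (\<Sum>k\<in>{1..<p}. of_nat ((p choose k) div p) * (x ^ k * y ^ (p - k)))"
  have "(x + y) ^ p = (\<Sum>k\<le>p. of_nat (p choose k) * x ^ k * y ^ (p - k))" by (rule binomial_ring)
  also have "{..p} = insert 0 (insert p {1..<p})" using p1 by auto
  also have "(\<Sum>k\<in>insert 0 (insert p {1..<p}). of_nat (p choose k) * x ^ k * y ^ (p - k)) =
      x ^ p + y ^ p + (\<Sum>k\<in>{1..<p}. of_nat (p choose k) * x ^ k * y ^ (p - k))"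
    using p1 by simp
  also have "(\<Sum>k\<in>{1..<p}. of_nat (p choose k) * x ^ k * y ^ (p - k)) = of_nat p * z"
    unfolding z_def sum_distrib_left
  proof (rule sum.cong[OF refl])
    fix k assume "k \<in> {1..<p}"
    hence "p dvd (p choose k)" using p by (intro dvd_choose_prime) auto
    hence "of_nat (p choose k) = (of_nat p * of_nat ((p choose k) div p) :: 'a)"
      by (metis dvd_mult_div_cancel of_nat_mult)
    thus "of_nat (p choose k) * x ^ k * y ^ (p - k) =
        of_nat p * (of_nat ((p choose k) div p) * (x ^ k * y ^ (p - k)))"
      by (simp add: mult.assoc)
  qed
  finally show thesis
    by (rule that[rotated]) (auto simp: z_def intro!: int_adjoin_sum int_adjoin_of_nat_mult
        int_adjoin_mult int_adjoin_power x y)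
qed

lemma int_adjoin_power_pp_add:
  assumes p: "prime p" and x: "x \<in> int_adjoin w" and y: "y \<in> int_adjoin w"
  shows "\<exists>z\<in>int_adjoin w. (x + y) ^ (p ^ m) = x ^ (p ^ m) + y ^ (p ^ m) + of_nat p * z"
proof (induction m)
  case 0
  show ?case by (rule bexI[OF _ int_adjoin.zero]) simp
next
  case (Suc m)
  then obtain z where z: "z \<in> int_adjoin w"
    "(x + y) ^ (p ^ m) = (x ^ (p ^ m) + y ^ (p ^ m)) + of_nat p * z" by auto
  obtain z1 where z1: "z1 \<in> int_adjoin w"
    "(x ^ (p ^ m) + y ^ (p ^ m) + of_nat p * z) ^ p =
      (x ^ (p ^ m) + y ^ (p ^ m)) ^ p + (of_nat p * z) ^ p + of_nat p * z1"
    by (rule int_adjoin_power_p_add[OF p int_adjoin_add[OF int_adjoin_power[OF x] int_adjoin_power[OF y]]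
          int_adjoin_of_nat_mult[OF z(1)]])
  obtain z2 where z2: "z2 \<in> int_adjoin w"
    "(x ^ (p ^ m) + y ^ (p ^ m)) ^ p = (x ^ (p ^ m)) ^ p + (y ^ (p ^ m)) ^ p + of_nat p * z2"
    by (rule int_adjoin_power_p_add[OF p int_adjoin_power[OF x] int_adjoin_power[OF y]])
  have "(of_nat p * z) ^ p = of_nat p * (z * (of_nat p * z) ^ (p - 1))"
    using p prime_gt_0_nat[of p] by (cases p) (auto simp: algebra_simps)
  hence "((x + y) ^ (p ^ m)) ^ p = (x ^ (p ^ m)) ^ p + (y ^ (p ^ m)) ^ p + of_nat p * z2 +
      of_nat p * (z * (of_nat p * z) ^ (p - 1)) + of_nat p * z1"
    by (simp only: z(2) z1(2) z2(2))
  hence "((x + y) ^ (p ^ m)) ^ p = (x ^ (p ^ m)) ^ p + (y ^ (p ^ m)) ^ p +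
      of_nat p * (z2 + z * (of_nat p * z) ^ (p - 1) + z1)"
    by (simp only: distrib_left add.assoc)
  moreover have "z2 + z * (of_nat p * z) ^ (p - 1) + z1 \<in> int_adjoin w"
    using z z1 z2 by (intro int_adjoin_add int_adjoin_mult int_adjoin_power int_adjoin_of_nat_mult)
  ultimately have "\<exists>z\<in>int_adjoin w. ((x + y) ^ (p ^ m)) ^ p = (x ^ (p ^ m)) ^ p + (y ^ (p ^ m)) ^ p + of_nat p * z"
    by blast
  thus ?case by (simp only: power_Suc2 power_mult)
qed

lemma fermat_int:
  fixes c :: int
  assumes p: "prime p"
  shows "\<exists>k. c ^ (p ^ m) = c + int p * k"
proof -
  have base: "[c ^ p = c] (mod int p)" for c
  proof -
    define r where "r = nat (c mod int p)"
    have r: "int r = c mod int p" using p prime_gt_0_nat[of p] by (simp add: r_def)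
    have "[r ^ p = r] (mod p)"
    proof (cases "p dvd r")
      case True
      have "p dvd r ^ p" using True prime_gt_0_nat[OF p] by (metis dvd_power dvd_trans)
      thus ?thesis using True by (simp add: cong_def dvd_eq_mod_eq_0)
    next
      case False
      have "r ^ p = r * r ^ (p - 1)" using prime_gt_0_nat[OF p] by (cases p) auto
      with cong_scalar_left[OF fermat_theorem[OF p False], of r] show ?thesis by simp
    qed
    hence "[int r ^ p = int r] (mod int p)" by (metis cong_int_iff of_nat_power)
    moreover have "[int r = c] (mod int p)" by (simp add: r)
    ultimately show ?thesis by (meson cong_pow cong_sym cong_trans)
  qed
  have "[c ^ (p ^ m) = c] (mod int p)"
  proof (induction m)
    case (Suc m)
    have "[(c ^ (p ^ m)) ^ p = c ^ p] (mod int p)" using Suc by (rule cong_pow)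
    from cong_trans[OF this base] show ?case by (simp add: power_mult[symmetric] mult.commute)
  qed simp
  hence "int p dvd c ^ (p ^ m) - c" by (simp add: cong_iff_dvd_diff)
  then obtain k where "c ^ (p ^ m) - c = int p * k" by blast
  hence "c ^ (p ^ m) = c + int p * k" by simp
  thus ?thesis by blast
qed

locale padic_base = teichmueller +
  fixes Qp :: "'a set"
  assumes Qp: "is_subfield Qp" "Qp \<subseteq> K" "is_finite_ext Qp K" "vcomplete Qp"
    and Qp_val: "\<And>n x. x \<in> Qp \<Longrightarrow> veq n x \<Longrightarrow> e dvd n"
    and Qp_val_surj: "\<And>k. \<exists>x\<in>Qp. veq (e * k) x"
    and Qp_dense: "\<And>x M. x \<in> Qp \<Longrightarrow> \<exists>r. vge M (x - of_rat r)"
begin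

text \<open>
  On \<open>\<int>[w]\<close> the \<open>q\<close>-th power map fixes \<open>w\<close> and the integers modulo \<open>p\<close>, hence is congruent to the
  identity modulo \<open>p\<close>.
\<close>

lemma int_adjoin_frobenius:
  fixes w x :: 'a
  assumes w: "w ^ q = w" and x: "x \<in> int_adjoin w"
  shows "\<exists>z\<in>int_adjoin w. x ^ q = x + of_nat p * z"
  using x
proof (induction rule: int_adjoin.induct)
  case zero
  show ?case
    by (rule bexI[OF _ int_adjoin.zero]) (use q_gt_1 in \<open>simp add: power_0_left\<close>)
next
  case (step x c)
  then obtain z where z: "z \<in> int_adjoin w" "x ^ q = x + of_nat p * z" by blast
  obtain z1 where z1: "z1 \<in> int_adjoin w"
    "(of_int c + w * x) ^ q = of_int c ^ q + (w * x) ^ q + of_nat p * z1"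
    using int_adjoin_power_pp_add[OF p int_adjoin_of_int int_adjoin_w_mult[OF step.hyps], of c f]
    unfolding q_def by blast
  obtain k where "c ^ q = c + int p * k" using fermat_int[OF p, of c f] unfolding q_def by blast
  from arg_cong[OF this, of "of_int :: int \<Rightarrow> 'a"]
  have k: "(of_int c :: 'a) ^ q = of_int c + of_nat p * of_int k" by simp
  have "(w * x) ^ q = w * x + of_nat p * (w * z)"
    by (simp add: power_mult_distrib w z(2) algebra_simps)
  hence "(of_int c + w * x) ^ q = (of_int c + w * x) + of_nat p * (of_int k + w * z + z1)"
    by (simp add: z1(2) k algebra_simps)
  moreover have "of_int k + w * z + z1 \<in> int_adjoin w"
    using z(1) z1(1) by (intro int_adjoin_add int_adjoin_of_int int_adjoin_w_mult)
  ultimately show ?case by blast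
qed

lemma int_adjoin_vge: assumes "vge 0 w" "x \<in> int_adjoin w" shows "vge 0 x"
  using assms(2,1) by (induction rule: int_adjoin.induct) (auto intro: vge_add vge_mult0)

text \<open>
  If \<open>x\<close> has positive value, \<open>x ^ q\<close> is negligible in \<open>x ^ q = x + p z\<close>, so \<open>x\<close> has the value of \<open>p z\<close>
  and one can descend to \<open>z\<close>.  Thus \<open>w\<close> generates no ramification.
\<close>

lemma int_adjoin_val:
  assumes w: "w ^ q = w" and x: "x \<in> int_adjoin w" "veq n x"
  shows "e dvd n"
  using x
proof (induction "nat n" arbitrary: n x rule: less_induct)
  case less
  have w0: "vge 0 w" using w by (rule vge_0_if_power_q)
  have n0: "0 \<le> n" using int_adjoin_vge[OF w0 less.prems(1)] less.prems(2) vge_veq_iff by blast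
  show ?case
  proof (cases "n = 0")
    case False
    hence n1: "0 < n" using n0 by simp
    obtain z where z: "z \<in> int_adjoin w" "x ^ q = x + of_nat p * z"
      using int_adjoin_frobenius[OF w less.prems(1)] by blast
    have "2 * n \<le> int q * n" using n1 q_gt_1 by (intro mult_right_mono) auto
    hence "vge (n + 1) (x ^ q)"
      using vge_mono[OF veq_vge[OF veq_power[OF less.prems(2), of q]], of "n + 1"] n1 by linarith
    hence "veq n (- x + x ^ q)" using less.prems(2) by (intro veq_add) auto
    hence pz: "veq n (of_nat p * z)" by (simp add: z(2))
    hence "z \<noteq> 0" using veq_nonzero by fastforce
    then obtain m where m: "veq m z" using ex_veq by blast
    have nm: "n = e + m" using veq_mult[OF veq_p m] pz veq_unique by blast
    have "0 \<le> m" using int_adjoin_vge[OF w0 z(1)] m vge_veq_iff by blast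
    hence "e dvd m" using nm e_pos by (intro less.hyps[OF _ z(1) m]) simp
    thus ?thesis by (simp add: nm)
  qed simp
qed

text \<open>
  Elements of \<open>Qp(w)\<close> are approximated by fractions with numerator in \<open>\<int>[w]\<close> and integral denominator,
  as the rationals are dense in the base field.
\<close>

lemma simple_extension_approx:
  assumes w: "vge 0 w" and x: "x \<in> ring.simple_extension (ring_of_type_algebra :: 'a ring) Qp w"
  shows "\<exists>y\<in>int_adjoin w. \<exists>d::int. d \<noteq> 0 \<and> vge M (x - y / of_int d)"
proof -
  interpret R: ring "ring_of_type_algebra :: 'a ring" by (rule ring_from_type_algebra)
  from x show ?thesis
  proof (induction rule: R.simple_extension.induct)
    case zero
    show ?case by (rule bexI[OF _ int_adjoin.zero], rule exI[of _ 1]) simp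
  next
    case (lin k1 k2)
    then obtain y d where yd: "y \<in> int_adjoin w" "d \<noteq> 0" "vge M (k1 - y / of_int d)" by blast
    obtain r where r: "vge M (k2 - of_rat r)" using Qp_dense lin.hyps by blast
    obtain a b where ab: "r = Rat.Fract a b" "b > 0" by (cases r) auto
    have rab: "(of_rat r :: 'a) = of_int a / of_int b" using ab by (simp add: of_rat_rat)
    define y' where "y' = of_int b * (w * y) + of_int (a * d)"
    have y': "y' \<in> int_adjoin w"
      unfolding y'_def by (intro int_adjoin_add int_adjoin_of_int_mult int_adjoin_w_mult yd int_adjoin_of_int)
    have "y' / of_int (d * b) = (y / of_int d) * w + of_int a / of_int b"
      using yd(2) ab(2) by (simp add: y'_def field_simps)
    hence "k1 * w + k2 - y' / of_int (d * b) = (k1 - y / of_int d) * w + (k2 - of_rat r)"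
      by (simp add: rab algebra_simps)
    moreover have "vge M ((k1 - y / of_int d) * w + (k2 - of_rat r))"
      by (intro vge_add vge_mult0' yd w r)
    ultimately have "vge M (k1 * w + k2 - y' / of_int (d * b))" by (simp only:)
    moreover have "d * b \<noteq> 0" using yd(2) ab(2) by simp
    ultimately have "\<exists>y\<in>int_adjoin w. \<exists>d::int. d \<noteq> 0 \<and> vge M (k1 * w + k2 - y / of_int d)"
      using y' by blast
    thus ?case by simp
  qed
qed

lemma simple_extension_val:
  assumes w: "w ^ q = w" and x: "x \<in> ring.simple_extension (ring_of_type_algebra :: 'a ring) Qp w"
    and n: "veq n x"
  shows "e dvd n"
proof -
  obtain y d where yd: "y \<in> int_adjoin w" "d \<noteq> 0" "vge (n + 1) (x - y / of_int d)"
    using simple_extension_approx[OF vge_0_if_power_q[OF w] x] by blast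
  have "veq n (y / of_int d)"
    using yd(3) by (intro veq_cong[OF n]) (simp add: vge_minus_commute)
  moreover obtain m where m: "veq m (of_int d)" using ex_veq[of "of_int d"] yd(2) by auto
  ultimately have "veq (m + n) (of_int d * (y / of_int d))" by (intro veq_mult)
  hence "veq (m + n) y" using yd(2) by simp
  hence "e dvd m + n" by (rule int_adjoin_val[OF w yd(1)])
  moreover have "e dvd m" using m Qp(1) by (intro Qp_val[of "of_int d"] is_subfield_of_int)
  ultimately show ?thesis by (simp add: dvd_add_right_iff)
qed

text \<open>
  The field generated by a Teichmueller representative is unramified by \<open>simple_extension_val\<close>.
\<close>

lemma teichmueller_in_max_unramified:
  assumes T: "max_unramified_ext v Qp K T" and w: "w \<in> K" "w ^ q = w"
  shows "w \<in> T"
proof -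
  interpret R: field "ring_of_type_algebra :: 'a ring" by (rule field_from_type_algebra)
  define F where "F = R.simple_extension Qp w"
  have "(R.algebraic over Qp) w"
    using R.finite_dimension_imp_algebraic[OF Qp(1) subfieldE(1)[OF K(1)] Qp(3) w(1)] .
  hence F: "is_subfield F"
    using R.simple_extension_is_subfield[OF Qp(1)] by (simp add: F_def)
  have QpF: "Qp \<subseteq> F" using R.simple_extension_incl[of Qp w] by (simp add: F_def)
  have wF: "w \<in> F" using R.simple_extension_mem[OF subfieldE(1)[OF Qp(1)]] by (simp add: F_def)
  have FK: "F \<subseteq> K"
  proof
    fix x assume "x \<in> F"
    thus "x \<in> K" unfolding F_def
      by (induction rule: R.simple_extension.induct) (use K(1) Qp(2) w(1) in \<open>auto simp: is_subfieldD\<close>)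
  qed
  have "unramified_ext v Qp F"
    unfolding unramified_ext_def
  proof
    show "v ` (F - {0}) \<subseteq> v ` (Qp - {0})"
    proof
      fix a assume "a \<in> v ` (F - {0})"
      then obtain x where x: "x \<in> F" "x \<noteq> 0" "a = v x" by blast
      obtain n where n: "veq n x" using ex_veq x(2) by blast
      then obtain k where "n = e * k" using simple_extension_val[OF w(2)] x(1) unfolding F_def by blast
      then obtain y where y: "y \<in> Qp" "veq n y" using Qp_val_surj by blast
      have "a = v y" using y(2) n x(3) by (simp add: veq_def)
      thus "a \<in> v ` (Qp - {0})" using y veq_nonzero by blast
    qed
  qed (use QpF in blast)
  with T F QpF FK have "F \<subseteq> T" by (simp add: max_unramified_ext_def)
  thus ?thesis using wF by blast
qed

lemma max_unramified_vge:
  assumes T: "max_unramified_ext v Qp K T" and x: "x \<in> T" "vge 1 x"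
  shows "vge e x"
proof (cases "x = 0")
  case False
  then obtain n where n: "veq n x" using ex_veq by blast
  from False x(1) have "v x \<in> v ` (Qp - {0})"
    using T by (auto simp: max_unramified_ext_def unramified_ext_def)
  then obtain y where "y \<in> Qp" "v x = v y" by blast
  hence "e dvd n" using Qp_val n by (simp add: veq_def)
  moreover have "1 \<le> n" using n x(2) vge_veq_iff by blast
  ultimately have "e \<le> n" by (intro zdvd_imp_le) auto
  thus ?thesis using n vge_veq_iff by blast
qed simp

lemma max_unramified_complete:
  assumes T: "max_unramified_ext v Qp K T"
  shows "vcomplete T"
proof -
  interpret R: field "ring_of_type_algebra :: 'a ring" by (rule field_from_type_algebra)
  have TT: "is_subfield T" "Qp \<subseteq> T" "T \<subseteq> K" using T by (simp_all add: max_unramified_ext_def)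
  have "subgroup T (add_monoid (ring_of_type_algebra :: 'a ring))"
    by (rule subring.axioms(1)[OF subfieldE(1)[OF TT(1)]])
  hence "subalgebra Qp T (ring_of_type_algebra :: 'a ring)"
    using TT by (auto simp: subalgebra_def subalgebra_axioms_def is_subfieldD)
  hence "is_finite_ext Qp T"
    using R.subalbegra_incl_imp_finite_dimension[OF Qp(1,3)] TT(3) by blast
  thus ?thesis using vcomplete_finite_ext[OF Qp(1,4)] by blast
qed

end

text \<open>
  The valuation of the top field restricts to \<open>e\<close> times the \<open>p\<close>-adic one; completeness and density are
  carried over by this rescaling.
\<close>

lemma (in valued) padic_numbers_facts:
  assumes p: "prime p" and Qp: "padic_numbers p Qp w"
    and e: "(e::nat) > 0" "\<forall>x\<in>Qp. v x = ereal (real e) * w x"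
  shows "veq (int e) (of_nat p)" and "vcomplete Qp"
    and "\<And>n x. x \<in> Qp \<Longrightarrow> veq n x \<Longrightarrow> int e dvd n"
    and "\<And>k. \<exists>x\<in>Qp. veq (int e * k) x"
    and "\<And>x M. x \<in> Qp \<Longrightarrow> \<exists>r. vge M (x - of_rat r)"
proof -
  have sub: "is_subfield Qp" and nw: "normalized_valuation Qp w"
    and rat: "\<And>r. w (of_rat r) = rat_padic_val p r"
    using Qp by (simp_all add: padic_numbers_def)
  have dense: "\<exists>r. w (x - of_rat r) \<ge> ereal (of_int M)" if "x \<in> Qp" for x and M :: int
    using Qp that unfolding padic_numbers_def by blast
  have complete: "\<exists>l\<in>Qp. \<forall>M::int. \<exists>k. \<forall>n\<ge>k. w (s n - l) \<ge> ereal (of_int M)"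
    if "range s \<subseteq> Qp" "\<forall>M::int. \<exists>k. \<forall>m\<ge>k. \<forall>n\<ge>k. w (s m - s n) \<ge> ereal (of_int M)"
    for s :: "nat \<Rightarrow> 'a"
    using Qp that unfolding padic_numbers_def by blast
  have wn: "\<exists>n::int. w x = ereal (of_int n) \<and> veq (int e * n) x" if "x \<in> Qp" "x \<noteq> 0" for x
  proof -
    have "w x \<in> w ` (Qp - {0})" using that by blast
    also have "\<dots> = range (\<lambda>n::int. ereal (of_int n))" using nw by (simp add: normalized_valuation_def)
    finally obtain n :: int where n: "w x = ereal (of_int n)" by blast
    thus ?thesis using e(2) that(1) by (auto simp: veq_def)
  qed
  have vge_w: "vge (int e * M) x \<longleftrightarrow> w x \<ge> ereal (of_int M)" if x: "x \<in> Qp" for x M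
  proof (cases "x = 0")
    case True
    have "w 0 = \<infinity>" using nw is_subfieldD(1)[OF sub] by (simp add: normalized_valuation_def)
    thus ?thesis using True by simp
  next
    case False
    then obtain n where n: "w x = ereal (of_int n)" "veq (int e * n) x" using wn x by blast
    show ?thesis using vge_veq_iff[OF n(2), of "int e * M"] e(1) by (simp add: n(1))
  qed
  show "veq (int e) (of_nat p)"
  proof -
    have "w (of_nat p) = rat_padic_val p (of_nat p)" using rat[of "of_nat p"] by simp
    also have "\<dots> = 1" using p prime_gt_0_nat[of p] by (simp add: rat_padic_val_def one_ereal_def)
    finally have "w (of_nat p) = 1" .
    moreover have "of_nat p \<in> Qp" by (rule is_subfield_of_nat[OF sub])
    ultimately show ?thesis using e(2) by (simp add: veq_def)
  qed
  show "int e dvd n" if "x \<in> Qp" "veq n x" for n x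
    using wn[OF that(1) veq_nonzero[OF that(2)]] that(2) veq_unique by (metis dvd_triv_left)
  show "\<exists>x\<in>Qp. veq (int e * k) x" for k
  proof -
    have "ereal (of_int k) \<in> range (\<lambda>n::int. ereal (of_int n))" by blast
    also have "\<dots> = w ` (Qp - {0})" using nw by (simp add: normalized_valuation_def)
    finally obtain x where "x \<in> Qp" "w x = ereal (of_int k)" by (metis Diff_iff imageE)
    thus ?thesis using e(2) by (auto simp: veq_def intro!: bexI[of _ x])
  qed
  show "\<exists>r. vge M (x - of_rat r)" if x: "x \<in> Qp" for x M
  proof -
    obtain r where "w (x - of_rat r) \<ge> ereal (of_int (max M 0))" using dense[OF x] by blast
    moreover have "x - of_rat r \<in> Qp" using sub x by (intro is_subfieldD is_subfield_of_rat)
    ultimately have "vge (int e * max M 0) (x - of_rat r)" using vge_w by blast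
    moreover have "M \<le> int e * max M 0"
    proof -
      have "1 * max M 0 \<le> int e * max M 0" using e(1) by (intro mult_right_mono) auto
      thus ?thesis by simp
    qed
    ultimately show ?thesis using vge_mono by blast
  qed
  show "vcomplete Qp"
    unfolding vcomplete_def
  proof (intro allI impI, elim conjE)
    fix s :: "nat \<Rightarrow> 'a"
    assume s: "range s \<subseteq> Qp" and c: "\<forall>M. \<exists>k. \<forall>m\<ge>k. \<forall>n\<ge>k. vge M (s m - s n)"
    have sQ: "s m \<in> Qp" for m using s by blast
    have d: "s m - s n \<in> Qp" for m n using sQ is_subfieldD(7)[OF sub] by blast
    have "\<forall>M::int. \<exists>k. \<forall>m\<ge>k. \<forall>n\<ge>k. w (s m - s n) \<ge> ereal (of_int M)"
      using c vge_w[OF d] by meson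
    then obtain l where l: "l \<in> Qp" "\<forall>M::int. \<exists>k. \<forall>n\<ge>k. w (s n - l) \<ge> ereal (of_int M)"
      using complete[OF s] by blast
    have "\<exists>k. \<forall>n\<ge>k. vge M (s n - l)" for M
    proof -
      obtain k where k: "\<forall>n\<ge>k. w (s n - l) \<ge> ereal (of_int (max M 0))" using l(2) by blast
      have "1 * max M 0 \<le> int e * max M 0" using e(1) by (intro mult_right_mono) auto
      hence le: "M \<le> int e * max M 0" by simp
      have "s n - l \<in> Qp" for n using sQ l(1) is_subfieldD(7)[OF sub] by blast
      hence "vge (int e * max M 0) (s n - l)" if "n \<ge> k" for n using k that vge_w by blast
      thus ?thesis using vge_mono[OF _ le] by blast
    qed
    with l(1) show "\<exists>l\<in>Qp. \<forall>M. \<exists>k. \<forall>n\<ge>k. vge M (s n - l)" by blast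
  qed
qed

section \<open>Elementary abelian extensions with one ramification break\<close>

text \<open>
  The Galois group is an elementary abelian group of order \<open>p ^ 2\<close> of automorphisms over \<open>K\<close>;
  \<open>break_ge\<close> and \<open>break_le\<close> say that \<open>b\<close> is its only break.
\<close>

locale ramified = padic_base +
  fixes G :: "('a \<Rightarrow> 'a) set" and b :: int
  assumes tot: "\<And>x. vge 0 x \<Longrightarrow> \<exists>y\<in>K. vge 0 y \<and> vge 1 (x - y)"
    and aut_add: "\<And>g x y. g \<in> G \<Longrightarrow> g (x + y) = g x + g y"
    and aut_mult: "\<And>g x y. g \<in> G \<Longrightarrow> g (x * y) = g x * g y"
    and aut_K: "\<And>g c. g \<in> G \<Longrightarrow> c \<in> K \<Longrightarrow> g c = c"
    and G_comp: "\<And>g h. g \<in> G \<Longrightarrow> h \<in> G \<Longrightarrow> g \<circ> h \<in> G"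
    and G_id: "id \<in> G"
    and G_inv: "\<And>g. g \<in> G \<Longrightarrow> \<exists>h\<in>G. h \<circ> g = id \<and> g \<circ> h = id"
    and G_comm: "\<And>g h. g \<in> G \<Longrightarrow> h \<in> G \<Longrightarrow> g \<circ> h = h \<circ> g"
    and G_exp: "\<And>g. g \<in> G \<Longrightarrow> g ^^ p = id"
    and G_card: "finite G" "card G = p ^ 2"
    and G_fixed: "\<And>x. (\<And>g. g \<in> G \<Longrightarrow> g x = x) \<Longrightarrow> x \<in> K"
    and aut_vge: "\<And>g n x. g \<in> G \<Longrightarrow> vge n x \<Longrightarrow> vge n (g x)"
    and break_ge: "\<And>g x. g \<in> G \<Longrightarrow> vge 1 x \<Longrightarrow> vge (b + 1) (g x - x)"
    and break_le: "\<And>g. g \<in> G \<Longrightarrow> (\<And>x. vge 1 x \<Longrightarrow> vge (b + 2) (g x - x)) \<Longrightarrow> g = id"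
begin

lemma aut_0: "g \<in> G \<Longrightarrow> g 0 = 0"
  using aut_K[of g 0] is_subfieldD(1)[OF K(1)] by simp

lemma aut_1: "g \<in> G \<Longrightarrow> g 1 = 1"
  using aut_K[of g 1] is_subfieldD(2)[OF K(1)] by simp

lemma aut_uminus: assumes "g \<in> G" shows "g (- x) = - g x"
proof -
  have "g x + g (- x) = 0" using aut_add[OF assms, of x "- x"] aut_0[OF assms] by simp
  thus ?thesis by (rule minus_unique[symmetric])
qed

lemma aut_diff: "g \<in> G \<Longrightarrow> g (x - y) = g x - g y"
  using aut_add[of g x "- y"] aut_uminus[of g y] by simp

lemma aut_power: "g \<in> G \<Longrightarrow> g (x ^ n) = g x ^ n"
  by (induction n) (simp_all add: aut_1 aut_mult)

lemma aut_sum: "g \<in> G \<Longrightarrow> g (sum h I) = (\<Sum>i\<in>I. g (h i))"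
  by (induction I rule: infinite_finite_induct) (simp_all add: aut_0 aut_add)

lemma aut_prod: "g \<in> G \<Longrightarrow> g (prod h I) = (\<Prod>i\<in>I. g (h i))"
  by (induction I rule: infinite_finite_induct) (simp_all add: aut_1 aut_mult)

lemma G_funpow: "g \<in> G \<Longrightarrow> g ^^ n \<in> G"
  by (induction n) (simp_all add: G_id G_comp)

lemma G_invE:
  assumes "g \<in> G"
  obtains h where "h \<in> G" "\<And>x. h (g x) = x" "\<And>x. g (h x) = x"
proof -
  from G_inv[OF assms] obtain h where h: "h \<in> G \<and> h \<circ> g = id \<and> g \<circ> h = id"
    unfolding Bex_def ..
  show thesis
  proof (rule that)
    show "h (g x) = x" "g (h x) = x" for x using h by (simp_all add: fun_eq_iff)
  qed (use h in simp)
qed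

lemma aut_veq: assumes g: "g \<in> G" and x: "veq n x" shows "veq n (g x)"
proof -
  obtain h where h: "h \<in> G" "\<And>x. h (g x) = x" by (rule G_invE[OF g]) (rule that)
  have "\<not> vge (n + 1) (g x)"
  proof
    assume "vge (n + 1) (g x)"
    hence "vge (n + 1) (h (g x))" by (rule aut_vge[OF h(1)])
    hence "vge (n + 1) x" by (simp add: h(2))
    thus False using x by (simp add: veq_iff)
  qed
  thus ?thesis using aut_vge[OF g veq_vge[OF x]] by (simp add: veq_iff)
qed

text \<open>
  For fixed \<open>s\<close> the elements raised by \<open>s\<close> are closed under products, and by the next lemma under
  inverses.
\<close>

lemma raise_mult:
  assumes g: "g \<in> G" and x: "veq n x" "vge (n + s) (g x - x)" and y: "veq m y" "vge (m + s) (g y - y)"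
  shows "vge (n + m + s) (g (x * y) - x * y)"
proof -
  have "vge (n + s + m) ((g x - x) * g y)" by (rule vge_mult[OF x(2) aut_vge[OF g veq_vge[OF y(1)]]])
  moreover have "vge (n + (m + s)) (x * (g y - y))" by (rule vge_mult[OF veq_vge[OF x(1)] y(2)])
  ultimately have "vge (n + m + s) ((g x - x) * g y + x * (g y - y))"
    using vge_add[of "n + m + s"] by (simp add: add.commute add.left_commute)
  thus ?thesis by (simp add: aut_mult[OF g] algebra_simps)
qed

lemma raise_inverse:
  assumes g: "g \<in> G" and x: "veq n x" "vge (n + s) (g x - x)"
  shows "vge (- n + s) (g (inverse x) - inverse x)"
proof -
  have x0: "x \<noteq> 0" "g x \<noteq> 0" using x(1) aut_veq[OF g x(1)] veq_nonzero by auto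
  have "g x * g (inverse x) = g (x * inverse x)" by (simp only: aut_mult[OF g])
  also have "x * inverse x = 1" using x0 by simp
  finally have "g x * g (inverse x) = 1" by (simp only: aut_1[OF g])
  hence gi: "g (inverse x) = inverse (g x)" by (metis inverse_unique)
  have "vge (n + s - (n + n)) (- ((g x - x) / (g x * x)))"
    unfolding vge_uminus by (rule vge_divide[OF x(2) veq_mult[OF aut_veq[OF g x(1)] x(1)]])
  moreover have "- ((g x - x) / (g x * x)) = g (inverse x) - inverse x"
    unfolding gi using x0 by (simp add: field_simps)
  ultimately show ?thesis by simp
qed

lemma unit_decomp: assumes "vge 0 x" obtains \<kappa> y where "\<kappa> \<in> K" "vge 0 \<kappa>" "vge 1 y" "x = \<kappa> + y"
proof -
  obtain \<kappa> where \<kappa>: "\<kappa> \<in> K" "vge 0 \<kappa>" "vge 1 (x - \<kappa>)" using tot[OF assms] by blast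
  show thesis by (rule that[OF \<kappa>]) simp
qed

text \<open>
  Modulo the maximal ideal a unit is congruent to an element of \<open>K\<close>, on which \<open>g\<close> acts trivially.
\<close>

lemma raise_unit:
  assumes g: "g \<in> G" and x: "vge 0 x"
  shows "vge (b + 1) (g x - x)"
proof -
  obtain \<kappa> y where y: "\<kappa> \<in> K" "vge 1 y" "x = \<kappa> + y" using unit_decomp[OF x] by blast
  have "g x - x = g y - y" by (simp add: y aut_add[OF g] aut_K[OF g])
  thus ?thesis using break_ge[OF g y(2)] by simp
qed

lemma raise_nonneg_power:
  assumes g: "g \<in> G" and x: "veq n x" "vge (n + s) (g x - x)"
  shows "vge (int k * n + s) (g (x ^ k) - x ^ k)"
proof (induction k)
  case (Suc k)
  from raise_mult[OF g x veq_power[OF x(1)] Suc] show ?case by (simp add: algebra_simps)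
qed (simp add: aut_1[OF g])

lemma raise_times_unit:
  assumes g: "g \<in> G" and s: "s \<le> b + 1" and z: "veq n z" "vge (n + s) (g z - z)" and x: "veq n x"
  shows "vge (n + s) (g x - x)"
proof -
  have u: "veq 0 (x / z)" using veq_divide[OF x z(1)] by simp
  have "vge (0 + s) (g (x / z) - x / z)"
    using vge_mono[OF raise_unit[OF g veq_vge[OF u]] s] by simp
  from raise_mult[OF g z u this] show ?thesis using veq_nonzero[OF z(1)] by simp
qed

text \<open>
  All elements of value \<open>n\<close> differ from a power of \<open>x\<close> by a unit, and units are raised by \<open>b + 1\<close>.
\<close>

lemma raise_all:
  assumes g: "g \<in> G" and s: "s \<le> b + 1" and x: "veq d x" "vge (d + s) (g x - x)"
    and n: "d dvd n" "0 < d" and z: "veq n z"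
  shows "vge (n + s) (g z - z)"
proof -
  obtain k where k: "n = d * k" using n(1) by blast
  show ?thesis
  proof (cases "0 \<le> k")
    case True
    hence nk: "int (nat k) * d = n" by (simp add: k)
    show ?thesis
      using raise_times_unit[OF g s veq_power[OF x(1)] raise_nonneg_power[OF g x], of "nat k"] z nk by simp
  next
    case False
    hence nk: "int (nat (- k)) * d = - n" by (simp add: k)
    have "vge (- n + s) (g (inverse z) - inverse z)"
      using raise_times_unit[OF g s veq_power[OF x(1)] raise_nonneg_power[OF g x], of "nat (- k)" "inverse z"]
        veq_inverse[OF z] nk by simp
    from raise_inverse[OF g veq_inverse[OF z] this] show ?thesis by simp
  qed
qed

lemma raise_b_veq: assumes g: "g \<in> G" and z: "veq n z" shows "vge (n + b) (g z - z)"
proof -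
  obtain x where x: "veq 1 x" using veq_surj by blast
  have "vge (1 + b) (g x - x)" using break_ge[OF g veq_vge[OF x]] by (simp add: add.commute)
  from raise_all[OF g _ x this _ _ z] show ?thesis by simp
qed

lemma raise_b: assumes g: "g \<in> G" and z: "vge n z" shows "vge (n + b) (g z - z)"
proof (cases "z = 0")
  case False
  then obtain m where m: "veq m z" using ex_veq by blast
  hence "n \<le> m" using z vge_veq_iff by blast
  thus ?thesis using vge_mono[OF raise_b_veq[OF g m]] by simp
qed (simp add: aut_0[OF g])

text \<open>
  The quotient \<open>g x / x\<close> is congruent to some \<open>\<kappa>\<close> of \<open>K\<close>, and \<open>g ^^ p = id\<close> forces \<open>\<kappa> ^ p\<close> to be
  congruent to \<open>1\<close>; as Frobenius is injective on the residue field, so is \<open>\<kappa>\<close>.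
\<close>

lemma raise_wild:
  assumes g: "g \<in> G" and x: "vge 1 x"
  shows "vge 2 (g x - x)"
proof (cases "vge 2 x")
  case True thus ?thesis by (intro vge_diff aut_vge[OF g])
next
  case False
  hence x1: "veq 1 x" using vge_imp_veq[OF x] by simp
  have "veq 0 (g x / x)" using veq_divide[OF aut_veq[OF g x1] x1] by simp
  then obtain \<kappa> where \<kappa>: "\<kappa> \<in> K" "vge 0 \<kappa>" "vge 1 (g x / x - \<kappa>)" using tot veq_vge by blast
  have "vge (1 + 1) ((g x / x - \<kappa>) * x)" by (intro vge_mult \<kappa> x)
  moreover have "(g x / x - \<kappa>) * x = g x - \<kappa> * x" using veq_nonzero[OF x1] by (simp add: left_diff_distrib)
  ultimately have d: "vge 2 (g x - \<kappa> * x)" by simp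
  have "vge 2 ((g ^^ i) x - \<kappa> ^ i * x)" for i
  proof (induction i)
    case (Suc i)
    have "vge 2 (g ((g ^^ i) x - \<kappa> ^ i * x))" by (rule aut_vge[OF g Suc])
    moreover have "vge 2 (\<kappa> ^ i * (g x - \<kappa> * x))" by (rule vge_mult0[OF vge_power0[OF \<kappa>(2)] d])
    ultimately have "vge 2 (g ((g ^^ i) x - \<kappa> ^ i * x) + \<kappa> ^ i * (g x - \<kappa> * x))" by (rule vge_add)
    moreover have "g (\<kappa> ^ i * x) = \<kappa> ^ i * g x"
      by (simp add: aut_mult[OF g] aut_K[OF g] is_subfield_power K(1) \<kappa>(1))
    ultimately show ?case by (simp add: aut_diff[OF g] algebra_simps)
  qed simp
  from this[of p] have "vge (1 + 1) (x * (1 - \<kappa> ^ p))" by (simp add: G_exp[OF g] algebra_simps)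
  hence "vge 1 (1 - \<kappa> ^ p)" by (rule vge_cancel[OF x1])
  hence "vge 1 (1 ^ p ^ (f - 1) - (\<kappa> ^ p) ^ p ^ (f - 1))"
    using vge_mono[OF vge_power_pp_diff[of 1 "\<kappa> ^ p" 1 "f - 1"], of 1] \<kappa>(2) by (simp add: vge_power0)
  moreover have "(\<kappa> ^ p) ^ p ^ (f - 1) = \<kappa> ^ q"
    using f by (simp add: q_def power_mult[symmetric] power_Suc[symmetric] del: power_Suc)
  ultimately have "vge 1 (1 - \<kappa> ^ q)" by simp
  from vge_add[OF this residue_q[OF \<kappa>(1,2)]] have "vge 1 (1 - \<kappa>)" by simp
  hence "vge (1 + 1) ((1 - \<kappa>) * x)" by (intro vge_mult x)
  hence "vge 2 ((g x - \<kappa> * x) - (1 - \<kappa>) * x)" using vge_diff[OF d] by simp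
  thus ?thesis by (simp add: algebra_simps)
qed

lemma b_ge_1: "1 \<le> b"
proof (rule ccontr)
  assume "\<not> 1 \<le> b"
  hence "G \<subseteq> {id}" using raise_wild break_le vge_mono[of 2 _ "b + 2"] by force
  hence "card G \<le> card {id :: 'a \<Rightarrow> 'a}" by (intro card_mono) auto
  moreover have "1 < p * p" using p_gt_1 by (simp add: one_less_mult)
  ultimately show False using G_card by (simp add: power2_eq_square)
qed

text \<open>
  Taking \<open>p\<close>-th powers improves congruences, so a \<open>p\<close>-th power of a uniformizer is raised by more than
  \<open>b\<close>.
\<close>

lemma raise_dvd:
  assumes g: "g \<in> G" and z: "veq n z" "int p dvd n"
  shows "vge (n + b + 1) (g z - z)"
proof -
  obtain x where x: "veq 1 x" using veq_surj by blast
  have "vge (1 + b) (g x - x)" by (rule raise_b_veq[OF g x])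
  hence "vge (int p * 1 + b + 1) (g x ^ p - x ^ p)"
    using b_ge_1 veq_vge[OF x] by (intro vge_power_p_diff aut_vge[OF g]) auto
  hence "vge (int p + (b + 1)) (g (x ^ p) - x ^ p)" by (simp add: aut_power[OF g] add.assoc)
  moreover have "veq (int p) (x ^ p)" using veq_power[OF x, of p] by simp
  ultimately have "vge (n + (b + 1)) (g z - z)"
    using raise_all[OF g _ _ _ z(2) _ z(1)] p_gt_1 by simp
  thus ?thesis by (simp add: add.assoc)
qed

text \<open>
  If some element of value prime to \<open>p\<close> is raised by more than \<open>b\<close>, its powers together with the elements
  of value divisible by \<open>p\<close> show the same for a uniformizer; then the break would be larger than \<open>b\<close>.
\<close>

lemma raise_not_dvd_imp_id:
  assumes g: "g \<in> G" and z: "veq n z" "\<not> int p dvd n" and r: "vge (n + b + 1) (g z - z)"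
  shows "g = id"
proof (rule break_le[OF g])
  have "coprime (int p) n" using z(2) p by (simp add: prime_imp_coprime)
  then obtain k0 where "[n * k0 = 1] (mod int p)"
    using cong_solve_coprime_int[of n "int p"] by (auto simp: coprime_commute)
  define k where "k = nat (k0 mod int p)"
  have "[n * (k0 mod int p) = n * k0] (mod int p)" by (intro cong_mult) (simp_all add: cong_def)
  hence "[n * int k = 1] (mod int p)"
    using \<open>[n * k0 = 1] (mod int p)\<close> p_gt_1 by (auto simp: k_def intro: cong_trans)
  hence dvd: "int p dvd 1 - int k * n" by (metis cong_iff_dvd_diff cong_sym mult.commute)
  have zk: "veq (int k * n) (z ^ k)" by (rule veq_power[OF z(1)])
  have rk: "vge (int k * n + (b + 1)) (g (z ^ k) - z ^ k)"
    using raise_nonneg_power[OF g z(1), of "b + 1" k] r by (simp add: add.assoc)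
  fix x assume x: "vge 1 x"
  show "vge (b + 2) (g x - x)"
  proof (cases "vge 2 x")
    case True
    from raise_b[OF g True] show ?thesis by (simp add: add.commute)
  next
    case False
    hence x1: "veq 1 x" using vge_imp_veq[OF x] by simp
    have y: "veq (1 - int k * n) (x / z ^ k)" by (rule veq_divide[OF x1 zk])
    have "vge (1 - int k * n + (b + 1)) (g (x / z ^ k) - x / z ^ k)"
      using raise_dvd[OF g y dvd] by (simp add: add.assoc)
    from raise_mult[OF g zk rk y this] have "vge (1 + (b + 1)) (g (z ^ k * (x / z ^ k)) - z ^ k * (x / z ^ k))"
      by simp
    moreover have "z ^ k * (x / z ^ k) = x" using veq_nonzero[OF zk] by (simp del: power_eq_0_iff)
    ultimately show ?thesis by (simp add: add.commute)
  qed
qed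

lemma raise_not_dvd:
  assumes "g \<in> G" "g \<noteq> id" "veq n z" "\<not> int p dvd n"
  shows "veq (n + b) (g z - z)"
  using raise_b_veq[OF assms(1,3)] raise_not_dvd_imp_id[OF assms(1,3,4)] assms(2)
  by (auto intro: vge_imp_veq)

lemma funpow_newton:
  assumes g: "\<And>x y. g (x + y) = g x + g y" and n: "n < N"
  shows "(g ^^ n) x = (\<Sum>i<N. of_nat (n choose i) * ((\<lambda>x. g x - x) ^^ i) (x :: 'a))"
  using n
proof (induction n arbitrary: N x)
  case 0
  then obtain M where "N = Suc M" by (cases N) auto
  thus ?case by (simp add: sum.lessThan_Suc_shift del: sum.lessThan_Suc)
next
  case (Suc n)
  let ?Y = "\<lambda>x. g x - x"
  obtain M where M: "N = Suc M" "n < M" using Suc.prems by (cases N) auto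
  have add: "(g ^^ n) (x + y) = (g ^^ n) x + (g ^^ n) y" for x y
    by (induction n) (simp_all add: g)
  have "(g ^^ Suc n) x = (g ^^ n) (x + ?Y x)" by (simp add: funpow_Suc_right del: funpow.simps)
  also have "\<dots> = (g ^^ n) x + (g ^^ n) (?Y x)" by (rule add)
  also have "(g ^^ n) x = (\<Sum>i<N. of_nat (n choose i) * (?Y ^^ i) x)"
    using M by (intro Suc.IH) auto
  also have "\<dots> = x + (\<Sum>i<M. of_nat (n choose Suc i) * (?Y ^^ Suc i) x)"
    by (simp add: M(1) sum.lessThan_Suc_shift del: sum.lessThan_Suc)
  also have "(g ^^ n) (?Y x) = (\<Sum>i<M. of_nat (n choose i) * (?Y ^^ i) (?Y x))"
    using M by (intro Suc.IH) auto
  also have "\<dots> = (\<Sum>i<M. of_nat (n choose i) * (?Y ^^ Suc i) x)"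
    by (simp add: funpow_Suc_right del: funpow.simps)
  also have "x + (\<Sum>i<M. of_nat (n choose Suc i) * (?Y ^^ Suc i) x) +
      (\<Sum>i<M. of_nat (n choose i) * (?Y ^^ Suc i) x) =
      x + (\<Sum>i<M. of_nat (Suc n choose Suc i) * (?Y ^^ Suc i) x)"
    by (simp add: sum.distrib[symmetric] algebra_simps)
  also have "\<dots> = (\<Sum>i<N. of_nat (Suc n choose i) * (?Y ^^ i) x)"
    by (simp add: M(1) sum.lessThan_Suc_shift del: sum.lessThan_Suc)
  finally show ?case .
qed

end

context ramified
begin

text \<open>
  If \<open>p\<close> divides \<open>b\<close>, the operator \<open>g - 1\<close> acts to leading order as multiplication by
  \<open>u = (g x - x) / x\<close> on elements whose value is congruent to \<open>1\<close> modulo \<open>p\<close>.  The relation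
  \<open>\<Sum>i=1..p. (p choose i) * (g - 1) ^^ i = 0\<close> then becomes \<open>p u + u ^ p = 0\<close> to leading order, since the
  middle terms are smaller.
\<close>

lemma unramified_break_relation:
  assumes g: "g \<in> G" "g \<noteq> id" and b: "int p dvd b" and x: "veq 1 x"
  shows "vge ((int p - 1) * b + 1) (((g x - x) / x) ^ (p - 1) + of_nat p)"
    and "\<And>n z. veq n z \<Longrightarrow> int p dvd n - 1 \<Longrightarrow> vge (n + b + 1) (g z - z - (g x - x) / x * z)"
proof -
  define u where "u = (g x - x) / x"
  have x0: "x \<noteq> 0" using x veq_nonzero by blast
  have ux: "u * x = g x - x" using x0 by (simp add: u_def)
  have not_dvd: "\<not> int p dvd n" if "int p dvd n - 1" for n
  proof
    assume "int p dvd n"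
    from dvd_diff[OF this that] have "int p dvd 1" by simp
    thus False using p_gt_1 by simp
  qed
  have "veq (1 + b) (g x - x)"
    using p_gt_1 by (intro raise_not_dvd[OF g x]) auto
  hence u: "veq b u" using veq_divide[OF _ x] unfolding u_def by fastforce
  have lead: "vge (n + b + 1) (g z - z - u * z)" if z: "veq n z" "int p dvd n - 1" for n z
  proof -
    have y: "veq (n - 1) (z / x)" by (rule veq_divide[OF z(1) x])
    have "vge (1 + (n - 1 + b + 1)) (g x * (g (z / x) - z / x))"
      by (rule vge_mult[OF aut_vge[OF g(1) veq_vge[OF x]] raise_dvd[OF g(1) y z(2)]])
    moreover have "g x * (g (z / x) - z / x) = g z - z - u * z"
    proof -
      have "g x * g (z / x) = g (x * (z / x))" by (simp only: aut_mult[OF g(1)])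
      also have "x * (z / x) = z" using x0 by simp
      finally have "g x * g (z / x) = g z" .
      moreover have "g x * (z / x) = z + u * z" using x0 by (simp add: u_def field_simps)
      ultimately show ?thesis by (simp add: right_diff_distrib)
    qed
    ultimately have "vge (1 + (n - 1 + b + 1)) (g z - z - u * z)" by (simp only:)
    thus ?thesis by (rule vge_mono) simp
  qed
  define Y where "Y = (\<lambda>i. ((\<lambda>x. g x - x) ^^ i) x)"
  have Y_Suc: "Y (Suc i) = g (Y i) - Y i" for i by (simp add: Y_def)
  have Y: "veq (1 + int i * b) (Y i) \<and> vge (1 + int i * b + 1) (Y i - u ^ i * x)" for i
  proof (induction i)
    case 0 thus ?case using x by (simp add: Y_def)
  next
    case (Suc i)
    have dv: "int p dvd (1 + int i * b) - 1" using b by simp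
    have 1: "veq (1 + int i * b + b) (Y (Suc i))"
      unfolding Y_Suc using Suc not_dvd[OF dv] by (intro raise_not_dvd[OF g]) auto
    have "vge (b + (1 + int i * b + 1)) (u * (Y i - u ^ i * x))"
      using Suc by (intro vge_mult veq_vge[OF u]) auto
    moreover have "vge (1 + int i * b + b + 1) (Y (Suc i) - u * Y i)"
      using lead[of "1 + int i * b" "Y i"] Suc dv by (simp add: Y_Suc)
    ultimately have "vge (1 + int i * b + b + 1) ((Y (Suc i) - u * Y i) + u * (Y i - u ^ i * x))"
      by (intro vge_add) (simp_all add: algebra_simps)
    moreover have "(Y (Suc i) - u * Y i) + u * (Y i - u ^ i * x) = Y (Suc i) - u ^ Suc i * x"
      by (simp add: algebra_simps)
    ultimately have "vge (1 + int i * b + b + 1) (Y (Suc i) - u ^ Suc i * x)" by simp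
    with 1 show ?case by (simp add: algebra_simps)
  qed
  define R where "R = (\<Sum>i=2..<p. of_nat (p choose i) * Y i)"
  have "x = (g ^^ p) x" using G_exp[OF g(1)] by simp
  also have "\<dots> = (\<Sum>i<Suc p. of_nat (p choose i) * Y i)"
    unfolding Y_def by (rule funpow_newton) (use aut_add[OF g(1)] in auto)
  also have "{..<Suc p} = insert 0 (insert 1 (insert p {2..<p}))" using p_gt_1 by auto
  also have "(\<Sum>i\<in>insert 0 (insert 1 (insert p {2..<p})). of_nat (p choose i) * Y i) =
      x + (of_nat p * Y 1 + (Y p + R))"
    using p_gt_1 by (simp add: R_def Y_def)
  finally have rel: "of_nat p * Y 1 + (Y p + R) = 0" by simp
  have Y1: "Y 1 = u * x" by (simp add: Y_def ux)
  have vB: "veq (e + (1 + b)) (of_nat p * Y 1)" using veq_mult[OF veq_p, of "1 + b" "Y 1"] Y[of 1] by simp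
  have vA: "veq (1 + int p * b) (Y p)" using Y by blast
  have vR: "vge (e + (1 + b) + 1) R"
    unfolding R_def
  proof (rule vge_sum)
    fix i assume i: "i \<in> {2..<p}"
    hence "p dvd (p choose i)" using p by (intro dvd_choose_prime) auto
    then obtain k where "p choose i = p * k" by blast
    hence "vge e (of_nat (p choose i))" using vge_mult[OF veq_vge[OF veq_p] vge_of_nat[of k]] by simp
    hence "vge (e + (1 + int i * b)) (of_nat (p choose i) * Y i)" using Y veq_vge by (blast intro: vge_mult)
    moreover have "2 * b \<le> int i * b" using i b_ge_1 by (intro mult_right_mono) auto
    hence "e + (1 + b) + 1 \<le> e + (1 + int i * b)" using b_ge_1 by linarith
    ultimately show "vge (e + (1 + b) + 1) (of_nat (p choose i) * Y i)" by (rule vge_mono)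
  qed
  have AB: "1 + int p * b = e + (1 + b)"
  proof (rule ccontr)
    assume "1 + int p * b \<noteq> e + (1 + b)"
    then consider "1 + int p * b < e + (1 + b)" | "e + (1 + b) < 1 + int p * b" by linarith
    thus False
    proof cases
      case 1
      have "vge (1 + int p * b + 1) (of_nat p * Y 1 + R)"
        using 1 by (intro vge_add vge_mono[OF veq_vge[OF vB]] vge_mono[OF vR]) auto
      moreover have "of_nat p * Y 1 + R = - Y p" using rel by (simp add: algebra_simps eq_neg_iff_add_eq_0)
      ultimately show False using vA by (simp add: veq_iff)
    next
      case 2
      have "vge (e + (1 + b) + 1) (Y p + R)"
        using 2 by (intro vge_add vge_mono[OF veq_vge[OF vA]] vge_mono[OF vR]) auto
      moreover have "Y p + R = - (of_nat p * Y 1)" using rel by (simp add: eq_neg_iff_add_eq_0 add.commute)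
      ultimately show False using vB by (simp add: veq_iff)
    qed
  qed
  have "vge (1 + int p * b + 1) (- R - (Y p - u ^ p * x))"
    by (rule vge_diff) (use Y[of p] vR AB in simp_all)
  moreover have "- R - (Y p - u ^ p * x) = (u * x) * (u ^ (p - 1) + of_nat p)"
  proof -
    have up: "u ^ p = u * u ^ (p - 1)" using p_gt_1 by (cases p) auto
    have "of_nat p * Y 1 = - (Y p + R)" using rel by (simp only: eq_neg_iff_add_eq_0)
    hence "of_nat p * (u * x) = - (Y p + R)" by (simp only: Y1)
    thus ?thesis by (simp add: up algebra_simps)
  qed
  ultimately have "vge (1 + int p * b + 1) ((u * x) * (u ^ (p - 1) + of_nat p))" by (simp only:)
  hence "vge ((b + 1) + ((int p - 1) * b + 1)) ((u * x) * (u ^ (p - 1) + of_nat p))"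
    by (rule vge_mono) (simp add: algebra_simps)
  with veq_mult[OF u x] show "vge ((int p - 1) * b + 1) (((g x - x) / x) ^ (p - 1) + of_nat p)"
    unfolding u_def[symmetric] by (rule vge_cancel)
  show "vge (n + b + 1) (g z - z - (g x - x) / x * z)" if "veq n z" "int p dvd n - 1" for n z
    using lead[OF that] unfolding u_def .
qed

end

locale ramified_pair = ramified +
  fixes \<gamma> \<sigma> :: "'a \<Rightarrow> 'a"
  assumes \<gamma>: "\<gamma> \<in> G" and \<sigma>: "\<sigma> \<in> G" "\<sigma> \<noteq> id"
    and independent: "\<And>m. \<gamma> \<circ> \<sigma> ^^ m \<noteq> id"
begin

lemma \<gamma>_not_id: "\<gamma> \<noteq> id"
  using independent[of 0] by simp

text \<open>
  The combination is \<open>(\<gamma> \<circ> \<sigma> ^^ m) x - x\<close> up to elements raised by \<open>2 b\<close>, and \<open>\<gamma> \<circ> \<sigma> ^^ m\<close> is not the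
  identity.
\<close>

lemma combination_raise:
  assumes x: "veq n x" "\<not> int p dvd n"
  shows "\<not> vge (n + b + 1) ((\<gamma> x - x) + of_nat m * (\<sigma> x - x))"
proof
  assume r: "vge (n + b + 1) ((\<gamma> x - x) + of_nat m * (\<sigma> x - x))"
  have sx: "vge (n + b) (\<sigma> x - x)" by (rule raise_b_veq[OF \<sigma>(1) x(1)])
  have pow: "vge (n + b + 1) ((\<sigma> ^^ m) x - x - of_nat m * (\<sigma> x - x))" for m
  proof (induction m)
    case (Suc m)
    have Gm: "\<sigma> ^^ m \<in> G" by (rule G_funpow[OF \<sigma>(1)])
    have "vge (n + b + b) ((\<sigma> ^^ m) (\<sigma> x - x) - (\<sigma> x - x))" by (rule raise_b[OF Gm sx])
    hence "vge (n + b + 1) ((\<sigma> ^^ m) (\<sigma> x - x) - (\<sigma> x - x))" by (rule vge_mono) (use b_ge_1 in simp)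
    from vge_add[OF Suc this] show ?case
      by (simp add: aut_diff[OF Gm] funpow_Suc_right algebra_simps del: funpow.simps)
  qed simp
  define w where "w = (\<sigma> ^^ m) x - x"
  have "vge (n + b) w" unfolding w_def by (rule raise_b_veq[OF G_funpow[OF \<sigma>(1)] x(1)])
  hence "vge (n + b + b) (\<gamma> w - w)" by (rule raise_b[OF \<gamma>])
  hence 1: "vge (n + b + 1) (\<gamma> w - w)" by (rule vge_mono) (use b_ge_1 in simp)
  have "vge (n + b + 1) ((\<gamma> w - w) + (w - of_nat m * (\<sigma> x - x)) + ((\<gamma> x - x) + of_nat m * (\<sigma> x - x)))"
    by (intro vge_add 1 r) (use pow in \<open>simp add: w_def\<close>)
  moreover have "(\<gamma> w - w) + (w - of_nat m * (\<sigma> x - x)) + ((\<gamma> x - x) + of_nat m * (\<sigma> x - x)) =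
      (\<gamma> \<circ> \<sigma> ^^ m) x - x"
    by (simp add: w_def aut_diff[OF \<gamma>] algebra_simps)
  ultimately have "vge (n + b + 1) ((\<gamma> \<circ> \<sigma> ^^ m) x - x)" by (simp only:)
  with independent[of m] show False
    using raise_not_dvd_imp_id[OF G_comp[OF \<gamma> G_funpow[OF \<sigma>(1)]] x] by blast
qed

text \<open>
  Otherwise \<open>\<gamma>\<close> and \<open>\<sigma>\<close> both give solutions of \<open>u ^ (p - 1) = - p\<close> to leading order.  Their ratio
  satisfies \<open>r ^ (p - 1) = 1\<close> in the residue field, so it is an integer \<open>m\<close> there, and \<open>\<gamma> \<sigma> ^^ (p - m)\<close>
  raises a uniformizer by more than \<open>b\<close>.
\<close>

lemma not_dvd_b: "\<not> int p dvd b"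
proof
  assume b: "int p dvd b"
  obtain x where x: "veq 1 x" using veq_surj by blast
  have x0: "x \<noteq> 0" using x veq_nonzero by blast
  have not1: "\<not> int p dvd 1" using p_gt_1 by simp
  define u where "u = (\<gamma> x - x) / x"
  define w where "w = (\<sigma> x - x) / x"
  have u: "veq b u" unfolding u_def
    using veq_divide[OF raise_not_dvd[OF \<gamma> \<gamma>_not_id x not1] x] by simp
  have w: "veq b w" unfolding w_def
    using veq_divide[OF raise_not_dvd[OF \<sigma> x not1] x] by simp
  have w0: "w \<noteq> 0" using w veq_nonzero by blast
  have "vge ((int p - 1) * b + 1) ((u ^ (p - 1) + of_nat p) - (w ^ (p - 1) + of_nat p))"
    unfolding u_def w_def
    by (intro vge_diff unramified_break_relation(1) \<gamma> \<gamma>_not_id \<sigma> b x)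
  hence d: "vge ((int p - 1) * b + 1) (u ^ (p - 1) - w ^ (p - 1))" by simp
  define r where "r = u / w"
  have r: "veq 0 r" using veq_divide[OF u w] by (simp add: r_def)
  have wp: "veq ((int p - 1) * b) (w ^ (p - 1))" using veq_power[OF w, of "p - 1"] p_gt_1 by (simp add: of_nat_diff)
  have "(u ^ (p - 1) - w ^ (p - 1)) / w ^ (p - 1) = r ^ (p - 1) - 1"
    using w0 by (simp add: r_def diff_divide_distrib power_divide)
  with vge_divide[OF d wp] have "vge 1 (r ^ (p - 1) - 1)" by simp
  from vge_mult0[OF veq_vge[OF r] this] have "vge 1 (r * r ^ (p - 1) - r)" by (simp add: algebra_simps)
  moreover have "r * r ^ (p - 1) = r ^ p" using p_gt_1 by (cases p) auto
  ultimately have rp: "vge 1 (r ^ p - r)" by simp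
  obtain \<kappa> where \<kappa>: "\<kappa> \<in> K" "vge 0 \<kappa>" "vge 1 (r - \<kappa>)" using tot[OF veq_vge[OF r]] by blast
  have "vge 1 (r ^ p - \<kappa> ^ p)"
    using vge_mono[OF vge_power_pp_diff[OF veq_vge[OF r] \<kappa>(2,3), of 1], of 1] by simp
  from vge_diff[OF vge_add[OF rp \<kappa>(3)] this] have "vge 1 (\<kappa> ^ p - \<kappa>)" by simp
  then obtain m where m: "m < p" "vge 1 (\<kappa> - of_nat m)" using prime_field_residue[OF \<kappa>(1,2)] by blast
  have "vge 1 (r - of_nat m)" using vge_add[OF \<kappa>(3) m(2)] by simp
  from vge_mult[OF this vge_mult[OF veq_vge[OF w] veq_vge[OF x]]]
  have "vge (1 + (b + 1)) ((r - of_nat m) * (w * x))" .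
  moreover have "(r - of_nat m) * (w * x) = (\<gamma> x - x) - of_nat m * (\<sigma> x - x)"
  proof -
    have "r * w = u" "u * x = \<gamma> x - x" "w * x = \<sigma> x - x" using w0 x0 by (simp_all add: r_def u_def w_def)
    thus ?thesis by (metis left_diff_distrib mult.assoc)
  qed
  ultimately have 1: "vge (1 + b + 1) ((\<gamma> x - x) - of_nat m * (\<sigma> x - x))" by simp
  \<comment> \<open>\<open>combination_raise\<close> asks for a natural coefficient, so \<open>- m\<close> is replaced by \<open>p - m\<close>\<close>
  have "vge (1 + (1 + b)) (of_nat p * (\<sigma> x - x))" by (intro vge_mult vge_p raise_b_veq[OF \<sigma>(1) x])
  hence "vge (1 + b + 1) (((\<gamma> x - x) - of_nat m * (\<sigma> x - x)) + of_nat p * (\<sigma> x - x))"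
    using vge_add[OF 1] by (simp add: add.commute)
  moreover have "((\<gamma> x - x) - of_nat m * (\<sigma> x - x)) + of_nat p * (\<sigma> x - x) =
      (\<gamma> x - x) + of_nat (p - m) * (\<sigma> x - x)"
    using m(1) by (simp add: of_nat_diff algebra_simps)
  ultimately have "vge (1 + b + 1) ((\<gamma> x - x) + of_nat (p - m) * (\<sigma> x - x))" by simp
  thus False using combination_raise[OF x not1] by blast
qed

end

section \<open>The operator attached to a truncated power\<close>

context ramified_pair
begin

definition Y :: "nat \<Rightarrow> 'a \<Rightarrow> 'a" where
  "Y i = (\<lambda>x. \<sigma> x - x) ^^ i"

lemma Y_0 [simp]: "Y 0 x = x"
  by (simp add: Y_def)

lemma Y_Suc: "Y (Suc i) x = \<sigma> (Y i x) - Y i x"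
  by (simp add: Y_def)

lemma Y_add: "Y (i + j) x = Y i (Y j x)"
  by (simp add: Y_def funpow_add)

lemma Y_plus: "Y i (x + y) = Y i x + Y i y"
  by (induction i) (simp_all add: Y_Suc aut_add[OF \<sigma>(1)] aut_diff[OF \<sigma>(1)])

lemma Y_diff: "Y i (x - y) = Y i x - Y i y"
  by (induction i) (simp_all add: Y_Suc aut_diff[OF \<sigma>(1)])

lemma Y_scale: "c \<in> K \<Longrightarrow> Y i (c * x) = c * Y i x"
  by (induction i) (simp_all add: Y_Suc aut_diff[OF \<sigma>(1)] aut_mult[OF \<sigma>(1)] aut_K[OF \<sigma>(1)] algebra_simps)

lemma Y_zero: "Y i 0 = 0"
  by (induction i) (simp_all add: Y_Suc aut_0[OF \<sigma>(1)])

lemma Y_sum: "Y i (sum h I) = (\<Sum>j\<in>I. Y i (h j))"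
  by (induction I rule: infinite_finite_induct) (simp_all add: Y_plus Y_zero)

lemma Y_commute: "Y i (Y j x) = Y j (Y i x)"
  using Y_add[of i j x] Y_add[of j i x] by (simp add: add.commute)

lemma \<gamma>_\<sigma>_commute: "\<gamma> (\<sigma> x) = \<sigma> (\<gamma> x)"
  using G_comm[OF \<gamma> \<sigma>(1)] by (simp add: fun_eq_iff)

lemma \<gamma>_Y: "\<gamma> (Y i x) = Y i (\<gamma> x)"
  by (induction i) (simp_all add: Y_Suc aut_diff[OF \<gamma>] \<gamma>_\<sigma>_commute)

lemma vge_Y: "vge n x \<Longrightarrow> vge (n + int i * b) (Y i x)"
proof (induction i)
  case (Suc i)
  from raise_b[OF \<sigma>(1) Suc.IH[OF Suc.prems]] show ?case by (simp add: Y_Suc algebra_simps)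
qed simp

lemma vge_Y_1: "vge n x \<Longrightarrow> 1 \<le> i \<Longrightarrow> vge (n + b) (Y i x)"
proof (rule vge_mono[OF vge_Y])
  assume "1 \<le> i"
  hence "1 * b \<le> int i * b" using b_ge_1 by (intro mult_right_mono) auto
  thus "n + b \<le> n + int i * b" by simp
qed

text \<open>
  The values \<open>b, 2 b, \<dots>, (p - 1) b\<close> are prime to \<open>p\<close>, so each of the first \<open>p - 1\<close> steps raises by
  exactly \<open>b\<close>.
\<close>

lemma veq_Y:
  assumes \<rho>: "veq b \<rho>" and i: "i < p"
  shows "veq ((int i + 1) * b) (Y i \<rho>)"
  using i
proof (induction i)
  case (Suc i)
  have "\<not> int p dvd (int i + 1) * b"
  proof
    assume "int p dvd (int i + 1) * b"
    hence "int p dvd int i + 1" using not_dvd_b p by (simp add: prime_dvd_mult_iff)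
    hence "int p \<le> int i + 1" by (intro zdvd_imp_le) auto
    thus False using Suc.prems by simp
  qed
  moreover have "veq ((int i + 1) * b) (Y i \<rho>)" using Suc by simp
  ultimately have "veq ((int i + 1) * b + b) (Y (Suc i) \<rho>)"
    unfolding Y_Suc by (intro raise_not_dvd[OF \<sigma>])
  moreover have "(int (Suc i) + 1) * b = (int i + 1) * b + b" by (simp add: algebra_simps)
  ultimately show ?case by (simp only:)
qed (use \<rho> in simp)

text \<open>
  The step from \<open>p - 1\<close> to \<open>p\<close> starts at the value \<open>p b\<close> and therefore gains more than \<open>b\<close>.
\<close>

lemma vge_Y_ge_p:
  assumes \<rho>: "veq b \<rho>" and i: "p \<le> i"
  shows "vge ((int i + 1) * b + 1) (Y i \<rho>)"
proof -
  obtain d where d: "i = d + p" using i by (metis add.commute le_Suc_ex)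
  have "veq (int p * b) (Y (p - 1) \<rho>)" using veq_Y[OF \<rho>, of "p - 1"] p_gt_1 by (simp add: of_nat_diff)
  from raise_dvd[OF \<sigma>(1) this] have "vge (int p * b + b + 1) (Y (Suc (p - 1)) \<rho>)" by (simp add: Y_Suc)
  hence "vge (int p * b + b + 1) (Y p \<rho>)" using p_gt_1 by simp
  from vge_Y[OF this, of d] show ?thesis by (simp add: d Y_add algebra_simps)
qed

text \<open>
  The action of \<open>\<sigma>^[a]\<close> on the field.
\<close>

definition sexp :: "'a \<Rightarrow> 'a \<Rightarrow> 'a" where
  "sexp a x = (\<Sum>i<p. (a gchoose i) * Y i x)"

lemma sexp_minus: "sexp a x - x = (\<Sum>i=1..<p. (a gchoose i) * Y i x)"
proof -
  have "{..<p} = insert 0 {1..<p}" using p_gt_1 by auto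
  thus ?thesis by (simp add: sexp_def)
qed

definition sexp_defect :: "'a \<Rightarrow> 'a \<Rightarrow> 'a \<Rightarrow> 'a" where
  "sexp_defect a x y = (\<Sum>i<p. \<Sum>j<p. trunc_defect_coeff p a i j * (Y i x * Y j y))"

text \<open>
  Apply \<open>trunc_defect\<close> to the multiplicativity of \<open>\<sigma> ^^ n\<close> for \<open>n < p\<close>.
\<close>

lemma sexp_mult: "sexp a x * sexp a y = sexp a (x * y) + sexp_defect a x y"
proof -
  have newton: "(\<sigma> ^^ n) z = (\<Sum>i<p. of_nat (n choose i) * Y i z)" if "n < p" for n z
    unfolding Y_def by (rule funpow_newton[OF aut_add[OF \<sigma>(1)] that])
  have "(\<Sum>i<p. \<Sum>j<p. (a gchoose i) * (a gchoose j) * (Y i x * Y j y)) -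
      (\<Sum>k<p. (a gchoose k) * Y k (x * y)) = sexp_defect a x y"
    unfolding sexp_defect_def
  proof (rule trunc_defect)
    fix n assume n: "n < p"
    have "(\<sigma> ^^ n) x * (\<sigma> ^^ n) y = (\<sigma> ^^ n) (x * y)"
      using aut_mult[OF G_funpow[OF \<sigma>(1)]] by simp
    thus "(\<Sum>i<p. \<Sum>j<p. of_nat (n choose i) * of_nat (n choose j) * (Y i x * Y j y)) =
        (\<Sum>k<p. of_nat (n choose k) * Y k (x * y))"
      by (simp add: newton[OF n] sum_product mult_ac)
  qed
  moreover have "(\<Sum>i<p. \<Sum>j<p. (a gchoose i) * (a gchoose j) * (Y i x * Y j y)) = sexp a x * sexp a y"
    by (simp add: sexp_def sum_product mult_ac)
  ultimately show ?thesis by (simp add: sexp_def[of a "x * y"] algebra_simps)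
qed

lemma vge_sexp_defect:
  assumes a: "vge 0 a" and x: "vge n x" and y: "vge m y"
  shows "vge (n + m + int p * b) (sexp_defect a x y)"
  unfolding sexp_defect_def
proof (intro vge_sum)
  fix i j assume ij: "i \<in> {..<p}" "j \<in> {..<p}"
  show "vge (n + m + int p * b) (trunc_defect_coeff p a i j * (Y i x * Y j y))"
  proof (cases "i + j < p")
    case False
    have "vge ((n + int i * b) + (m + int j * b)) (Y i x * Y j y)"
      by (intro vge_mult vge_Y x y)
    moreover have "int p * b \<le> (int i + int j) * b" using False b_ge_1 by (intro mult_right_mono) auto
    ultimately have "vge (n + m + int p * b) (Y i x * Y j y)"
      using vge_mono[of "(n + int i * b) + (m + int j * b)" _ "n + m + int p * b"] by (simp add: algebra_simps)
    with vge_trunc_defect_coeff[OF a, of i j] ij show ?thesis by (simp add: vge_mult0)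
  qed (simp add: trunc_defect_coeff_eq_0)
qed

text \<open>
  The norm of a uniformizer.
\<close>

lemma norm_elem: obtains c where "c \<in> K" "veq (int p ^ 2) c"
proof -
  obtain x where x: "veq 1 x" using veq_surj by blast
  define c where "c = (\<Prod>g\<in>G. g x)"
  have "c \<in> K"
  proof (rule G_fixed)
    fix h assume h: "h \<in> G"
    have "inj_on ((\<circ>) h) G"
    proof (rule inj_onI)
      fix g g' assume eq: "h \<circ> g = h \<circ> g'"
      obtain h' where "h' \<in> G" and h': "\<And>x. h' (h x) = x" by (rule G_invE[OF h]) (rule that)
      show "g = g'"
      proof
        fix y
        have "h (g y) = h (g' y)" using fun_cong[OF eq, of y] by (simp only: comp_apply)
        hence "h' (h (g y)) = h' (h (g' y))" by (rule arg_cong)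
        thus "g y = g' y" by (simp only: h')
      qed
    qed
    moreover have "(\<circ>) h ` G \<subseteq> G" using G_comp[OF h] by blast
    ultimately have "bij_betw ((\<circ>) h) G G"
      using G_card(1) by (simp add: bij_betw_def card_image card_subset_eq)
    from prod.reindex_bij_betw[OF this, of "\<lambda>g. g x"] show "h c = c"
      by (simp add: c_def aut_prod[OF h])
  qed
  moreover have "veq (int (card F)) (\<Prod>g\<in>F. g x)" if "finite F" "F \<subseteq> G" for F
    using that
  proof (induction F rule: finite_induct)
    case (insert g F)
    hence "veq (1 + int (card F)) (g x * (\<Prod>g\<in>F. g x))" using aut_veq[of g 1 x] x by (intro veq_mult) auto
    thus ?case using insert.hyps by simp
  qed simp
  hence "veq (int p ^ 2) c" using G_card unfolding c_def by (metis of_nat_power subset_refl)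
  ultimately show thesis by (rule that)
qed

lemma K_val: "\<exists>c\<in>K. veq (int p ^ 2 * j) c"
proof -
  obtain c where c: "c \<in> K" "veq (int p ^ 2) c" by (rule norm_elem)
  show ?thesis
  proof (cases "0 \<le> j")
    case True
    have "veq (int (nat j) * int p ^ 2) (c ^ nat j)" by (rule veq_power[OF c(2)])
    thus ?thesis using True is_subfield_power[OF K(1) c(1)] by (auto simp: mult.commute)
  next
    case False
    have "veq (- (int (nat (- j)) * int p ^ 2)) (inverse (c ^ nat (- j)))"
      by (intro veq_inverse veq_power c(2))
    hence "veq (int p ^ 2 * j) (inverse (c ^ nat (- j)))" using False by (simp add: mult.commute)
    thus ?thesis using is_subfieldD(6)[OF K(1) is_subfield_power[OF K(1) c(1)]] by blast
  qed
qed

end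

locale ramified_triple = ramified_pair +
  fixes \<omega> :: 'a
  assumes \<omega>: "\<omega> \<in> K" "vge 0 \<omega>"
begin

definition \<Theta> :: "'a \<Rightarrow> 'a" where "\<Theta> x = \<gamma> (sexp \<omega> x)"

definition D :: "'a \<Rightarrow> 'a" where "D x = \<Theta> x - x"

lemma \<Theta>_add: "\<Theta> (x + y) = \<Theta> x + \<Theta> y"
proof -
  have "sexp \<omega> (x + y) = sexp \<omega> x + sexp \<omega> y"
    by (simp add: sexp_def Y_plus distrib_left sum.distrib)
  thus ?thesis by (simp add: \<Theta>_def aut_add[OF \<gamma>])
qed

lemma \<Theta>_scale: assumes "c \<in> K" shows "\<Theta> (c * x) = c * \<Theta> x"
proof -
  have "sexp \<omega> (c * x) = c * sexp \<omega> x"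
    by (simp add: sexp_def Y_scale[OF assms] mult.left_commute sum_distrib_left)
  thus ?thesis by (simp add: \<Theta>_def aut_mult[OF \<gamma>] aut_K[OF \<gamma> assms])
qed

lemma D_add: "D (x + y) = D x + D y"
  by (simp add: D_def \<Theta>_add)

lemma D_scale: "c \<in> K \<Longrightarrow> D (c * x) = c * D x"
  by (simp add: D_def \<Theta>_scale right_diff_distrib)

lemma D_1: "D 1 = 0"
proof -
  have "Y i 1 = 0" if "1 \<le> i" for i
  proof -
    have "Y (i - 1 + 1) 1 = Y (i - 1) (Y 1 1)" by (rule Y_add)
    thus ?thesis using that by (simp add: Y_Suc aut_1[OF \<sigma>(1)] Y_zero)
  qed
  hence "sexp \<omega> 1 - 1 = 0" unfolding sexp_minus by (intro sum.neutral) auto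
  thus ?thesis by (simp add: D_def \<Theta>_def aut_1[OF \<gamma>])
qed

lemma D_Y: "D (Y i x) = Y i (D x)"
proof -
  have "Y i (sexp \<omega> x) = (\<Sum>j<p. (\<omega> gchoose j) * Y i (Y j x))"
    unfolding sexp_def Y_sum by (simp add: Y_scale[OF is_subfield_gbinomial[OF K(1) \<omega>(1)]])
  also have "\<dots> = sexp \<omega> (Y i x)" unfolding sexp_def by (subst Y_commute) (rule refl)
  finally have "\<Theta> (Y i x) = Y i (\<Theta> x)" by (simp add: \<Theta>_def \<gamma>_Y[symmetric])
  thus ?thesis by (simp add: D_def Y_diff)
qed

lemma vge_sexp_minus: assumes "vge n x" shows "vge (n + b) (sexp \<omega> x - x)"
  unfolding sexp_minus
proof (rule vge_sum)
  fix i assume "i \<in> {1..<p}"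
  hence i: "i < p" "1 \<le> i" by auto
  show "vge (n + b) ((\<omega> gchoose i) * Y i x)"
    by (rule vge_mult0[OF vge_gbinomial[OF \<omega>(2) i(1)] vge_Y_1[OF assms i(2)]])
qed

lemma vge_D: assumes "vge n x" shows "vge (n + b) (D x)"
proof -
  have "D x = \<gamma> (sexp \<omega> x - x) + (\<gamma> x - x)"
    by (simp add: D_def \<Theta>_def aut_diff[OF \<gamma>])
  thus ?thesis using aut_vge[OF \<gamma> vge_sexp_minus[OF assms]] raise_b[OF \<gamma> assms] by (simp add: vge_add)
qed

text \<open>
  Terms of degree at least \<open>2\<close> in \<open>\<gamma> - 1\<close> and \<open>\<sigma> - 1\<close> raise by \<open>2 b\<close>.
\<close>

lemma D_linear_part:
  assumes "vge n x"
  shows "vge (n + 2 * b) (D x - ((\<gamma> x - x) + \<omega> * (\<sigma> x - x)))"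
proof -
  define S where "S = (\<Sum>i=2..<p. (\<omega> gchoose i) * Y i x)"
  have "{1..<p} = insert 1 {2..<p}" using p_gt_1 by auto
  hence s: "sexp \<omega> x - x = \<omega> * (\<sigma> x - x) + S"
    by (simp add: sexp_minus S_def Y_Suc)
  have S: "vge (n + 2 * b) S"
    unfolding S_def
  proof (rule vge_sum)
    fix i assume i: "i \<in> {2..<p}"
    have "2 * b \<le> int i * b" using i b_ge_1 by (intro mult_right_mono) auto
    hence "vge (n + 2 * b) (Y i x)" using vge_mono[OF vge_Y[OF assms, of i]] by simp
    moreover have "vge 0 (\<omega> gchoose i)" using i by (intro vge_gbinomial[OF \<omega>(2)]) auto
    ultimately show "vge (n + 2 * b) ((\<omega> gchoose i) * Y i x)" by (rule vge_mult0[rotated])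
  qed
  have "D x = \<gamma> (sexp \<omega> x - x) + (\<gamma> x - x)"
    by (simp add: D_def \<Theta>_def aut_diff[OF \<gamma>])
  hence lin: "D x - ((\<gamma> x - x) + \<omega> * (\<sigma> x - x)) = (\<gamma> (sexp \<omega> x - x) - (sexp \<omega> x - x)) + S"
    by (simp add: s)
  have "vge (n + 2 * b) (\<gamma> (sexp \<omega> x - x) - (sexp \<omega> x - x))"
    by (rule vge_mono[OF raise_b[OF \<gamma> vge_sexp_minus[OF assms]]]) simp
  from vge_add[OF this S] show ?thesis unfolding lin .
qed

lemma D_mult: "D (x * y) = x * D y + y * D x + D x * D y - \<gamma> (sexp_defect \<omega> x y)"
proof -
  have "\<Theta> (x * y) = \<gamma> (sexp \<omega> x * sexp \<omega> y - sexp_defect \<omega> x y)"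
    by (simp add: \<Theta>_def sexp_mult)
  also have "\<dots> = \<Theta> x * \<Theta> y - \<gamma> (sexp_defect \<omega> x y)"
    by (simp add: \<Theta>_def aut_diff[OF \<gamma>] aut_mult[OF \<gamma>])
  finally show ?thesis by (simp add: D_def algebra_simps)
qed

text \<open>
  In the product rule \<open>D_mult\<close> the defect is raised by \<open>p b\<close>; this is where \<open>s \<le> p b\<close> enters.
\<close>

lemma vge_D_mult:
  assumes s: "0 \<le> s" "s \<le> int p * b"
    and x: "vge n x" "vge (n + s) (D x)" and y: "vge m y" "vge (m + s) (D y)"
  shows "vge (n + m + s) (D (x * y))"
proof -
  have "vge (n + (m + s)) (x * D y)" by (intro vge_mult x y)
  moreover have "vge (m + (n + s)) (y * D x)" by (intro vge_mult x y)
  moreover have "vge ((n + s) + (m + s)) (D x * D y)" by (intro vge_mult x y)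
  hence "vge (n + m + s) (D x * D y)" by (rule vge_mono) (use s in simp)
  moreover have "vge (n + m + int p * b) (\<gamma> (sexp_defect \<omega> x y))"
    by (intro aut_vge[OF \<gamma>] vge_sexp_defect \<omega>(2) x y)
  hence "vge (n + m + s) (\<gamma> (sexp_defect \<omega> x y))" by (rule vge_mono) (use s in simp)
  ultimately show ?thesis
    unfolding D_mult by (intro vge_diff vge_add) (simp_all add: add_ac)
qed

text \<open>
  Since \<open>b\<close> is prime to \<open>p\<close> and \<open>K\<close> contains elements of value \<open>p ^ 2\<close>, the elements \<open>c * \<rho> ^ k\<close> with
  \<open>c \<in> K\<close> take every value, and \<open>D\<close> raises them by \<open>s\<close>.  An arbitrary \<open>z\<close> is expanded to finite
  precision in such elements with coefficients from \<open>K\<close>.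
\<close>

lemma vge_D_all:
  assumes s: "0 \<le> s" "s \<le> int p * b" and \<rho>: "veq b \<rho>" "vge (b + s) (D \<rho>)" and z: "vge n z"
  shows "vge (n + s) (D z)"
proof -
  have pow: "vge (int k * b + s) (D (\<rho> ^ k))" for k
  proof (induction k)
    case (Suc k)
    from vge_D_mult[OF s veq_vge[OF \<rho>(1)] \<rho>(2) vge_power[OF veq_vge[OF \<rho>(1)]] Suc]
    show ?case by (simp add: algebra_simps)
  qed (simp add: D_1)
  \<comment> \<open>\<open>\<rho> ^ k\<close> with \<open>k b = m\<close> modulo \<open>p ^ 2\<close>, corrected by an element of \<open>K\<close>\<close>
  have basis: "\<exists>z0. veq m z0 \<and> vge (m + s) (D z0)" for m
  proof -
    have "coprime b (int p ^ 2)"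
      using not_dvd_b p by (metis coprime_commute coprime_power_right_iff prime_imp_coprime prime_int_nat_transfer prime_nat_int_transfer)
    then obtain k0 where k0: "[b * k0 = 1] (mod (int p ^ 2))"
      using cong_solve_coprime_int by blast
    define k where "k = nat ((k0 * m) mod (int p ^ 2))"
    have pp: "0 < int p ^ 2" using p_gt_1 by simp
    have "int k = (k0 * m) mod (int p ^ 2)" using pp by (simp add: k_def)
    hence "[int k * b = k0 * m * b] (mod (int p ^ 2))" by (simp add: cong_def mod_mult_left_eq)
    moreover have "[k0 * m * b = m] (mod (int p ^ 2))"
      using cong_scalar_right[OF k0, of m] by (simp add: mult_ac)
    ultimately have "[m = int k * b] (mod (int p ^ 2))" by (metis cong_sym cong_trans)
    then obtain j where j: "m - int k * b = int p ^ 2 * j"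
      by (auto simp: cong_iff_dvd_diff elim!: dvdE)
    obtain c where c: "c \<in> K" "veq (int p ^ 2 * j) c" using K_val by blast
    have "veq (int p ^ 2 * j + int k * b) (c * \<rho> ^ k)" by (intro veq_mult c(2) veq_power \<rho>(1))
    moreover have "vge (int p ^ 2 * j + (int k * b + s)) (c * D (\<rho> ^ k))"
      by (intro vge_mult veq_vge[OF c(2)] pow)
    moreover have "int p ^ 2 * j + int k * b = m" using j by simp
    ultimately show ?thesis by (metis D_scale[OF c(1)] add.assoc)
  qed
  \<comment> \<open>the expansion of \<open>x\<close>, by induction on the number \<open>d\<close> of its terms: each step removes the leading one\<close>
  have "vge (n + s) (D x)" if "vge (n + s - int d) x" "int d \<le> s" for d x
    using that
  proof (induction d arbitrary: x)
    case 0
    from vge_D[OF 0(1)] show ?case using b_ge_1 by (auto elim: vge_mono)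
  next
    case (Suc d)
    show ?case
    proof (cases "vge (n + s - int d) x")
      case True thus ?thesis using Suc by simp
    next
      case False
      define m where "m = n + s - int (Suc d)"
      have m1: "m + 1 = n + s - int d" by (simp add: m_def)
      have x: "veq m x"
        using Suc.prems(1) False unfolding m1[symmetric] m_def[symmetric] by (rule vge_imp_veq)
      have mn: "n \<le> m" using Suc.prems(2) by (simp add: m_def)
      obtain z0 where z0: "veq m z0" "vge (m + s) (D z0)" using basis by blast
      have "veq 0 (x / z0)" using veq_divide[OF x z0(1)] by simp
      then obtain \<kappa> where \<kappa>: "\<kappa> \<in> K" "vge 0 \<kappa>" "vge 1 (x / z0 - \<kappa>)" using tot veq_vge by blast
      have "vge (1 + m) ((x / z0 - \<kappa>) * z0)" by (rule vge_mult[OF \<kappa>(3) veq_vge[OF z0(1)]])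
      moreover have "(x / z0 - \<kappa>) * z0 = x - \<kappa> * z0" using veq_nonzero[OF z0(1)] by (simp add: left_diff_distrib)
      ultimately have "vge (1 + m) (x - \<kappa> * z0)" by (simp only:)
      hence "vge (n + s - int d) (x - \<kappa> * z0)" by (rule vge_mono) (simp add: m_def)
      hence "vge (n + s) (D (x - \<kappa> * z0))" using Suc by simp
      moreover have "vge (n + s) (\<kappa> * D z0)"
        by (rule vge_mono[OF vge_mult0[OF \<kappa>(2) z0(2)]]) (use mn in simp)
      ultimately have "vge (n + s) (D (x - \<kappa> * z0) + \<kappa> * D z0)" by (rule vge_add)
      thus ?thesis using D_add[of "x - \<kappa> * z0" "\<kappa> * z0"] by (simp add: D_scale[OF \<kappa>(1)])
    qed
  qed
  from this[of "nat s" z] z s show ?thesis by simp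
qed

text \<open>
  Suppose \<open>D\<close> raises \<open>\<rho>\<close> by more than \<open>p b\<close>, and hence everything by at least \<open>p b\<close>.  In the
  product rule for \<open>\<rho>\<close> and \<open>y = (Y ^^ (p - 2)) \<rho>\<close> every term except the defect then has value greater
  than \<open>2 p b\<close>.  The defect, however, has value exactly \<open>2 p b\<close>: its term with indices \<open>p - 1\<close> and \<open>1\<close> is
  \<open>p * (\<omega> gchoose p)\<close> times the square of \<open>(Y ^^ (p - 1)) \<rho>\<close>, and the other terms
  have larger value.
\<close>

lemma D_bound:
  assumes \<omega>_m: "\<And>m. m < p \<Longrightarrow> veq 0 (\<omega> - of_nat m)" and \<rho>: "veq b \<rho>"
  shows "\<not> vge (b + int p * b + 1) (D \<rho>)"
proof
  assume big: "vge (b + int p * b + 1) (D \<rho>)"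
  have pb: "0 \<le> int p * b" using b_ge_1 by simp
  have all: "vge (n + int p * b) (D z)" if "vge n z" for n z
    using vge_D_all[OF pb _ \<rho> vge_mono[OF big] that] by simp
  define y where "y = Y (p - 2) \<rho>"
  have p2: "2 \<le> p" using p_gt_1 by simp
  have y: "veq ((int p - 1) * b) y"
    using veq_Y[OF \<rho>, of "p - 2"] p2 by (simp add: y_def of_nat_diff)
  have Yy: "Y j y = Y (j + (p - 2)) \<rho>" for j by (simp add: y_def Y_add)
  have Dy: "vge ((int p - 1) * b + int p * b + 1) (D y)"
  proof -
    have "vge (b + int p * b + 1 + int (p - 2) * b) (Y (p - 2) (D \<rho>))" by (rule vge_Y[OF big])
    thus ?thesis using p2 by (simp add: y_def D_Y of_nat_diff algebra_simps)
  qed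
  have xy: "veq (int p * b) (\<rho> * y)" using veq_mult[OF \<rho> y] by (simp add: algebra_simps)
  have top: "veq (int p * b) (Y (p - 1) \<rho>)" using veq_Y[OF \<rho>, of "p - 1"] p2 by (simp add: of_nat_diff)
  \<comment> \<open>only the term with indices \<open>p - 1\<close> and \<open>1\<close> has a value as small as \<open>2 p b\<close>\<close>
  have E: "veq (2 * int p * b) (sexp_defect \<omega> \<rho> y)"
  proof -
    let ?t = "\<lambda>i j. trunc_defect_coeff p \<omega> i j * (Y i \<rho> * Y j y)"
    have small: "vge (2 * int p * b + 1) (?t i j)" if ij: "i < p" "j < p" "(i, j) \<noteq> (p - 1, 1)" for i j
    proof (cases "i + j < p")
      case False
      have coeff: "vge 0 (trunc_defect_coeff p \<omega> i j)" by (rule vge_trunc_defect_coeff[OF \<omega>(2) ij(1,2)])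
      have Yi: "vge ((int i + 1) * b) (Y i \<rho>)" by (rule veq_vge[OF veq_Y[OF \<rho> ij(1)]])
      have "vge (2 * int p * b + 1) (Y i \<rho> * Y j y)"
      proof (cases "j = 1")
        case True
        hence "i = p - 1" using False ij by simp
        thus ?thesis using True ij by simp
      next
        case j1: False
        hence "2 \<le> j" using False ij by (cases j) auto
        hence "p \<le> j + (p - 2)" using p2 by simp
        from vge_Y_ge_p[OF \<rho> this] have "vge ((int j + int p - 1) * b + 1) (Y j y)"
          using p2 by (simp add: Yy of_nat_diff)
        from vge_mult[OF Yi this]
        have "vge ((int i + 1) * b + ((int j + int p - 1) * b + 1)) (Y i \<rho> * Y j y)" .
        moreover have "2 * int p * b \<le> (int i + int j + int p) * b"
          using False b_ge_1 by (intro mult_right_mono) auto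
        ultimately show ?thesis
          using vge_mono[of "(int i + 1) * b + ((int j + int p - 1) * b + 1)" _ "2 * int p * b + 1"]
          by (simp add: algebra_simps)
      qed
      thus ?thesis by (rule vge_mult0[OF coeff])
    qed (simp add: trunc_defect_coeff_eq_0)
    have Y1y: "Y 1 y = Y (p - 1) \<rho>" unfolding Yy using p2 by (simp add: Suc_diff_Suc numeral_2_eq_2)
    have "veq (0 + (int p * b + int p * b)) (?t (p - 1) 1)"
      unfolding trunc_defect_coeff_top[OF p_gt_1] Y1y
      by (intro veq_mult veq_p_gbinomial_p \<omega>_m top)
    moreover have "0 + (int p * b + int p * b) = 2 * int p * b" by simp
    ultimately have main: "veq (2 * int p * b) (?t (p - 1) 1)" by (simp only:)
    have split: "sexp_defect \<omega> \<rho> y =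
        ?t (p - 1) 1 + (\<Sum>z\<in>{..<p} \<times> {..<p} - {(p - 1, 1)}. ?t (fst z) (snd z))"
    proof -
      have "sexp_defect \<omega> \<rho> y = (\<Sum>z\<in>{..<p} \<times> {..<p}. ?t (fst z) (snd z))"
        unfolding sexp_defect_def by (simp add: sum.cartesian_product case_prod_unfold)
      also have "\<dots> = ?t (p - 1) 1 + (\<Sum>z\<in>{..<p} \<times> {..<p} - {(p - 1, 1)}. ?t (fst z) (snd z))"
        by (subst sum.remove[of _ "(p - 1, 1)"]) (use p_gt_1 in auto)
      finally show ?thesis .
    qed
    have "vge (2 * int p * b + 1) (\<Sum>z\<in>{..<p} \<times> {..<p} - {(p - 1, 1)}. ?t (fst z) (snd z))"
    proof (rule vge_sum)
      fix z assume "z \<in> {..<p} \<times> {..<p} - {(p - 1, 1)}"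
      thus "vge (2 * int p * b + 1) (?t (fst z) (snd z))"
        using small[of "fst z" "snd z"] by (cases z) auto
    qed
    thus ?thesis unfolding split by (rule veq_add[OF main])
  qed
  obtain \<kappa> where \<kappa>: "\<kappa> \<in> K" "vge 0 \<kappa>" "vge 1 ((\<rho> * y) / Y (p - 1) \<rho> - \<kappa>)"
    using tot[of "(\<rho> * y) / Y (p - 1) \<rho>"] veq_vge[OF veq_divide[OF xy top]] by auto
  define z where "z = \<rho> * y - \<kappa> * Y (p - 1) \<rho>"
  have "vge (1 + int p * b) (((\<rho> * y) / Y (p - 1) \<rho> - \<kappa>) * Y (p - 1) \<rho>)"
    by (rule vge_mult[OF \<kappa>(3) veq_vge[OF top]])
  moreover have "((\<rho> * y) / Y (p - 1) \<rho> - \<kappa>) * Y (p - 1) \<rho> = z"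
    using veq_nonzero[OF top] by (simp add: z_def left_diff_distrib)
  ultimately have z: "vge (1 + int p * b) z" by (simp only:)
  have "D (\<rho> * y) = D z + \<kappa> * D (Y (p - 1) \<rho>)"
    using D_add[of z "\<kappa> * Y (p - 1) \<rho>"] by (simp add: z_def D_scale[OF \<kappa>(1)])
  moreover have "vge (2 * int p * b + 1) (D z)"
    using all[OF z] by (simp add: algebra_simps)
  moreover have "vge (2 * int p * b + 1) (\<kappa> * D (Y (p - 1) \<rho>))"
  proof -
    have "vge (b + int p * b + 1 + int (p - 1) * b) (Y (p - 1) (D \<rho>))" by (rule vge_Y[OF big])
    hence "vge (2 * int p * b + 1) (D (Y (p - 1) \<rho>))" using p2 by (simp add: D_Y of_nat_diff algebra_simps)
    thus ?thesis by (rule vge_mult0[OF \<kappa>(2)])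
  qed
  ultimately have Dxy: "vge (2 * int p * b + 1) (D (\<rho> * y))" by (simp add: vge_add)
  have 1: "vge (b + ((int p - 1) * b + int p * b + 1)) (\<rho> * D y)"
    by (intro vge_mult veq_vge[OF \<rho>] Dy)
  have 2: "vge ((int p - 1) * b + (b + int p * b + 1)) (y * D \<rho>)"
    by (intro vge_mult veq_vge[OF y] big)
  have "vge ((b + int p * b + 1) + ((int p - 1) * b + int p * b + 1)) (D \<rho> * D y)"
    by (intro vge_mult Dy big)
  hence 3: "vge (2 * int p * b + 1) (D \<rho> * D y)"
    by (rule vge_mono) (use pb in \<open>simp add: algebra_simps\<close>)
  have "vge (2 * int p * b + 1) (\<rho> * D y + y * D \<rho> + D \<rho> * D y - D (\<rho> * y))"
    using 1 2 3 Dxy by (intro vge_diff vge_add) (simp_all add: algebra_simps)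
  hence "vge (2 * int p * b + 1) (\<gamma> (sexp_defect \<omega> \<rho> y))" by (simp add: D_mult)
  with aut_veq[OF \<gamma> E] show False by (simp add: veq_iff)
qed

end

section \<open>Group rings\<close>

locale group_algebra = comm_group G for G :: "('g, 'm) monoid_scheme" (structure) +
  fixes R :: "'a::field_char_0 set"
  assumes fin: "finite (carrier G)"
    and R_0: "0 \<in> R" and R_1: "1 \<in> R"
    and R_add: "\<And>x y. x \<in> R \<Longrightarrow> y \<in> R \<Longrightarrow> x + y \<in> R"
    and R_mult: "\<And>x y. x \<in> R \<Longrightarrow> y \<in> R \<Longrightarrow> x * y \<in> R"
    and R_uminus: "\<And>x. x \<in> R \<Longrightarrow> - x \<in> R"
begin

abbreviation RG :: "('g \<Rightarrow> 'a) ring" where "RG \<equiv> group_ring R G"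

lemma R_diff: "x \<in> R \<Longrightarrow> y \<in> R \<Longrightarrow> x - y \<in> R"
  using R_add[of x "- y"] R_uminus[of y] by simp

lemma R_sum: "(\<And>i. i \<in> I \<Longrightarrow> f i \<in> R) \<Longrightarrow> sum f I \<in> R"
  by (induction I rule: infinite_finite_induct) (simp_all add: R_0 R_add)

lemma R_of_nat: "of_nat n \<in> R"
  by (induction n) (simp_all add: R_0 R_1 R_add)

lemma carrier_RG: "x \<in> carrier RG \<longleftrightarrow> (\<forall>g\<in>carrier G. x g \<in> R) \<and> (\<forall>g. g \<notin> carrier G \<longrightarrow> x g = 0)"
  by (simp add: group_ring_def)

lemma RG_in: "x \<in> carrier RG \<Longrightarrow> x g \<in> R"
  using R_0 by (cases "g \<in> carrier G") (auto simp: carrier_RG)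

lemma RG_out: "x \<in> carrier RG \<Longrightarrow> g \<notin> carrier G \<Longrightarrow> x g = 0"
  by (simp add: carrier_RG)

lemma RG_I: "(\<And>g. g \<in> carrier G \<Longrightarrow> x g \<in> R) \<Longrightarrow> (\<And>g. g \<notin> carrier G \<Longrightarrow> x g = 0) \<Longrightarrow> x \<in> carrier RG"
  by (simp add: carrier_RG)

lemma RG_add: "x \<oplus>\<^bsub>group_ring R' G\<^esub> y = (\<lambda>g. x g + y g)"
  by (simp add: group_ring_def)

lemma RG_zero: "\<zero>\<^bsub>group_ring R' G\<^esub> = (\<lambda>g. 0)"
  by (simp add: group_ring_def)

lemma RG_one: "\<one>\<^bsub>group_ring R' G\<^esub> = (\<lambda>g. if g = \<one> then 1 else 0)"
  by (simp add: group_ring_def)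

lemma RG_mult: "x \<otimes>\<^bsub>group_ring R' G\<^esub> y =
    (\<lambda>g. if g \<in> carrier G then \<Sum>h\<in>carrier G. x h * y (inv h \<otimes> g) else 0)"
  by (simp add: group_ring_def)

lemma sum_translate:
  assumes "h \<in> carrier G"
  shows "(\<Sum>k\<in>carrier G. F k) = (\<Sum>m\<in>carrier G. F (h \<otimes> m))"
proof (rule sum.reindex_bij_witness[of _ "\<lambda>m. h \<otimes> m" "\<lambda>k. inv h \<otimes> k"])
  fix a assume a: "a \<in> carrier G"
  show "h \<otimes> (inv h \<otimes> a) = a" "inv h \<otimes> a \<in> carrier G"
    using assms a by (simp_all add: m_assoc[symmetric])
  thus "F (h \<otimes> (inv h \<otimes> a)) = F a" by simp
  show "inv h \<otimes> (h \<otimes> a) = a" "h \<otimes> a \<in> carrier G"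
    using assms a by (simp_all add: m_assoc[symmetric])
qed

lemma RG_mult_closed: "x \<in> carrier RG \<Longrightarrow> y \<in> carrier RG \<Longrightarrow> x \<otimes>\<^bsub>RG\<^esub> y \<in> carrier RG"
  by (rule RG_I) (simp_all add: RG_mult R_sum R_mult RG_in)

lemma RG_mult_comm:
  fixes x y :: "'g \<Rightarrow> 'a"
  shows "x \<otimes>\<^bsub>RG\<^esub> y = y \<otimes>\<^bsub>RG\<^esub> x"
proof
  fix g
  show "(x \<otimes>\<^bsub>RG\<^esub> y) g = (y \<otimes>\<^bsub>RG\<^esub> x) g"
  proof (cases "g \<in> carrier G")
    case True
    have "(\<Sum>h\<in>carrier G. x h * y (inv h \<otimes> g)) = (\<Sum>k\<in>carrier G. y k * x (inv k \<otimes> g))"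
    proof (rule sum.reindex_bij_witness[of _ "\<lambda>k. inv k \<otimes> g" "\<lambda>h. inv h \<otimes> g"])
      fix a assume a: "a \<in> carrier G"
      have e: "inv (inv a \<otimes> g) \<otimes> g = a"
        using a True by (simp add: inv_mult m_assoc m_comm[of a] ) (simp add: m_assoc[symmetric])
      show "inv (inv a \<otimes> g) \<otimes> g = a" "inv (inv a \<otimes> g) \<otimes> g = a" by (rule e)+
      show "inv a \<otimes> g \<in> carrier G" "inv a \<otimes> g \<in> carrier G" using a True by simp_all
      show "y (inv a \<otimes> g) * x (inv (inv a \<otimes> g) \<otimes> g) = x a * y (inv a \<otimes> g)"
        by (simp add: e)
    qed
    thus ?thesis using True by (simp add: RG_mult)
  qed (simp add: RG_mult)
qed

lemma RG_mult_assoc: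
  fixes x y z :: "'g \<Rightarrow> 'a"
  shows "(x \<otimes>\<^bsub>RG\<^esub> y) \<otimes>\<^bsub>RG\<^esub> z = x \<otimes>\<^bsub>RG\<^esub> (y \<otimes>\<^bsub>RG\<^esub> z)"
proof
  fix g
  show "((x \<otimes>\<^bsub>RG\<^esub> y) \<otimes>\<^bsub>RG\<^esub> z) g = (x \<otimes>\<^bsub>RG\<^esub> (y \<otimes>\<^bsub>RG\<^esub> z)) g"
  proof (cases "g \<in> carrier G")
    case True
    have "((x \<otimes>\<^bsub>RG\<^esub> y) \<otimes>\<^bsub>RG\<^esub> z) g =
        (\<Sum>k\<in>carrier G. \<Sum>h\<in>carrier G. x h * (y (inv h \<otimes> k) * z (inv k \<otimes> g)))"
      using True by (simp add: RG_mult sum_distrib_right mult.assoc)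
    also have "\<dots> = (\<Sum>h\<in>carrier G. \<Sum>k\<in>carrier G. x h * (y (inv h \<otimes> k) * z (inv k \<otimes> g)))"
      by (rule sum.swap)
    also have "\<dots> = (\<Sum>h\<in>carrier G. \<Sum>m\<in>carrier G. x h * (y m * z (inv m \<otimes> (inv h \<otimes> g))))"
    proof (rule sum.cong[OF refl])
      fix h assume h: "h \<in> carrier G"
      have "(\<Sum>k\<in>carrier G. x h * (y (inv h \<otimes> k) * z (inv k \<otimes> g))) =
          (\<Sum>m\<in>carrier G. x h * (y (inv h \<otimes> (h \<otimes> m)) * z (inv (h \<otimes> m) \<otimes> g)))"
        by (rule sum_translate[OF h])
      also have "\<dots> = (\<Sum>m\<in>carrier G. x h * (y m * z (inv m \<otimes> (inv h \<otimes> g))))"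
      proof (rule sum.cong[OF refl])
        fix m assume m: "m \<in> carrier G"
        have "inv h \<otimes> (h \<otimes> m) = m" using h m by (simp add: m_assoc[symmetric])
        moreover have "inv (h \<otimes> m) \<otimes> g = inv m \<otimes> (inv h \<otimes> g)"
          using h m True by (simp add: inv_mult_group m_assoc)
        ultimately show "x h * (y (inv h \<otimes> (h \<otimes> m)) * z (inv (h \<otimes> m) \<otimes> g)) =
            x h * (y m * z (inv m \<otimes> (inv h \<otimes> g)))" by simp
      qed
      finally show "(\<Sum>k\<in>carrier G. x h * (y (inv h \<otimes> k) * z (inv k \<otimes> g))) =
          (\<Sum>m\<in>carrier G. x h * (y m * z (inv m \<otimes> (inv h \<otimes> g))))" .
    qed
    also have "\<dots> = (x \<otimes>\<^bsub>RG\<^esub> (y \<otimes>\<^bsub>RG\<^esub> z)) g"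
      using True by (simp add: RG_mult sum_distrib_left)
    finally show ?thesis .
  qed (simp add: RG_mult)
qed

lemma RG_l_one:
  assumes "x \<in> carrier RG"
  shows "\<one>\<^bsub>RG\<^esub> \<otimes>\<^bsub>RG\<^esub> x = x"
proof
  fix g
  show "(\<one>\<^bsub>RG\<^esub> \<otimes>\<^bsub>RG\<^esub> x) g = x g"
  proof (cases "g \<in> carrier G")
    case True
    have "(\<Sum>h\<in>carrier G. (if h = \<one> then 1 else 0) * x (inv h \<otimes> g)) =
        (\<Sum>h\<in>carrier G. if h = \<one> then x g else 0)"
      using True by (intro sum.cong refl) auto
    thus ?thesis using True fin by (simp add: RG_mult RG_one)
  qed (use assms in \<open>simp add: RG_mult RG_out\<close>)
qed

lemma cring_RG: "cring RG"
proof (rule cringI)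
  show "abelian_group RG"
  proof (rule abelian_groupI)
    fix x assume "x \<in> carrier RG"
    hence "(\<lambda>g. - x g) \<in> carrier RG" by (auto simp: carrier_RG R_uminus)
    thus "\<exists>y\<in>carrier RG. y \<oplus>\<^bsub>RG\<^esub> x = \<zero>\<^bsub>RG\<^esub>"
      by (rule bexI[rotated]) (simp add: RG_add RG_zero)
  qed (auto simp: RG_add RG_zero carrier_RG R_0 R_add algebra_simps)
  show "comm_monoid RG"
    by (rule comm_monoidI)
      (auto simp: RG_mult_closed RG_mult_assoc RG_l_one intro: RG_mult_comm,
       auto simp: carrier_RG RG_one R_0 R_1)
  show "(x \<oplus>\<^bsub>RG\<^esub> y) \<otimes>\<^bsub>RG\<^esub> z = x \<otimes>\<^bsub>RG\<^esub> z \<oplus>\<^bsub>RG\<^esub> y \<otimes>\<^bsub>RG\<^esub> z" for x y z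
    by (simp add: RG_mult RG_add fun_eq_iff distrib_right sum.distrib)
qed

sublocale RG: cring RG by (rule cring_RG)

lemma RG_a_inv: "x \<in> carrier RG \<Longrightarrow> \<ominus>\<^bsub>RG\<^esub> x = (\<lambda>g. - x g)"
  by (rule RG.minus_equality) (auto simp: RG_add RG_zero carrier_RG R_uminus)

lemma RG_minus: "y \<in> carrier RG \<Longrightarrow> x \<ominus>\<^bsub>RG\<^esub> y = (\<lambda>g. x g - y g)"
  by (simp add: a_minus_def RG_a_inv RG_add)

definition smult :: "'a \<Rightarrow> ('g \<Rightarrow> 'a) \<Rightarrow> 'g \<Rightarrow> 'a" where
  "smult c x = (\<lambda>g. c * x g)"

lemma smult_closed: "c \<in> R \<Longrightarrow> x \<in> carrier RG \<Longrightarrow> smult c x \<in> carrier RG"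
  by (auto simp: carrier_RG smult_def R_mult)

lemma smult_mult: "smult c x \<otimes>\<^bsub>RG\<^esub> y = smult c (x \<otimes>\<^bsub>RG\<^esub> y)"
  by (auto simp: RG_mult smult_def sum_distrib_left mult.assoc)

lemma mult_smult: "x \<otimes>\<^bsub>RG\<^esub> smult c y = smult c (x \<otimes>\<^bsub>RG\<^esub> y)"
  by (auto simp: RG_mult smult_def sum_distrib_left mult.left_commute)

lemma sum_mult: "(\<lambda>g. \<Sum>i\<in>I. z i g) \<otimes>\<^bsub>RG\<^esub> y = (\<lambda>g. \<Sum>i\<in>I. (z i \<otimes>\<^bsub>RG\<^esub> y) g)"
proof
  fix g
  show "((\<lambda>g. \<Sum>i\<in>I. z i g) \<otimes>\<^bsub>RG\<^esub> y) g = (\<Sum>i\<in>I. (z i \<otimes>\<^bsub>RG\<^esub> y) g)"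
  proof (cases "g \<in> carrier G")
    case True
    have "((\<lambda>g. \<Sum>i\<in>I. z i g) \<otimes>\<^bsub>RG\<^esub> y) g = (\<Sum>h\<in>carrier G. \<Sum>i\<in>I. z i h * y (inv h \<otimes> g))"
      using True by (simp add: RG_mult sum_distrib_right)
    also have "\<dots> = (\<Sum>i\<in>I. \<Sum>h\<in>carrier G. z i h * y (inv h \<otimes> g))" by (rule sum.swap)
    finally show ?thesis using True by (simp add: RG_mult)
  qed (simp add: RG_mult)
qed

lemma mult_sum: "y \<otimes>\<^bsub>RG\<^esub> (\<lambda>g. \<Sum>i\<in>I. z i g) = (\<lambda>g. \<Sum>i\<in>I. (y \<otimes>\<^bsub>RG\<^esub> z i) g)"
  using sum_mult[of z I y] by (simp add: RG_mult_comm[of y])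

lemma ideal_smult:
  assumes "ideal J RG" "c \<in> R" "z \<in> J"
  shows "smult c z \<in> J"
proof -
  interpret J: ideal J RG by (rule assms(1))
  have z: "z \<in> carrier RG" using assms(3) by (rule J.Icarr)
  have "smult c z = smult c \<one>\<^bsub>RG\<^esub> \<otimes>\<^bsub>RG\<^esub> z" by (simp add: smult_mult RG.l_one[OF z])
  thus ?thesis using J.I_l_closed[OF assms(3) smult_closed[OF assms(2) RG.one_closed]] by simp
qed

lemma ideal_add: "ideal J RG \<Longrightarrow> x \<in> J \<Longrightarrow> y \<in> J \<Longrightarrow> (\<lambda>g. x g + y g) \<in> J"
  using additive_subgroup.a_closed[OF ideal.axioms(1), of J RG x y] by (simp add: RG_add)

lemma ideal_zero: "ideal J RG \<Longrightarrow> (\<lambda>g. 0) \<in> J"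
  using additive_subgroup.zero_closed[OF ideal.axioms(1), of J RG] by (simp add: RG_zero)

lemma ideal_lincomb:
  assumes J: "ideal J RG" and "\<And>i. i \<in> I \<Longrightarrow> c i \<in> R" "\<And>i. i \<in> I \<Longrightarrow> z i \<in> J"
  shows "(\<lambda>g. \<Sum>i\<in>I. c i * z i g) \<in> J"
  using assms(2,3)
proof (induction I rule: infinite_finite_induct)
  case (insert i I)
  have "(\<lambda>g. smult (c i) (z i) g + (\<Sum>i\<in>I. c i * z i g)) \<in> J"
    using insert by (intro ideal_add[OF J] ideal_smult[OF J]) auto
  thus ?case using insert.hyps by (simp add: smult_def)
qed (simp_all add: ideal_zero[OF J])

lemma RG_lincomb:
  assumes "\<And>i. i \<in> I \<Longrightarrow> c i \<in> R" "\<And>i. i \<in> I \<Longrightarrow> z i \<in> carrier RG"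
  shows "(\<lambda>g. \<Sum>i\<in>I. c i * z i g) \<in> carrier RG"
  using assms by (intro ideal_lincomb RG.oneideal)

lemma group_ring_of_closed: "g \<in> carrier G \<Longrightarrow> group_ring_of g \<in> carrier RG"
  by (auto simp: carrier_RG group_ring_of_def R_0 R_1)

lemma group_ring_of_one: "group_ring_of \<one> = \<one>\<^bsub>RG\<^esub>"
  by (simp add: group_ring_of_def RG_one)

lemma group_ring_of_mult:
  assumes g: "g \<in> carrier G" and h: "h \<in> carrier G"
  shows "(group_ring_of g :: 'g \<Rightarrow> 'a) \<otimes>\<^bsub>RG\<^esub> group_ring_of h = group_ring_of (g \<otimes> h)"
proof
  fix k
  show "((group_ring_of g :: 'g \<Rightarrow> 'a) \<otimes>\<^bsub>RG\<^esub> group_ring_of h) k = group_ring_of (g \<otimes> h) k"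
  proof (cases "k \<in> carrier G")
    case True
    have eq: "inv g \<otimes> k = h \<longleftrightarrow> k = g \<otimes> h" using g h True inv_solve_left' by metis
    have "(\<Sum>l\<in>carrier G. (if l = g then 1 else 0) * (if inv l \<otimes> k = h then 1 else 0 :: 'a)) =
        (\<Sum>l\<in>carrier G. if l = g then (if inv g \<otimes> k = h then 1 else 0) else 0)"
      by (intro sum.cong refl) auto
    thus ?thesis using True fin g by (simp add: RG_mult group_ring_of_def eq)
  qed (use g h in \<open>auto simp: RG_mult group_ring_of_def\<close>)
qed

lemma group_ring_of_pow:
  assumes "g \<in> carrier G"
  shows "(group_ring_of g :: 'g \<Rightarrow> 'a) [^]\<^bsub>RG\<^esub> (n::nat) = group_ring_of (g [^] n)"
  by (induction n) (simp_all add: group_ring_of_one group_ring_of_mult assms)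

lemma aug_gens: "(\<lambda>g. group_ring_of g \<ominus>\<^bsub>RG\<^esub> \<one>\<^bsub>RG\<^esub>) ` carrier G \<subseteq> carrier RG"
  using group_ring_of_closed by auto

lemma aug_ideal_induct:
  assumes z: "z \<in> aug_ideal R G"
    and gen: "\<And>g. g \<in> carrier G \<Longrightarrow> P (group_ring_of g \<ominus>\<^bsub>RG\<^esub> \<one>\<^bsub>RG\<^esub>)"
    and add: "\<And>x y. x \<in> carrier RG \<Longrightarrow> y \<in> carrier RG \<Longrightarrow> P x \<Longrightarrow> P y \<Longrightarrow> P (\<lambda>g. x g + y g)"
    and mult: "\<And>x y. x \<in> carrier RG \<Longrightarrow> y \<in> carrier RG \<Longrightarrow> P y \<Longrightarrow> P (x \<otimes>\<^bsub>RG\<^esub> y)"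
  shows "P z"
proof -
  let ?J = "{z \<in> carrier RG. P z}"
  have gJ: "group_ring_of g \<ominus>\<^bsub>RG\<^esub> \<one>\<^bsub>RG\<^esub> \<in> ?J" if "g \<in> carrier G" for g
    using gen[OF that] aug_gens that by blast
  have mJ: "x \<otimes>\<^bsub>RG\<^esub> y \<in> ?J" if "x \<in> carrier RG" "y \<in> ?J" for x y
    using mult[of x y] that by (simp add: RG_mult_closed)
  have "ideal ?J RG"
  proof (rule idealI)
    show "subgroup ?J (add_monoid RG)"
    proof (rule RG.add.subgroupI)
      show "?J \<noteq> {}" using gJ[OF one_closed] by blast
      show "\<ominus>\<^bsub>RG\<^esub> z \<in> ?J" if z: "z \<in> ?J" for z
      proof -
        have "\<ominus>\<^bsub>RG\<^esub> z = (\<ominus>\<^bsub>RG\<^esub> \<one>\<^bsub>RG\<^esub>) \<otimes>\<^bsub>RG\<^esub> z" using z by (simp add: RG.l_minus)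
        thus ?thesis using mJ[of "\<ominus>\<^bsub>RG\<^esub> \<one>\<^bsub>RG\<^esub>" z] z by simp
      qed
      show "z \<oplus>\<^bsub>RG\<^esub> w \<in> ?J" if "z \<in> ?J" "w \<in> ?J" for z w
        using add[of z w] that RG.a_closed[of z w] by (simp add: RG_add)
    qed auto
    show "x \<otimes>\<^bsub>RG\<^esub> a \<in> ?J" if "a \<in> ?J" "x \<in> carrier RG" for a x by (rule mJ[OF that(2,1)])
    show "a \<otimes>\<^bsub>RG\<^esub> x \<in> ?J" if "a \<in> ?J" "x \<in> carrier RG" for a x
      using mJ[OF that(2,1)] by (simp add: RG_mult_comm[of a])
  qed (rule RG.ring_axioms)
  hence "aug_ideal R G \<subseteq> ?J" unfolding aug_ideal_def by (rule RG.genideal_minimal) (use gJ in blast)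
  thus ?thesis using z by blast
qed

text \<open>
  Polynomial identities below degree \<open>p\<close> become congruences modulo the \<open>p\<close>-th power of the augmentation
  ideal when evaluated at \<open>x - 1\<close>.
\<close>

definition ev :: "('g \<Rightarrow> 'a) \<Rightarrow> 'a poly \<Rightarrow> 'g \<Rightarrow> 'a" where
  "ev s P = (\<lambda>g. \<Sum>i\<le>degree P. coeff P i * (s [^]\<^bsub>RG\<^esub> i) g)"

lemma ev_bound: assumes "degree P \<le> N" shows "ev s P = (\<lambda>g. \<Sum>i\<le>N. coeff P i * (s [^]\<^bsub>RG\<^esub> i) g)"
  unfolding ev_def
  by (rule ext, rule sum.mono_neutral_left) (use assms in \<open>auto simp: coeff_eq_0\<close>)

lemma ev_bound_less: assumes "degree P < N" shows "ev s P = (\<lambda>g. \<Sum>i<N. coeff P i * (s [^]\<^bsub>RG\<^esub> i) g)"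
  unfolding ev_def
  by (rule ext, rule sum.mono_neutral_left) (use assms in \<open>auto simp: coeff_eq_0\<close>)

lemma ev_add: "ev s (P + Q) = (\<lambda>g. ev s P g + ev s Q g)"
proof -
  let ?N = "max (degree P) (degree Q)"
  show ?thesis
    by (simp add: ev_bound[of P ?N] ev_bound[of Q ?N] ev_bound[of "P + Q" ?N] degree_add_le
        distrib_right sum.distrib)
qed

lemma ev_diff: "ev s (P - Q) = (\<lambda>g. ev s P g - ev s Q g)"
proof -
  let ?N = "max (degree P) (degree Q)"
  show ?thesis
    by (simp add: ev_bound[of P ?N] ev_bound[of Q ?N] ev_bound[of "P - Q" ?N] degree_diff_le
        left_diff_distrib sum_subtractf)
qed

lemma ev_smult: "ev s (Polynomial.smult c P) = smult c (ev s P)"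
  by (simp add: ev_bound[of "Polynomial.smult c P" "degree P"] degree_smult_le ev_def smult_def
      sum_distrib_left mult.assoc)

lemma ev_0: "ev s 0 = (\<lambda>g. 0)"
  by (simp add: ev_def)

lemma ev_sum: "ev s (sum P I) = (\<lambda>g. \<Sum>i\<in>I. ev s (P i) g)"
  by (induction I rule: infinite_finite_induct) (simp_all add: ev_0 ev_add)

lemma ev_pCons:
  assumes s: "s \<in> carrier RG"
  shows "ev s (pCons a P) = (\<lambda>g. a * \<one>\<^bsub>RG\<^esub> g + (s \<otimes>\<^bsub>RG\<^esub> ev s P) g)"
proof
  fix g
  have "ev s (pCons a P) g = (\<Sum>i\<le>Suc (degree P). coeff (pCons a P) i * (s [^]\<^bsub>RG\<^esub> i) g)"
    by (simp add: ev_bound[of "pCons a P" "Suc (degree P)"] degree_pCons_le)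
  also have "\<dots> = a * \<one>\<^bsub>RG\<^esub> g + (\<Sum>i\<le>degree P. coeff P i * (s [^]\<^bsub>RG\<^esub> Suc i) g)"
    by (subst sum.atMost_Suc_shift) simp
  also have "(\<Sum>i\<le>degree P. coeff P i * (s [^]\<^bsub>RG\<^esub> Suc i) g) =
      (\<Sum>i\<le>degree P. (s \<otimes>\<^bsub>RG\<^esub> smult (coeff P i) (s [^]\<^bsub>RG\<^esub> i)) g)"
    unfolding mult_smult by (simp add: smult_def RG_mult_comm[of s])
  also have "\<dots> = (s \<otimes>\<^bsub>RG\<^esub> ev s P) g"
    unfolding ev_def mult_sum by (simp add: smult_def)
  finally show "ev s (pCons a P) g = a * \<one>\<^bsub>RG\<^esub> g + (s \<otimes>\<^bsub>RG\<^esub> ev s P) g" .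
qed

lemma ev_closed:
  assumes "s \<in> carrier RG" "\<And>i. coeff P i \<in> R"
  shows "ev s P \<in> carrier RG"
  unfolding ev_def using assms by (intro RG_lincomb) simp_all

lemma ev_1: "s \<in> carrier RG \<Longrightarrow> ev s 1 = \<one>\<^bsub>RG\<^esub>"
  by (simp add: ev_def)

lemma ev_mult:
  assumes s: "s \<in> carrier RG" and P: "\<And>i. coeff P i \<in> R" and Q: "\<And>i. coeff Q i \<in> R"
  shows "ev s (P * Q) = ev s P \<otimes>\<^bsub>RG\<^esub> ev s Q"
  using P
proof (induction P)
  case 0
  have "\<zero>\<^bsub>RG\<^esub> \<otimes>\<^bsub>RG\<^esub> ev s Q = \<zero>\<^bsub>RG\<^esub>" using ev_closed[OF s Q] by simp
  thus ?case by (simp add: ev_0 RG_zero)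
next
  case (pCons a P)
  have aR: "a \<in> R" using pCons.prems[of 0] by simp
  have PR: "coeff P i \<in> R" for i using pCons.prems[of "Suc i"] by simp
  have eQ: "ev s Q \<in> carrier RG" by (rule ev_closed[OF s Q])
  have eP: "ev s P \<in> carrier RG" by (rule ev_closed[OF s PR])
  have "ev s (pCons a P * Q) = (\<lambda>g. smult a (ev s Q) g + (s \<otimes>\<^bsub>RG\<^esub> ev s (P * Q)) g)"
    by (simp add: ev_add ev_smult ev_pCons[OF s])
  also have "ev s (P * Q) = ev s P \<otimes>\<^bsub>RG\<^esub> ev s Q" by (rule pCons.IH[OF PR])
  also have "(\<lambda>g. smult a (ev s Q) g + (s \<otimes>\<^bsub>RG\<^esub> (ev s P \<otimes>\<^bsub>RG\<^esub> ev s Q)) g) =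
      (smult a \<one>\<^bsub>RG\<^esub> \<otimes>\<^bsub>RG\<^esub> ev s Q) \<oplus>\<^bsub>RG\<^esub> ((s \<otimes>\<^bsub>RG\<^esub> ev s P) \<otimes>\<^bsub>RG\<^esub> ev s Q)"
    by (simp add: RG_add smult_mult RG.l_one[OF eQ] RG_mult_assoc)
  also have "\<dots> = (smult a \<one>\<^bsub>RG\<^esub> \<oplus>\<^bsub>RG\<^esub> s \<otimes>\<^bsub>RG\<^esub> ev s P) \<otimes>\<^bsub>RG\<^esub> ev s Q"
    using s eP eQ aR smult_closed by (intro RG.l_distr[symmetric]) auto
  also have "smult a \<one>\<^bsub>RG\<^esub> \<oplus>\<^bsub>RG\<^esub> s \<otimes>\<^bsub>RG\<^esub> ev s P = ev s (pCons a P)"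
    by (simp add: RG_add ev_pCons[OF s] smult_def)
  finally show ?case .
qed

lemma coeff_mult_R:
  "(\<And>i. coeff P i \<in> R) \<Longrightarrow> (\<And>i. coeff Q i \<in> R) \<Longrightarrow> coeff (P * Q) i \<in> R"
  by (simp add: coeff_mult R_sum R_mult)

lemma coeff_power_R: "(\<And>i. coeff P i \<in> R) \<Longrightarrow> coeff (P ^ n) i \<in> R"
proof (induction n arbitrary: i)
  case 0 thus ?case by (simp add: R_0 R_1 coeff_1)
next
  case (Suc n) thus ?case by (simp add: coeff_mult_R)
qed

lemma ev_power:
  assumes s: "s \<in> carrier RG" and P: "\<And>i. coeff P i \<in> R"
  shows "ev s (P ^ n) = ev s P [^]\<^bsub>RG\<^esub> (n::nat)"
proof (induction n)
  case 0
  show ?case by (simp add: ev_1[OF s])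
next
  case (Suc n)
  have "ev s (P ^ Suc n) = ev s (P ^ n * P)" by (simp add: mult.commute)
  also have "\<dots> = ev s (P ^ n) \<otimes>\<^bsub>RG\<^esub> ev s P" by (intro ev_mult[OF s] coeff_power_R P)
  finally show ?case by (simp add: Suc)
qed

lemma newton_RG:
  assumes x: "x \<in> carrier RG" and n: "n < N"
  shows "x [^]\<^bsub>RG\<^esub> n = (\<lambda>g. \<Sum>i<N. of_nat (n choose i) * ((x \<ominus>\<^bsub>RG\<^esub> \<one>\<^bsub>RG\<^esub>) [^]\<^bsub>RG\<^esub> i) g)"
proof -
  define s where "s = x \<ominus>\<^bsub>RG\<^esub> \<one>\<^bsub>RG\<^esub>"
  have s: "s \<in> carrier RG" using x by (simp add: s_def)
  have P: "coeff [:1, 1 :: 'a:] i \<in> R" for i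
    by (auto simp: coeff_pCons R_0 R_1 split: nat.splits)
  have "ev s [:1, 1:] = (\<lambda>g. 1 * \<one>\<^bsub>RG\<^esub> g + (s \<otimes>\<^bsub>RG\<^esub> ev s 1) g)"
    using ev_pCons[OF s, of 1 1] by (simp add: one_pCons)
  hence x': "ev s [:1, 1:] = x"
    using s by (simp add: ev_1 s_def RG_minus)
  have X: "[:1, 1 :: 'a:] = [:0, 1:] + 1" by (simp add: one_pCons)
  have "[:1, 1 :: 'a:] ^ n = (\<Sum>k\<le>n. of_nat (n choose k) * [:0, 1:] ^ k)"
    unfolding X by (simp add: binomial_ring)
  hence "coeff ([:1, 1 :: 'a:] ^ n) i = of_nat (n choose i)" for i
    by (simp add: coeff_sum of_nat_poly monom_altdef[of 1, simplified, symmetric] if_distrib cong: if_cong)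
  moreover have "degree ([:1, 1 :: 'a:] ^ n) < N"
    using n degree_power_le[of "[:1, 1 :: 'a:]" n] by simp
  ultimately have "ev s ([:1, 1:] ^ n) = (\<lambda>g. \<Sum>i<N. of_nat (n choose i) * (s [^]\<^bsub>RG\<^esub> i) g)"
    by (simp add: ev_bound_less)
  thus ?thesis using ev_power[OF s P, of n] x' by (simp add: s_def)
qed

end

section \<open>Truncated exponentiation modulo a power of the augmentation ideal\<close>

definition trunc_binomial :: "nat \<Rightarrow> 'a::field_char_0 \<Rightarrow> 'a poly" where
  "trunc_binomial p a = (\<Sum>i<p. monom (a gchoose i) i)"

lemma coeff_trunc_binomial: "coeff (trunc_binomial p a) i = (if i < p then a gchoose i else 0)"
  by (simp add: trunc_binomial_def coeff_sum)

lemma degree_trunc_binomial: "0 < p \<Longrightarrow> degree (trunc_binomial p a) < p"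
  by (rule degree_lessI) (auto simp: coeff_trunc_binomial)

lemma coeff_trunc_binomial_mult:
  assumes "m < p"
  shows "coeff (trunc_binomial p a * trunc_binomial p c) m = (a + c gchoose m)"
proof -
  have "coeff (trunc_binomial p a * trunc_binomial p c) m = (\<Sum>i\<le>m. (a gchoose i) * (c gchoose (m - i)))"
    unfolding coeff_mult using assms by (intro sum.cong refl) (auto simp: coeff_trunc_binomial)
  thus ?thesis by (simp add: gbinomial_Vandermonde[symmetric] atLeast0AtMost)
qed

text \<open>
  Both sides solve the differential equation \<open>(1 + X) F' = c a F\<close> with \<open>F(0) = 1\<close>.
\<close>

lemma fps_binomial_compose:
  fixes a c :: "'a::field_char_0"
  shows "fps_binomial c oo (fps_binomial a - 1) = fps_binomial (c * a)"
proof -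
  define g where "g = fps_binomial a - 1"
  define F where "F = fps_binomial c oo g"
  have g0: "g $ 0 = 0" by (simp add: g_def)
  have X0: "(1 + fps_X :: 'a fps) $ 0 \<noteq> 0" "(1 + fps_X :: 'a fps) \<noteq> 0" by (auto simp: fps_eq_iff)
  have ode: "(1 + fps_X) * fps_deriv (fps_binomial x) = fps_const x * fps_binomial x" for x :: 'a
  proof -
    have "(1 + fps_X) * (fps_const x * fps_binomial x * inverse (1 + fps_X)) =
        fps_const x * fps_binomial x * (inverse (1 + fps_X) * (1 + fps_X))"
      by (simp only: mult_ac)
    thus ?thesis
      unfolding fps_binomial_deriv fps_divide_unit[OF X0(1)] inverse_mult_eq_1[OF X0(1)] by simp
  qed
  have "((1 + fps_X) * fps_deriv (fps_binomial c)) oo g = (fps_const c * fps_binomial c) oo g"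
    by (simp only: ode)
  hence comp: "(1 + g) * (fps_deriv (fps_binomial c) oo g) = fps_const c * F"
    by (simp add: fps_compose_mult_distrib[OF g0] fps_compose_add_distrib F_def fps_X_fps_compose_startby0 g0)
  have "(1 + fps_X) * fps_deriv F = (fps_deriv (fps_binomial c) oo g) * ((1 + fps_X) * fps_deriv (fps_binomial a))"
    unfolding F_def fps_compose_deriv[OF g0] by (simp add: g_def mult_ac)
  also have "\<dots> = fps_const a * ((1 + g) * (fps_deriv (fps_binomial c) oo g))"
    unfolding ode by (simp add: g_def mult_ac)
  also have "\<dots> = fps_const (c * a) * F"
    unfolding comp by (simp only: mult.assoc[symmetric] fps_const_mult mult.commute[of a c])
  finally have "(1 + fps_X) * fps_deriv F = fps_const (c * a) * F" .
  hence "fps_deriv F = fps_const (c * a) * F / (1 + fps_X)"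
    using nonzero_mult_div_cancel_left[OF X0(2), of "fps_deriv F"] by simp
  moreover have "F $ 0 = 1" by (simp add: F_def)
  ultimately show ?thesis using fps_binomial_ODE_unique'[of F "c * a"] by (simp add: F_def g_def)
qed

text \<open>
  Below degree \<open>p\<close> truncation is not visible, so the identity for formal power series applies.
\<close>

lemma coeff_trunc_binomial_compose:
  fixes a c :: "'a::field_char_0"
  assumes m: "m < p"
  shows "coeff (\<Sum>k<p. Polynomial.smult (c gchoose k) ((trunc_binomial p a - 1) ^ k)) m = (c * a gchoose m)"
proof -
  define g where "g = fps_binomial a - 1"
  have g0: "g $ 0 = 0" by (simp add: g_def)
  have pow: "coeff ((trunc_binomial p a - 1) ^ k) m = g ^ k $ m" if "m < p" for k m
    using that
  proof (induction k arbitrary: m)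
    case (Suc k)
    have base: "coeff (trunc_binomial p a - 1) i = g $ i" if "i < p" for i
      using that by (auto simp: coeff_trunc_binomial g_def coeff_1)
    have "coeff ((trunc_binomial p a - 1) ^ Suc k) m =
        (\<Sum>i\<le>m. coeff (trunc_binomial p a - 1) i * coeff ((trunc_binomial p a - 1) ^ k) (m - i))"
      by (simp add: coeff_mult)
    also have "\<dots> = (\<Sum>i\<le>m. g $ i * g ^ k $ (m - i))"
      using Suc.prems by (intro sum.cong refl arg_cong2[of _ _ _ _ "(*)"] base Suc.IH) auto
    also have "\<dots> = g ^ Suc k $ m" by (simp add: fps_mult_nth atLeast0AtMost)
    finally show ?case .
  qed (simp add: coeff_1)
  have "coeff (\<Sum>k<p. Polynomial.smult (c gchoose k) ((trunc_binomial p a - 1) ^ k)) m =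
      (\<Sum>k<p. (c gchoose k) * g ^ k $ m)"
    by (simp add: coeff_sum pow m)
  also have "\<dots> = (\<Sum>k=0..m. (c gchoose k) * g ^ k $ m)"
    using m startsby_zero_power_prefix[OF g0] by (intro sum.mono_neutral_right) auto
  also have "\<dots> = (fps_binomial c oo g) $ m" by (simp add: fps_compose_nth)
  also have "\<dots> = (c * a gchoose m)" by (simp add: g_def fps_binomial_compose)
  finally show ?thesis .
qed

locale trunc_algebra = group_algebra G R
  for G :: "('g, 'm) monoid_scheme" (structure) and R :: "'a::field_char_0 set" +
  fixes p :: nat
  assumes prime_p: "prime p"
    and binom_R: "\<And>a k. a \<in> R \<Longrightarrow> k < p \<Longrightarrow> (a gchoose k) \<in> R"
    and defect_R: "\<And>a i j. a \<in> R \<Longrightarrow> i < p \<Longrightarrow> j < p \<Longrightarrow> trunc_defect_coeff p a i j \<in> R"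
    and inverse_R: "\<And>i. 0 < i \<Longrightarrow> i < p \<Longrightarrow> 1 / of_nat i \<in> R"
    and exponent_p: "\<And>g. g \<in> carrier G \<Longrightarrow> g [^] p = \<one>"
    and aug_inverse: "\<And>a. a \<in> aug_ideal R G \<Longrightarrow> \<exists>y\<in>carrier (group_ring R G).
        (\<one>\<^bsub>group_ring R G\<^esub> \<oplus>\<^bsub>group_ring R G\<^esub> a) \<otimes>\<^bsub>group_ring R G\<^esub> y = \<one>\<^bsub>group_ring R G\<^esub>"
begin

lemma p_gt_1: "1 < p"
  using prime_p prime_gt_1_nat by blast

abbreviation A where "A \<equiv> aug_ideal R G"

definition Apow :: "nat \<Rightarrow> ('g \<Rightarrow> 'a) set" where
  "Apow n = A [^]\<^bsub>ideals_set RG\<^esub> n"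

lemma A_ideal: "ideal A RG"
  unfolding aug_ideal_def by (rule RG.genideal_ideal[OF aug_gens])

lemma A_gen: "g \<in> carrier G \<Longrightarrow> group_ring_of g \<ominus>\<^bsub>RG\<^esub> \<one>\<^bsub>RG\<^esub> \<in> A"
  using RG.genideal_self[OF aug_gens] unfolding aug_ideal_def by blast

lemma A_carrier: "x \<in> A \<Longrightarrow> x \<in> carrier RG"
  by (rule ideal.Icarr[OF A_ideal])

lemma Apow_0: "Apow 0 = carrier RG"
  by (simp add: Apow_def ideals_set_def)

lemma Apow_Suc: "Apow (Suc n) = Apow n \<cdot>\<^bsub>RG\<^esub> A"
  by (simp add: Apow_def ideals_set_def)

lemma Apow_ideal: "ideal (Apow n) RG"
proof (induction n)
  case 0 show ?case unfolding Apow_0 by (rule RG.oneideal)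
next
  case (Suc n) show ?case unfolding Apow_Suc by (rule RG.ideal_prod_is_ideal[OF Suc A_ideal])
qed

lemma Apow_carrier: "x \<in> Apow n \<Longrightarrow> x \<in> carrier RG"
  by (rule ideal.Icarr[OF Apow_ideal])

lemma Apow_mult: "x \<in> Apow n \<Longrightarrow> y \<in> A \<Longrightarrow> x \<otimes>\<^bsub>RG\<^esub> y \<in> Apow (Suc n)"
  unfolding Apow_Suc by (rule ideal_prod.prod)

lemma Apow_antimono: "n \<le> m \<Longrightarrow> Apow m \<subseteq> Apow n"
proof (induction rule: dec_induct)
  case (step m)
  have "Apow (Suc m) \<subseteq> Apow m"
    unfolding Apow_Suc using RG.ideal_prod_inter[OF Apow_ideal A_ideal] by blast
  thus ?case using step by blast
qed simp

lemma Apow_power: "s \<in> A \<Longrightarrow> s [^]\<^bsub>RG\<^esub> n \<in> Apow n"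
  by (induction n) (simp_all add: Apow_0 Apow_mult A_carrier)

lemma Apow_power_mult:
  assumes s: "s \<in> A" and t: "t \<in> A"
  shows "s [^]\<^bsub>RG\<^esub> i \<otimes>\<^bsub>RG\<^esub> t [^]\<^bsub>RG\<^esub> j \<in> Apow (i + j)"
proof (induction j)
  case 0 show ?case using Apow_power[OF s, of i] A_carrier[OF s] by simp
next
  case (Suc j)
  have "(s [^]\<^bsub>RG\<^esub> i \<otimes>\<^bsub>RG\<^esub> t [^]\<^bsub>RG\<^esub> j) \<otimes>\<^bsub>RG\<^esub> t \<in> Apow (Suc (i + j))" by (rule Apow_mult[OF Suc t])
  thus ?case using A_carrier[OF s] A_carrier[OF t] by (simp add: RG_mult_assoc)
qed

abbreviation I where "I \<equiv> Apow p"

lemma I_subset_A: "I \<subseteq> A"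
proof -
  have "Apow (Suc (p - 1)) \<subseteq> A"
    unfolding Apow_Suc using RG.ideal_prod_inter[OF Apow_ideal A_ideal] by blast
  thus ?thesis using p_gt_1 by simp
qed

lemma one_plus_ideal:
  assumes J: "ideal J RG"
  shows "x \<in> \<one>\<^bsub>RG\<^esub> <+\<^bsub>RG\<^esub> J \<longleftrightarrow> x \<in> carrier RG \<and> x \<ominus>\<^bsub>RG\<^esub> \<one>\<^bsub>RG\<^esub> \<in> J"
proof
  assume "x \<in> \<one>\<^bsub>RG\<^esub> <+\<^bsub>RG\<^esub> J"
  then obtain j where j: "j \<in> J" "x = \<one>\<^bsub>RG\<^esub> \<oplus>\<^bsub>RG\<^esub> j" by (auto simp: a_l_coset_def')
  have jc: "j \<in> carrier RG" by (rule ideal.Icarr[OF J j(1)])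
  have "x \<ominus>\<^bsub>RG\<^esub> \<one>\<^bsub>RG\<^esub> = j" using jc by (simp add: j(2) RG_minus) (simp add: RG_add)
  thus "x \<in> carrier RG \<and> x \<ominus>\<^bsub>RG\<^esub> \<one>\<^bsub>RG\<^esub> \<in> J" using j jc by simp
next
  assume x: "x \<in> carrier RG \<and> x \<ominus>\<^bsub>RG\<^esub> \<one>\<^bsub>RG\<^esub> \<in> J"
  have "x = \<one>\<^bsub>RG\<^esub> \<oplus>\<^bsub>RG\<^esub> (x \<ominus>\<^bsub>RG\<^esub> \<one>\<^bsub>RG\<^esub>)" by (simp add: RG_minus RG_add)
  thus "x \<in> \<one>\<^bsub>RG\<^esub> <+\<^bsub>RG\<^esub> J" using x unfolding a_l_coset_def' by blast
qed

abbreviation M where "M \<equiv> one_plus_aug R G"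

lemma carrier_M: "x \<in> carrier M \<longleftrightarrow> x \<in> carrier RG \<and> x \<ominus>\<^bsub>RG\<^esub> \<one>\<^bsub>RG\<^esub> \<in> A"
  using one_plus_ideal[OF A_ideal] by (simp add: one_plus_aug_def)

lemma M_RG: "x \<in> carrier M \<Longrightarrow> x \<in> carrier RG"
  by (simp add: carrier_M)

lemma M_mult: "x \<otimes>\<^bsub>M\<^esub> y = x \<otimes>\<^bsub>RG\<^esub> y" and M_one: "\<one>\<^bsub>M\<^esub> = \<one>\<^bsub>RG\<^esub>"
  by (simp_all add: one_plus_aug_def)

lemma mult_minus_one:
  assumes "x \<in> carrier RG" "y \<in> carrier RG"
  shows "x \<otimes>\<^bsub>RG\<^esub> y \<ominus>\<^bsub>RG\<^esub> \<one>\<^bsub>RG\<^esub> =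
    (x \<ominus>\<^bsub>RG\<^esub> \<one>\<^bsub>RG\<^esub>) \<otimes>\<^bsub>RG\<^esub> y \<oplus>\<^bsub>RG\<^esub> (y \<ominus>\<^bsub>RG\<^esub> \<one>\<^bsub>RG\<^esub>)"
proof -
  have "(x \<ominus>\<^bsub>RG\<^esub> \<one>\<^bsub>RG\<^esub>) \<otimes>\<^bsub>RG\<^esub> y = x \<otimes>\<^bsub>RG\<^esub> y \<ominus>\<^bsub>RG\<^esub> y"
    using assms by (simp add: a_minus_def RG.l_distr RG.l_minus)
  thus ?thesis using assms by (simp add: RG_minus RG_mult_closed) (simp add: RG_add)
qed

lemma one_plus_closed:
  assumes J: "ideal J RG" and "x \<in> carrier RG" "y \<in> carrier RG"
    "x \<ominus>\<^bsub>RG\<^esub> \<one>\<^bsub>RG\<^esub> \<in> J" "y \<ominus>\<^bsub>RG\<^esub> \<one>\<^bsub>RG\<^esub> \<in> J"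
  shows "x \<otimes>\<^bsub>RG\<^esub> y \<ominus>\<^bsub>RG\<^esub> \<one>\<^bsub>RG\<^esub> \<in> J"
  unfolding mult_minus_one[OF assms(2,3)]
  by (rule additive_subgroup.a_closed[OF ideal.axioms(1)[OF J] ideal.I_r_closed[OF J assms(4,3)] assms(5)])

lemma one_plus_inverse:
  assumes J: "ideal J RG" and x: "x \<in> carrier RG" "x \<ominus>\<^bsub>RG\<^esub> \<one>\<^bsub>RG\<^esub> \<in> J"
    and y: "y \<in> carrier RG" "x \<otimes>\<^bsub>RG\<^esub> y = \<one>\<^bsub>RG\<^esub>"
  shows "y \<ominus>\<^bsub>RG\<^esub> \<one>\<^bsub>RG\<^esub> \<in> J"
proof -
  let ?u = "(x \<ominus>\<^bsub>RG\<^esub> \<one>\<^bsub>RG\<^esub>) \<otimes>\<^bsub>RG\<^esub> y" and ?w = "y \<ominus>\<^bsub>RG\<^esub> \<one>\<^bsub>RG\<^esub>"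
  have uw: "?u \<in> carrier RG" "?w \<in> carrier RG" using x y by (simp_all add: RG_mult_closed)
  have "?u \<oplus>\<^bsub>RG\<^esub> ?w = \<zero>\<^bsub>RG\<^esub>"
    unfolding mult_minus_one[OF x(1) y(1), symmetric] y(2) by (simp add: RG.r_neg a_minus_def)
  hence "?w \<oplus>\<^bsub>RG\<^esub> ?u = \<zero>\<^bsub>RG\<^esub>" using RG.a_comm[OF uw] by simp
  hence "\<ominus>\<^bsub>RG\<^esub> ?u = ?w" using uw by (rule RG.minus_equality)
  moreover have "\<ominus>\<^bsub>RG\<^esub> ?u \<in> J"
    by (rule additive_subgroup.a_inv_closed[OF ideal.axioms(1)[OF J] ideal.I_r_closed[OF J x(2) y(1)]])
  ultimately show ?thesis by simp
qed

lemma M_inverse: assumes "x \<in> carrier M" shows "\<exists>y\<in>carrier M. y \<otimes>\<^bsub>RG\<^esub> x = \<one>\<^bsub>RG\<^esub>"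
proof -
  have x: "x \<in> carrier RG" "x \<ominus>\<^bsub>RG\<^esub> \<one>\<^bsub>RG\<^esub> \<in> A" using assms by (simp_all add: carrier_M)
  have "x = \<one>\<^bsub>RG\<^esub> \<oplus>\<^bsub>RG\<^esub> (x \<ominus>\<^bsub>RG\<^esub> \<one>\<^bsub>RG\<^esub>)" by (simp add: RG_minus RG_add)
  then obtain y where y: "y \<in> carrier RG" "x \<otimes>\<^bsub>RG\<^esub> y = \<one>\<^bsub>RG\<^esub>" using aug_inverse[OF x(2)] by auto
  have "y \<in> carrier M" using one_plus_inverse[OF A_ideal x y] y(1) by (simp add: carrier_M)
  thus ?thesis using y(2) RG_mult_comm[of x y] by auto
qed

lemma M_comm_group: "comm_group M"
proof (rule comm_groupI)
  show "x \<otimes>\<^bsub>M\<^esub> y \<in> carrier M" if "x \<in> carrier M" "y \<in> carrier M" for x y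
    using that one_plus_closed[OF A_ideal, of x y] by (simp add: carrier_M M_mult RG_mult_closed)
  show "\<one>\<^bsub>M\<^esub> \<in> carrier M"
    using additive_subgroup.zero_closed[OF ideal.axioms(1)[OF A_ideal]]
    by (simp add: carrier_M M_one a_minus_def RG.r_neg)
  show "\<exists>y\<in>carrier M. y \<otimes>\<^bsub>M\<^esub> x = \<one>\<^bsub>M\<^esub>" if "x \<in> carrier M" for x
    using M_inverse[OF that] by (simp add: M_mult M_one)
qed (auto simp: M_mult M_one RG_mult_assoc carrier_M intro: RG_mult_comm)

sublocale M: comm_group M by (rule M_comm_group)

abbreviation N where "N \<equiv> one_plus_aug_pow p R G"

lemma N_iff: "x \<in> N \<longleftrightarrow> x \<in> carrier RG \<and> x \<ominus>\<^bsub>RG\<^esub> \<one>\<^bsub>RG\<^esub> \<in> I"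
  using one_plus_ideal[OF Apow_ideal] by (simp add: one_plus_aug_pow_def Apow_def)

lemma M_inv: "x \<in> carrier M \<Longrightarrow> inv\<^bsub>M\<^esub> x \<in> carrier RG \<and> x \<otimes>\<^bsub>RG\<^esub> inv\<^bsub>M\<^esub> x = \<one>\<^bsub>RG\<^esub>"
  using M.r_inv[of x] M.inv_closed[of x] by (simp add: M_mult M_one M_RG)

lemma N_subgroup: "subgroup N M"
proof (rule M.subgroupI)
  show "N \<subseteq> carrier M" using I_subset_A by (auto simp: N_iff carrier_M)
  have "\<one>\<^bsub>RG\<^esub> \<in> N"
    using additive_subgroup.zero_closed[OF ideal.axioms(1)[OF Apow_ideal]]
    by (simp add: N_iff a_minus_def RG.r_neg)
  thus "N \<noteq> {}" by blast
  show "inv\<^bsub>M\<^esub> x \<in> N" if x: "x \<in> N" for x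
  proof -
    have "x \<in> carrier M" using x I_subset_A by (auto simp: N_iff carrier_M)
    thus ?thesis using M_inv[of x] one_plus_inverse[OF Apow_ideal] x unfolding N_iff by blast
  qed
  show "x \<otimes>\<^bsub>M\<^esub> y \<in> N" if "x \<in> N" "y \<in> N" for x y
    using that one_plus_closed[OF Apow_ideal, of x y] by (simp add: N_iff M_mult RG_mult_closed)
qed

lemma N_normal: "N \<lhd> M"
  using M.subgroup_imp_normal[OF N_subgroup] .

abbreviation TG where "TG \<equiv> trunc_group p R G"
abbreviation cl where "cl \<equiv> trunc_class p R G"

sublocale N: normal N M by (rule N_normal)

sublocale TG: group TG
  unfolding trunc_group_def by (rule N.factorgroup_is_group)

lemma carrier_TG: "carrier TG = cl ` carrier M"
  by (auto simp: trunc_group_def FactGroup_def RCOSETS_def trunc_class_def)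

lemma cl_in: "x \<in> carrier M \<Longrightarrow> cl x \<in> carrier TG"
  by (simp add: carrier_TG)

lemma cl_mult: "x \<in> carrier M \<Longrightarrow> y \<in> carrier M \<Longrightarrow> cl x \<otimes>\<^bsub>TG\<^esub> cl y = cl (x \<otimes>\<^bsub>RG\<^esub> y)"
  using N.rcos_sum[of x y] by (simp add: trunc_group_def trunc_class_def M_mult)

lemma cl_one: "cl \<one>\<^bsub>RG\<^esub> = \<one>\<^bsub>TG\<^esub>"
  using M.coset_mult_one[OF N.subset] by (simp add: trunc_group_def trunc_class_def M_one)

text \<open>
  For elements of \<open>1 + A\<close> this is equality of their classes (\<open>cl_eq_iff\<close>).
\<close>

definition eqI :: "('g \<Rightarrow> 'a) \<Rightarrow> ('g \<Rightarrow> 'a) \<Rightarrow> bool" where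
  "eqI x y \<longleftrightarrow> (\<lambda>g. x g - y g) \<in> I"

lemma cl_eq_iff:
  assumes x: "x \<in> carrier M" and y: "y \<in> carrier M"
  shows "cl x = cl y \<longleftrightarrow> eqI x y"
proof -
  have xR: "x \<in> carrier RG" and yR: "y \<in> carrier RG" using x y M_RG by auto
  have iy: "inv\<^bsub>M\<^esub> y \<in> carrier RG" "y \<otimes>\<^bsub>RG\<^esub> inv\<^bsub>M\<^esub> y = \<one>\<^bsub>RG\<^esub>" using M_inv[OF y] by auto
  have "cl x = cl y \<longleftrightarrow> x \<in> N #>\<^bsub>M\<^esub> y"
    unfolding trunc_class_def using x y N_subgroup
    by (metis M.repr_independence M.repr_independenceD)
  also have "\<dots> \<longleftrightarrow> x \<otimes>\<^bsub>M\<^esub> inv\<^bsub>M\<^esub> y \<in> N"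
    by (rule N.rcos_module[OF M.is_group y x])
  also have "\<dots> \<longleftrightarrow> x \<otimes>\<^bsub>RG\<^esub> inv\<^bsub>M\<^esub> y \<ominus>\<^bsub>RG\<^esub> \<one>\<^bsub>RG\<^esub> \<in> I"
    using xR iy by (simp add: N_iff M_mult RG_mult_closed)
  also have "x \<otimes>\<^bsub>RG\<^esub> inv\<^bsub>M\<^esub> y \<ominus>\<^bsub>RG\<^esub> \<one>\<^bsub>RG\<^esub> = (x \<ominus>\<^bsub>RG\<^esub> y) \<otimes>\<^bsub>RG\<^esub> inv\<^bsub>M\<^esub> y"
    using xR yR iy by (simp add: a_minus_def RG.l_distr RG.l_minus)
  also have "\<dots> \<in> I \<longleftrightarrow> x \<ominus>\<^bsub>RG\<^esub> y \<in> I"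
  proof
    assume "(x \<ominus>\<^bsub>RG\<^esub> y) \<otimes>\<^bsub>RG\<^esub> inv\<^bsub>M\<^esub> y \<in> I"
    from ideal.I_r_closed[OF Apow_ideal this yR]
    have "(x \<ominus>\<^bsub>RG\<^esub> y) \<otimes>\<^bsub>RG\<^esub> (inv\<^bsub>M\<^esub> y \<otimes>\<^bsub>RG\<^esub> y) \<in> I" by (simp only: RG_mult_assoc)
    thus "x \<ominus>\<^bsub>RG\<^esub> y \<in> I" using xR yR iy(2) by (simp add: RG_mult_comm[of _ y])
  qed (rule ideal.I_r_closed[OF Apow_ideal _ iy(1)])
  finally show ?thesis by (simp add: eqI_def RG_minus[OF yR])
qed

end

context trunc_algebra
begin

lemma eqI_refl: "eqI x x"
  using ideal_zero[OF Apow_ideal] by (simp add: eqI_def)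

lemma eqI_sym: "eqI x y \<Longrightarrow> eqI y x"
proof -
  assume "eqI x y"
  hence z: "(\<lambda>g. x g - y g) \<in> I" by (simp add: eqI_def)
  from ideal_smult[OF Apow_ideal R_uminus[OF R_1] this] show "eqI y x"
    by (simp add: eqI_def smult_def)
qed

lemma eqI_trans: "eqI x y \<Longrightarrow> eqI y z \<Longrightarrow> eqI x z"
  using ideal_add[OF Apow_ideal, of "\<lambda>g. x g - y g" p "\<lambda>g. y g - z g"] by (simp add: eqI_def)

lemma mult_diff_left: "x \<otimes>\<^bsub>RG\<^esub> z = (\<lambda>g. ((\<lambda>g. x g - y g) \<otimes>\<^bsub>RG\<^esub> z) g + (y \<otimes>\<^bsub>RG\<^esub> z) g)"
  by (auto simp: RG_mult fun_eq_iff left_diff_distrib sum_subtractf)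

lemma eqI_mult_right:
  assumes "eqI x y" "z \<in> carrier RG"
  shows "eqI (x \<otimes>\<^bsub>RG\<^esub> z) (y \<otimes>\<^bsub>RG\<^esub> z)"
proof -
  have "(\<lambda>g. x g - y g) \<otimes>\<^bsub>RG\<^esub> z \<in> I"
    using assms by (intro ideal.I_r_closed[OF Apow_ideal]) (simp_all add: eqI_def)
  moreover have "(\<lambda>g. (x \<otimes>\<^bsub>RG\<^esub> z) g - (y \<otimes>\<^bsub>RG\<^esub> z) g) = (\<lambda>g. x g - y g) \<otimes>\<^bsub>RG\<^esub> z"
    by (rule ext) (subst mult_diff_left[of x z y], simp)
  ultimately show ?thesis by (simp add: eqI_def)
qed

lemma eqI_mult:
  assumes "eqI x y" "eqI z w" "y \<in> carrier RG" "z \<in> carrier RG"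
  shows "eqI (x \<otimes>\<^bsub>RG\<^esub> z) (y \<otimes>\<^bsub>RG\<^esub> w)"
proof (rule eqI_trans)
  show "eqI (x \<otimes>\<^bsub>RG\<^esub> z) (y \<otimes>\<^bsub>RG\<^esub> z)" by (rule eqI_mult_right[OF assms(1,4)])
  show "eqI (y \<otimes>\<^bsub>RG\<^esub> z) (y \<otimes>\<^bsub>RG\<^esub> w)"
    using eqI_mult_right[OF assms(2,3)] by (simp add: RG_mult_comm[of y])
qed

lemma ev_in_Apow:
  assumes s: "s \<in> A" and P: "\<And>i. coeff P i \<in> R" "\<And>i. i < n \<Longrightarrow> coeff P i = 0"
  shows "ev s P \<in> Apow n"
proof -
  have "ev s P = (\<lambda>g. \<Sum>i\<in>{n..degree P}. coeff P i * (s [^]\<^bsub>RG\<^esub> i) g)"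
    unfolding ev_def by (rule ext, rule sum.mono_neutral_right) (auto simp: P(2))
  also have "\<dots> \<in> Apow n"
    using Apow_power[OF s] Apow_antimono P(1) by (intro ideal_lincomb[OF Apow_ideal]) fastforce+
  finally show ?thesis .
qed

lemma Apow_1_subset: "Apow 1 \<subseteq> A"
  using RG.ideal_prod_inter[OF Apow_ideal[of 0] A_ideal] Apow_Suc[of 0] by auto

abbreviation te where "te \<equiv> trunc_exp p R G"

lemma coeff_tb_R: "a \<in> R \<Longrightarrow> coeff (trunc_binomial p a) i \<in> R"
  by (simp add: coeff_trunc_binomial binom_R R_0)

lemma coeff_tb_minus_1_R: "a \<in> R \<Longrightarrow> coeff (trunc_binomial p a - 1) i \<in> R"
  by (simp add: coeff_tb_R R_diff R_0 R_1 coeff_1)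

lemma te_ev: "te x a = ev (x \<ominus>\<^bsub>RG\<^esub> \<one>\<^bsub>RG\<^esub>) (trunc_binomial p a)"
proof -
  have d: "degree (trunc_binomial p a) < p" using p_gt_1 by (intro degree_trunc_binomial) simp
  show ?thesis
    unfolding ev_bound_less[OF d] trunc_exp_def by (simp add: coeff_trunc_binomial)
qed

lemma te_closed: "x \<in> carrier RG \<Longrightarrow> a \<in> R \<Longrightarrow> te x a \<in> carrier RG"
  unfolding te_ev by (intro ev_closed coeff_tb_R) auto

lemma te_minus_one:
  assumes "x \<in> carrier RG"
  shows "te x a \<ominus>\<^bsub>RG\<^esub> \<one>\<^bsub>RG\<^esub> = ev (x \<ominus>\<^bsub>RG\<^esub> \<one>\<^bsub>RG\<^esub>) (trunc_binomial p a - 1)"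
proof -
  have s: "x \<ominus>\<^bsub>RG\<^esub> \<one>\<^bsub>RG\<^esub> \<in> carrier RG" using assms by simp
  show ?thesis unfolding te_ev ev_diff ev_1[OF s] by (rule RG_minus[OF RG.one_closed])
qed

lemma te_M: assumes x: "x \<in> carrier M" and a: "a \<in> R" shows "te x a \<in> carrier M"
proof -
  have xR: "x \<in> carrier RG" "x \<ominus>\<^bsub>RG\<^esub> \<one>\<^bsub>RG\<^esub> \<in> A" using x by (simp_all add: carrier_M)
  have "te x a \<ominus>\<^bsub>RG\<^esub> \<one>\<^bsub>RG\<^esub> \<in> Apow 1"
    unfolding te_minus_one[OF xR(1)]
    by (rule ev_in_Apow[OF xR(2) coeff_tb_minus_1_R[OF a]]) (use p_gt_1 in \<open>simp add: coeff_trunc_binomial\<close>)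
  thus ?thesis using te_closed[OF xR(1) a] Apow_1_subset by (auto simp: carrier_M)
qed

text \<open>
  As polynomials in \<open>x - 1\<close>, the two sides agree in degrees below \<open>p\<close> by Vandermonde's identity.
\<close>

lemma te_add:
  assumes x: "x \<in> carrier M" and a: "a \<in> R" "c \<in> R"
  shows "eqI (te x a \<otimes>\<^bsub>RG\<^esub> te x c) (te x (a + c))"
proof -
  have xR: "x \<in> carrier RG" "x \<ominus>\<^bsub>RG\<^esub> \<one>\<^bsub>RG\<^esub> \<in> A" using x by (simp_all add: carrier_M)
  let ?s = "x \<ominus>\<^bsub>RG\<^esub> \<one>\<^bsub>RG\<^esub>"
  have s: "?s \<in> carrier RG" by (rule A_carrier[OF xR(2)])
  have "te x a \<otimes>\<^bsub>RG\<^esub> te x c = ev ?s (trunc_binomial p a * trunc_binomial p c)"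
    unfolding te_ev by (intro ev_mult[OF s, symmetric] coeff_tb_R a)
  hence "(\<lambda>g. (te x a \<otimes>\<^bsub>RG\<^esub> te x c) g - te x (a + c) g) =
      ev ?s (trunc_binomial p a * trunc_binomial p c - trunc_binomial p (a + c))"
    by (simp add: te_ev ev_diff)
  also have "\<dots> \<in> I"
  proof (rule ev_in_Apow[OF xR(2)])
    show "coeff (trunc_binomial p a * trunc_binomial p c - trunc_binomial p (a + c)) i \<in> R" for i
      using a by (simp add: R_diff coeff_mult_R coeff_tb_R R_add)
    show "coeff (trunc_binomial p a * trunc_binomial p c - trunc_binomial p (a + c)) i = 0" if "i < p" for i
      using that by (simp add: coeff_trunc_binomial_mult) (simp add: coeff_trunc_binomial)
  qed
  finally show ?thesis by (simp add: eqI_def)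
qed

lemma te_te:
  assumes x: "x \<in> carrier M" and a: "a \<in> R" and c: "c \<in> R"
  shows "eqI (te (te x a) c) (te x (c * a))"
proof -
  have xR: "x \<in> carrier RG" "x \<ominus>\<^bsub>RG\<^esub> \<one>\<^bsub>RG\<^esub> \<in> A" using x by (simp_all add: carrier_M)
  let ?s = "x \<ominus>\<^bsub>RG\<^esub> \<one>\<^bsub>RG\<^esub>" and ?Q = "trunc_binomial p a - 1"
  let ?P = "\<Sum>k<p. Polynomial.smult (c gchoose k) (?Q ^ k)"
  have s: "?s \<in> carrier RG" by (rule A_carrier[OF xR(2)])
  have QR: "coeff ?Q i \<in> R" for i by (rule coeff_tb_minus_1_R[OF a])
  have "te (te x a) c = (\<lambda>g. \<Sum>k<p. (c gchoose k) * ((te x a \<ominus>\<^bsub>RG\<^esub> \<one>\<^bsub>RG\<^esub>) [^]\<^bsub>RG\<^esub> k) g)"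
    by (simp add: trunc_exp_def)
  also have "\<dots> = ev ?s ?P"
    by (simp add: te_minus_one[OF xR(1)] ev_power[OF s QR, symmetric] ev_sum ev_smult smult_def)
  finally have "(\<lambda>g. te (te x a) c g - te x (c * a) g) = ev ?s (?P - trunc_binomial p (c * a))"
    by (simp add: te_ev[of x] ev_diff)
  also have "\<dots> \<in> I"
  proof (rule ev_in_Apow[OF xR(2)])
    show "coeff (?P - trunc_binomial p (c * a)) i \<in> R" for i
      using a c coeff_power_R[OF QR]
      by (auto simp: coeff_sum intro!: R_diff R_sum R_mult binom_R coeff_tb_R)
    show "coeff (?P - trunc_binomial p (c * a)) i = 0" if "i < p" for i
      unfolding coeff_diff coeff_trunc_binomial_compose[OF that] using that
      by (simp add: coeff_trunc_binomial)
  qed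
  finally show ?thesis by (simp add: eqI_def)
qed

text \<open>
  Apply \<open>trunc_defect\<close> to \<open>x ^ n y ^ n = (x y) ^ n\<close>: only terms with \<open>i + j \<ge> p\<close> remain, and those lie in
  the \<open>p\<close>-th power of the augmentation ideal.
\<close>

lemma te_mult:
  assumes x: "x \<in> carrier M" and y: "y \<in> carrier M" and a: "a \<in> R"
  shows "eqI (te x a \<otimes>\<^bsub>RG\<^esub> te y a) (te (x \<otimes>\<^bsub>RG\<^esub> y) a)"
proof -
  have xR: "x \<in> carrier RG" "x \<ominus>\<^bsub>RG\<^esub> \<one>\<^bsub>RG\<^esub> \<in> A" using x by (simp_all add: carrier_M)
  have yR: "y \<in> carrier RG" "y \<ominus>\<^bsub>RG\<^esub> \<one>\<^bsub>RG\<^esub> \<in> A" using y by (simp_all add: carrier_M)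
  have xy: "x \<otimes>\<^bsub>RG\<^esub> y \<in> carrier RG" using xR(1) yR(1) by (rule RG_mult_closed)
  let ?s = "x \<ominus>\<^bsub>RG\<^esub> \<one>\<^bsub>RG\<^esub>" and ?t = "y \<ominus>\<^bsub>RG\<^esub> \<one>\<^bsub>RG\<^esub>"
  let ?r = "x \<otimes>\<^bsub>RG\<^esub> y \<ominus>\<^bsub>RG\<^esub> \<one>\<^bsub>RG\<^esub>"
  define m where "m = (\<lambda>(i::nat) (j::nat). ?s [^]\<^bsub>RG\<^esub> i \<otimes>\<^bsub>RG\<^esub> ?t [^]\<^bsub>RG\<^esub> j)"
  have double: "(\<lambda>h. \<Sum>i<p. u i * (?s [^]\<^bsub>RG\<^esub> i) h) \<otimes>\<^bsub>RG\<^esub> (\<lambda>h. \<Sum>j<p. w j * (?t [^]\<^bsub>RG\<^esub> j) h) =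
      (\<lambda>h. \<Sum>i<p. \<Sum>j<p. u i * w j * m i j h)" for u w :: "nat \<Rightarrow> 'a"
  proof -
    have "(\<lambda>h. \<Sum>i<p. smult (u i) (?s [^]\<^bsub>RG\<^esub> i) h) \<otimes>\<^bsub>RG\<^esub> (\<lambda>h. \<Sum>j<p. smult (w j) (?t [^]\<^bsub>RG\<^esub> j) h) =
        (\<lambda>h. \<Sum>i<p. \<Sum>j<p. smult (w j) (smult (u i) (m i j)) h)"
      unfolding sum_mult mult_sum smult_mult mult_smult m_def ..
    thus ?thesis by (simp add: smult_def mult_ac)
  qed
  have diff: "(te x a \<otimes>\<^bsub>RG\<^esub> te y a) h - te (x \<otimes>\<^bsub>RG\<^esub> y) a h =
      (\<Sum>i<p. \<Sum>j<p. trunc_defect_coeff p a i j * m i j h)" for h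
  proof -
    have "(\<Sum>i<p. \<Sum>j<p. (a gchoose i) * (a gchoose j) * m i j h) -
        (\<Sum>k<p. (a gchoose k) * (?r [^]\<^bsub>RG\<^esub> k) h) =
        (\<Sum>i<p. \<Sum>j<p. trunc_defect_coeff p a i j * m i j h)"
    proof (rule trunc_defect)
      fix n assume n: "n < p"
      have "x [^]\<^bsub>RG\<^esub> n \<otimes>\<^bsub>RG\<^esub> y [^]\<^bsub>RG\<^esub> n = (x \<otimes>\<^bsub>RG\<^esub> y) [^]\<^bsub>RG\<^esub> n"
        using RG.nat_pow_distrib[OF xR(1) yR(1)] by simp
      thus "(\<Sum>i<p. \<Sum>j<p. of_nat (n choose i) * of_nat (n choose j) * m i j h) =
          (\<Sum>k<p. of_nat (n choose k) * (?r [^]\<^bsub>RG\<^esub> k) h)"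
        unfolding newton_RG[OF xR(1) n] newton_RG[OF yR(1) n] newton_RG[OF xy n] double
        by (rule fun_cong)
    qed
    thus ?thesis unfolding trunc_exp_def double .
  qed
  have "(\<lambda>h. \<Sum>z\<in>{..<p}\<times>{..<p}. trunc_defect_coeff p a (fst z) (snd z) * m (fst z) (snd z) h) \<in> I"
  proof -
    let ?Z = "{z \<in> {..<p}\<times>{..<p}. p \<le> fst z + snd z}"
    have "(\<lambda>h. \<Sum>z\<in>{..<p}\<times>{..<p}. trunc_defect_coeff p a (fst z) (snd z) * m (fst z) (snd z) h) =
        (\<lambda>h. \<Sum>z\<in>?Z. trunc_defect_coeff p a (fst z) (snd z) * m (fst z) (snd z) h)"
      by (rule ext, rule sum.mono_neutral_right) (auto simp: trunc_defect_coeff_eq_0 not_le)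
    also have "\<dots> \<in> I"
    proof (rule ideal_lincomb[OF Apow_ideal])
      fix z assume z: "z \<in> ?Z"
      thus "trunc_defect_coeff p a (fst z) (snd z) \<in> R" by (intro defect_R a) auto
      show "m (fst z) (snd z) \<in> I"
        unfolding m_def using Apow_power_mult[OF xR(2) yR(2)] Apow_antimono z by blast
    qed
    finally show ?thesis .
  qed
  hence "(\<lambda>h. \<Sum>i<p. \<Sum>j<p. trunc_defect_coeff p a i j * m i j h) \<in> I"
    by (simp add: sum.cartesian_product case_prod_unfold)
  thus ?thesis by (simp add: eqI_def diff)
qed

lemma te_cong:
  assumes x: "x \<in> carrier M" and y: "y \<in> carrier M" and a: "a \<in> R" and xy: "eqI x y"
  shows "eqI (te x a) (te y a)"
proof -
  let ?s = "x \<ominus>\<^bsub>RG\<^esub> \<one>\<^bsub>RG\<^esub>" and ?t = "y \<ominus>\<^bsub>RG\<^esub> \<one>\<^bsub>RG\<^esub>"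
  have s: "?s \<in> carrier RG" and t: "?t \<in> carrier RG" using x y by (auto simp: carrier_M)
  have st: "eqI ?s ?t" using xy x y by (simp add: eqI_def RG_minus)
  have pow: "eqI (?s [^]\<^bsub>RG\<^esub> k) (?t [^]\<^bsub>RG\<^esub> k)" for k :: nat
  proof (induction k)
    case (Suc k)
    show ?case using eqI_mult[OF Suc st] s t by simp
  qed (simp add: eqI_refl)
  have "(\<lambda>g. \<Sum>i<p. (a gchoose i) * (\<lambda>g. (?s [^]\<^bsub>RG\<^esub> i) g - (?t [^]\<^bsub>RG\<^esub> i) g) g) \<in> I"
    using pow by (intro ideal_lincomb[OF Apow_ideal]) (auto simp: eqI_def binom_R a)
  thus ?thesis by (simp add: eqI_def trunc_exp_def right_diff_distrib sum_subtractf)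
qed

lemma ev_monom: "ev s (monom c i) = smult c (s [^]\<^bsub>RG\<^esub> i)"
proof (cases "c = 0")
  case False
  have "(\<Sum>j\<le>i. (if i = j then c else 0) * (s [^]\<^bsub>RG\<^esub> j) h) = c * (s [^]\<^bsub>RG\<^esub> i) h" for h
    by (simp add: if_distrib[of "\<lambda>u. u * _"] cong: if_cong)
  thus ?thesis using False by (simp add: ev_def degree_monom_eq smult_def)
qed (simp add: ev_0 smult_def)

text \<open>
  From \<open>(1 + s) ^ p = 1\<close> one gets \<open>s ^ p = - p s (1 + w)\<close> with \<open>w\<close> in the augmentation ideal, and
  \<open>1 + w\<close> is invertible.  Hence the classes of truncated powers depend only on the exponent modulo
  \<open>p\<close>, that is, on its residue class.
\<close>

lemma p_smult_gen:
  assumes g: "g \<in> carrier G"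
  shows "smult (of_nat p) (group_ring_of g \<ominus>\<^bsub>RG\<^esub> \<one>\<^bsub>RG\<^esub>) \<in> I"
proof -
  define x :: "'g \<Rightarrow> 'a" where "x = group_ring_of g"
  let ?s = "x \<ominus>\<^bsub>RG\<^esub> \<one>\<^bsub>RG\<^esub>"
  have x: "x \<in> carrier RG" by (simp add: x_def group_ring_of_closed g)
  have sA: "?s \<in> A" unfolding x_def by (rule A_gen[OF g])
  have s: "?s \<in> carrier RG" by (rule A_carrier[OF sA])
  define W :: "'a poly" where "W = (\<Sum>i=2..<p. monom (of_nat ((p choose i) div p)) (i - 1))"
  have WR: "coeff W i \<in> R" for i by (auto simp: W_def coeff_sum R_sum R_0 R_of_nat)
  have cdiv: "of_nat (p choose i) = (of_nat p * of_nat ((p choose i) div p) :: 'a)" if "1 \<le> i" "i < p" for i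
  proof -
    have "p dvd (p choose i)" using prime_p that by (intro dvd_choose_prime) auto
    thus ?thesis by (metis dvd_mult_div_cancel of_nat_mult)
  qed
  have sW: "?s \<otimes>\<^bsub>RG\<^esub> ev ?s W = (\<lambda>h. \<Sum>i=2..<p. of_nat ((p choose i) div p) * (?s [^]\<^bsub>RG\<^esub> i) h)"
  proof -
    have "?s \<otimes>\<^bsub>RG\<^esub> ev ?s W = ev ?s (pCons 0 W)" by (simp add: ev_pCons[OF s])
    also have "pCons 0 W = (\<Sum>i=2..<p. monom (of_nat ((p choose i) div p)) i)"
    proof -
      have "pCons 0 W = [:0, 1:] * W" by simp
      also have "\<dots> = (\<Sum>i=2..<p. [:0, 1:] * monom (of_nat ((p choose i) div p)) (i - 1))"
        unfolding W_def by (rule sum_distrib_left)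
      also have "\<dots> = (\<Sum>i=2..<p. monom (of_nat ((p choose i) div p)) i)"
        by (intro sum.cong refl) (auto simp: monom_Suc[symmetric])
      finally show ?thesis .
    qed
    also have "ev ?s \<dots> = (\<lambda>h. \<Sum>i=2..<p. of_nat ((p choose i) div p) * (?s [^]\<^bsub>RG\<^esub> i) h)"
      unfolding ev_sum ev_monom by (simp add: smult_def)
    finally show ?thesis .
  qed
  have eWA: "ev ?s W \<in> A"
  proof -
    have "ev ?s W \<in> Apow 1"
      by (rule ev_in_Apow[OF sA WR]) (auto simp: W_def coeff_sum intro!: sum.neutral)
    thus ?thesis using Apow_1_subset by blast
  qed
  then obtain y where y: "y \<in> carrier RG" "(\<one>\<^bsub>RG\<^esub> \<oplus>\<^bsub>RG\<^esub> ev ?s W) \<otimes>\<^bsub>RG\<^esub> y = \<one>\<^bsub>RG\<^esub>"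
    using aug_inverse by blast
  have eW: "ev ?s W \<in> carrier RG" by (rule A_carrier[OF eWA])
  have "\<one>\<^bsub>RG\<^esub> = x [^]\<^bsub>RG\<^esub> p"
    unfolding x_def group_ring_of_pow[OF g] exponent_p[OF g] by (simp add: group_ring_of_one)
  also have "\<dots> = (\<lambda>h. \<Sum>i<Suc p. of_nat (p choose i) * (?s [^]\<^bsub>RG\<^esub> i) h)"
    by (rule newton_RG[OF x]) simp
  finally have one: "\<one>\<^bsub>RG\<^esub> h = (\<Sum>i<Suc p. of_nat (p choose i) * (?s [^]\<^bsub>RG\<^esub> i) h)" for h
    by (rule fun_cong)
  have set: "{..<Suc p} = insert 0 (insert 1 (insert p {2..<p}))" using p_gt_1 by auto
  have rel: "(?s [^]\<^bsub>RG\<^esub> p) h + of_nat p * (?s \<otimes>\<^bsub>RG\<^esub> (\<one>\<^bsub>RG\<^esub> \<oplus>\<^bsub>RG\<^esub> ev ?s W)) h = 0" for h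
  proof -
    have "?s \<otimes>\<^bsub>RG\<^esub> (\<one>\<^bsub>RG\<^esub> \<oplus>\<^bsub>RG\<^esub> ev ?s W) = ?s \<oplus>\<^bsub>RG\<^esub> ?s \<otimes>\<^bsub>RG\<^esub> ev ?s W"
      using s eW by (simp add: RG.r_distr)
    hence "of_nat p * (?s \<otimes>\<^bsub>RG\<^esub> (\<one>\<^bsub>RG\<^esub> \<oplus>\<^bsub>RG\<^esub> ev ?s W)) h =
        of_nat p * ?s h + (\<Sum>i=2..<p. of_nat (p choose i) * (?s [^]\<^bsub>RG\<^esub> i) h)"
      by (simp add: RG_add sW distrib_left sum_distrib_left cdiv mult.assoc)
    moreover have "\<one>\<^bsub>RG\<^esub> h = \<one>\<^bsub>RG\<^esub> h + (of_nat p * ?s h + ((?s [^]\<^bsub>RG\<^esub> p) h +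
        (\<Sum>i=2..<p. of_nat (p choose i) * (?s [^]\<^bsub>RG\<^esub> i) h)))"
      using one[of h] p_gt_1 s unfolding set by simp
    ultimately show ?thesis by (simp add: algebra_simps)
  qed
  have "smult (of_nat p) ?s = smult (-1) (?s [^]\<^bsub>RG\<^esub> p \<otimes>\<^bsub>RG\<^esub> y)"
  proof -
    have "smult (of_nat p) (?s \<otimes>\<^bsub>RG\<^esub> (\<one>\<^bsub>RG\<^esub> \<oplus>\<^bsub>RG\<^esub> ev ?s W)) = smult (-1) (?s [^]\<^bsub>RG\<^esub> p)"
      using rel by (simp add: smult_def fun_eq_iff add_eq_0_iff)
    hence "smult (of_nat p) ((?s \<otimes>\<^bsub>RG\<^esub> (\<one>\<^bsub>RG\<^esub> \<oplus>\<^bsub>RG\<^esub> ev ?s W)) \<otimes>\<^bsub>RG\<^esub> y) =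
        smult (-1) (?s [^]\<^bsub>RG\<^esub> p \<otimes>\<^bsub>RG\<^esub> y)"
      by (simp only: smult_mult[symmetric])
    thus ?thesis using s by (simp add: RG_mult_assoc y(2))
  qed
  also have "\<dots> \<in> I"
    by (intro ideal_smult[OF Apow_ideal] R_uminus R_1 ideal.I_r_closed[OF Apow_ideal] Apow_power sA y(1))
  finally show ?thesis by (simp add: x_def)
qed

lemma p_smult_A: assumes "z \<in> A" shows "smult (of_nat p) z \<in> I"
proof (rule aug_ideal_induct[OF assms])
  fix x y assume xy: "x \<in> carrier RG" "y \<in> carrier RG"
  show "smult (of_nat p) (\<lambda>g. x g + y g) \<in> I" if "smult (of_nat p) x \<in> I" "smult (of_nat p) y \<in> I"
    using ideal_add[OF Apow_ideal that] by (simp add: smult_def distrib_left)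
  show "smult (of_nat p) (x \<otimes>\<^bsub>RG\<^esub> y) \<in> I" if "smult (of_nat p) y \<in> I"
    using ideal.I_l_closed[OF Apow_ideal that xy(1)] by (simp add: mult_smult)
qed (rule p_smult_gen)

text \<open>
  Each \<open>p * a gchoose i\<close> with \<open>0 < i < p\<close> is divisible by \<open>p\<close>.
\<close>

lemma te_p_mult:
  assumes x: "x \<in> carrier M" and a: "a \<in> R"
  shows "eqI (te x (of_nat p * a)) \<one>\<^bsub>RG\<^esub>"
proof -
  have xR: "x \<in> carrier RG" "x \<ominus>\<^bsub>RG\<^esub> \<one>\<^bsub>RG\<^esub> \<in> A" using x by (simp_all add: carrier_M)
  let ?s = "x \<ominus>\<^bsub>RG\<^esub> \<one>\<^bsub>RG\<^esub>" and ?b = "of_nat p * a"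
  have s: "?s \<in> carrier RG" by (rule A_carrier[OF xR(2)])
  define c where "c = (\<lambda>i. a * (1 / of_nat i) * (?b - 1 gchoose (i - 1)))"
  have bR: "?b - 1 \<in> R" by (intro R_diff R_mult R_of_nat a R_1)
  have cR: "c i \<in> R" if "i \<in> {1..<p}" for i
    unfolding c_def using that by (intro R_mult a inverse_R binom_R bR) auto
  have binom: "(?b gchoose i) = c i * of_nat p" if i: "i \<in> {1..<p}" for i
  proof -
    obtain k where k: "i = Suc k" using i by (cases i) auto
    have "of_nat (Suc k) * (?b gchoose Suc k) = ?b * (?b - 1 gchoose k)"
      using gbinomial_absorption[of k ?b] by simp
    hence "(?b gchoose Suc k) = ?b * (?b - 1 gchoose k) / of_nat (Suc k)"
      by (simp add: nonzero_eq_divide_eq mult.commute del: of_nat_Suc)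
    thus ?thesis by (simp add: k c_def)
  qed
  have sp: "{..<p} = insert 0 {1..<p}" using p_gt_1 by auto
  have "(\<lambda>g. te x ?b g - \<one>\<^bsub>RG\<^esub> g) = (\<lambda>g. \<Sum>i=1..<p. c i * smult (of_nat p) (?s [^]\<^bsub>RG\<^esub> i) g)"
    unfolding trunc_exp_def sp by (rule ext) (simp add: binom smult_def mult.assoc)
  also have "\<dots> \<in> I"
  proof (rule ideal_lincomb[OF Apow_ideal cR])
    fix i assume "i \<in> {1..<p}"
    hence "?s [^]\<^bsub>RG\<^esub> i \<in> Apow 1" using Apow_power[OF xR(2), of i] Apow_antimono[of 1 i] by auto
    thus "smult (of_nat p) (?s [^]\<^bsub>RG\<^esub> i) \<in> I" using Apow_1_subset p_smult_A by blast
  qed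
  finally show ?thesis by (simp add: eqI_def)
qed

end

context trunc_algebra
begin

abbreviation span where "span \<equiv> trunc_span p R G"

text \<open>
  Stability under the scalars of the residue field.
\<close>

definition exp_closed :: "('g \<Rightarrow> 'a) set set \<Rightarrow> bool" where
  "exp_closed H \<longleftrightarrow> (\<forall>\<omega>\<in>R. \<forall>x\<in>carrier M. cl x \<in> H \<longrightarrow> cl (te x \<omega>) \<in> H)"

lemma span_def': "span S = \<Inter>{H. subgroup H TG \<and> S \<subseteq> H \<and> exp_closed H}"
  by (simp add: trunc_span_def exp_closed_def)

lemma carrier_TG_exp_closed: "exp_closed (carrier TG)"
  by (auto simp: exp_closed_def intro: cl_in te_M)

lemma span_subgroup: assumes "S \<subseteq> carrier TG" shows "subgroup (span S) TG"
  unfolding span_def'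
  by (rule TG.subgroups_Inter) (use assms TG.subgroup_self carrier_TG_exp_closed in auto)

lemma span_incl: "S \<subseteq> span S"
  by (auto simp: span_def')

lemma span_exp_closed: "exp_closed (span S)"
  unfolding exp_closed_def span_def' by blast

lemma span_least: "subgroup H TG \<Longrightarrow> S \<subseteq> H \<Longrightarrow> exp_closed H \<Longrightarrow> span S \<subseteq> H"
  by (auto simp: span_def')

lemma span_mono_span:
  assumes "S \<subseteq> span S'" "S' \<subseteq> carrier TG"
  shows "span S \<subseteq> span S'"
  by (rule span_least[OF span_subgroup[OF assms(2)] assms(1) span_exp_closed])

lemma te_1: assumes "x \<in> carrier RG" shows "te x 1 = x"
proof -
  have "x [^]\<^bsub>RG\<^esub> (1::nat) = te x 1"
    unfolding newton_RG[OF assms p_gt_1] trunc_exp_def by (simp add: binomial_gbinomial)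
  thus ?thesis using assms by simp
qed

lemma te_0: assumes "x \<in> carrier RG" shows "te x 0 = \<one>\<^bsub>RG\<^esub>"
proof -
  have "x [^]\<^bsub>RG\<^esub> (0::nat) = te x 0"
    unfolding newton_RG[OF assms less_trans[OF zero_less_one p_gt_1]] trunc_exp_def
    by (simp add: binomial_gbinomial)
  thus ?thesis by simp
qed

lemma M_mult_closed: "x \<in> carrier M \<Longrightarrow> y \<in> carrier M \<Longrightarrow> x \<otimes>\<^bsub>RG\<^esub> y \<in> carrier M"
  using M.m_closed[of x y] by (simp add: M_mult)

text \<open>
  The right-hand side is closed under products and under truncated exponentiation by the laws of
  \<open>te\<close>.
\<close>

lemma span_pair:
  assumes x: "x \<in> carrier M" and y: "y \<in> carrier M"
  shows "span {cl x, cl y} = {cl (te x a \<otimes>\<^bsub>RG\<^esub> te y c) |a c. a \<in> R \<and> c \<in> R}"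
    (is "_ = ?H")
proof
  have xR: "x \<in> carrier RG" and yR: "y \<in> carrier RG" using x y M_RG by auto
  have tM: "te x a \<otimes>\<^bsub>RG\<^esub> te y c \<in> carrier M" if "a \<in> R" "c \<in> R" for a c
    using that by (intro M_mult_closed te_M x y)
  have prod: "cl (te x a \<otimes>\<^bsub>RG\<^esub> te y c) \<otimes>\<^bsub>TG\<^esub> cl (te x a' \<otimes>\<^bsub>RG\<^esub> te y c') =
      cl (te x (a + a') \<otimes>\<^bsub>RG\<^esub> te y (c + c'))"
    if R: "a \<in> R" "c \<in> R" "a' \<in> R" "c' \<in> R" for a c a' c'
  proof -
    note cls = te_closed[OF xR R(1)] te_closed[OF xR R(3)] te_closed[OF yR R(2)] te_closed[OF yR R(4)]
    have "(te x a \<otimes>\<^bsub>RG\<^esub> te y c) \<otimes>\<^bsub>RG\<^esub> (te x a' \<otimes>\<^bsub>RG\<^esub> te y c') =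
        (te x a \<otimes>\<^bsub>RG\<^esub> te x a') \<otimes>\<^bsub>RG\<^esub> (te y c \<otimes>\<^bsub>RG\<^esub> te y c')"
      using cls by (simp add: RG.m_ac)
    moreover have "eqI \<dots> (te x (a + a') \<otimes>\<^bsub>RG\<^esub> te y (c + c'))"
      using R cls by (intro eqI_mult te_add x y te_closed xR yR R_add RG_mult_closed)
    ultimately have "eqI ((te x a \<otimes>\<^bsub>RG\<^esub> te y c) \<otimes>\<^bsub>RG\<^esub> (te x a' \<otimes>\<^bsub>RG\<^esub> te y c'))
        (te x (a + a') \<otimes>\<^bsub>RG\<^esub> te y (c + c'))" by simp
    moreover have "(te x a \<otimes>\<^bsub>RG\<^esub> te y c) \<otimes>\<^bsub>RG\<^esub> (te x a' \<otimes>\<^bsub>RG\<^esub> te y c') \<in> carrier M"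
      using R by (intro M_mult_closed te_M x y)
    ultimately show ?thesis using R cl_mult[OF tM tM] cl_eq_iff[OF _ tM] by (simp add: R_add)
  qed
  have one: "\<one>\<^bsub>TG\<^esub> = cl (te x 0 \<otimes>\<^bsub>RG\<^esub> te y 0)"
    by (simp add: te_0 xR yR cl_one)
  have sub: "subgroup ?H TG"
  proof (rule TG.subgroupI)
    show "?H \<subseteq> carrier TG" using tM cl_in by auto
    show "?H \<noteq> {}" using R_0 by blast
    show "inv\<^bsub>TG\<^esub> C \<in> ?H" if C: "C \<in> ?H" for C
    proof -
      obtain a c where ac: "a \<in> R" "c \<in> R" "C = cl (te x a \<otimes>\<^bsub>RG\<^esub> te y c)" using C by blast
      have "cl (te x (- a) \<otimes>\<^bsub>RG\<^esub> te y (- c)) \<otimes>\<^bsub>TG\<^esub> C = \<one>\<^bsub>TG\<^esub>"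
        unfolding ac(3) one using ac by (subst prod) (simp_all add: R_uminus)
      hence "inv\<^bsub>TG\<^esub> C = cl (te x (- a) \<otimes>\<^bsub>RG\<^esub> te y (- c))"
        using ac tM cl_in R_uminus by (intro TG.inv_equality) auto
      thus ?thesis using ac R_uminus by blast
    qed
    show "C \<otimes>\<^bsub>TG\<^esub> C' \<in> ?H" if C: "C \<in> ?H" "C' \<in> ?H" for C C'
    proof -
      obtain a c where ac: "a \<in> R" "c \<in> R" "C = cl (te x a \<otimes>\<^bsub>RG\<^esub> te y c)" using C(1) by blast
      obtain a' c' where ac': "a' \<in> R" "c' \<in> R" "C' = cl (te x a' \<otimes>\<^bsub>RG\<^esub> te y c')" using C(2) by blast
      show ?thesis unfolding ac(3) ac'(3) prod[OF ac(1,2) ac'(1,2)] using ac ac' R_add by blast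
    qed
  qed
  have exp: "exp_closed ?H"
    unfolding exp_closed_def
  proof (intro ballI impI)
    fix \<omega> z assume w: "\<omega> \<in> R" and z: "z \<in> carrier M" and "cl z \<in> ?H"
    then obtain a c where ac: "a \<in> R" "c \<in> R" "cl z = cl (te x a \<otimes>\<^bsub>RG\<^esub> te y c)" by blast
    have mem: "te x a \<in> carrier M" "te y c \<in> carrier M" "te (te x a) \<omega> \<in> carrier M"
      "te (te y c) \<omega> \<in> carrier M" using ac w by (intro te_M x y; simp)+
    have "eqI z (te x a \<otimes>\<^bsub>RG\<^esub> te y c)" using ac cl_eq_iff[OF z tM] by simp
    hence 1: "eqI (te z \<omega>) (te (te x a \<otimes>\<^bsub>RG\<^esub> te y c) \<omega>)" using z tM ac w by (intro te_cong) auto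
    have 2: "eqI (te (te x a \<otimes>\<^bsub>RG\<^esub> te y c) \<omega>) (te (te x a) \<omega> \<otimes>\<^bsub>RG\<^esub> te (te y c) \<omega>)"
      by (rule eqI_sym[OF te_mult[OF mem(1,2) w]])
    have 3: "eqI (te (te x a) \<omega> \<otimes>\<^bsub>RG\<^esub> te (te y c) \<omega>) (te x (\<omega> * a) \<otimes>\<^bsub>RG\<^esub> te y (\<omega> * c))"
      using mem ac w by (intro eqI_mult te_te x y te_closed xR yR R_mult M_RG)
    have "eqI (te z \<omega>) (te x (\<omega> * a) \<otimes>\<^bsub>RG\<^esub> te y (\<omega> * c))"
      by (rule eqI_trans[OF eqI_trans[OF 1 2] 3])
    hence "cl (te z \<omega>) = cl (te x (\<omega> * a) \<otimes>\<^bsub>RG\<^esub> te y (\<omega> * c))"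
      using cl_eq_iff[OF te_M[OF z w] tM] ac w by (simp add: R_mult)
    thus "cl (te z \<omega>) \<in> ?H" using ac w R_mult by blast
  qed
  have "cl x = cl (te x 1 \<otimes>\<^bsub>RG\<^esub> te y 0)" "cl y = cl (te x 0 \<otimes>\<^bsub>RG\<^esub> te y 1)"
    by (simp_all add: te_0 te_1 xR yR)
  hence "{cl x, cl y} \<subseteq> ?H" using R_0 R_1 by blast
  thus "span {cl x, cl y} \<subseteq> ?H" by (rule span_least[OF sub _ exp])
  show "?H \<subseteq> span {cl x, cl y}"
  proof
    fix C assume "C \<in> ?H"
    then obtain a c where ac: "a \<in> R" "c \<in> R" "C = cl (te x a \<otimes>\<^bsub>RG\<^esub> te y c)" by blast
    interpret S: subgroup "span {cl x, cl y}" TG by (rule span_subgroup) (simp add: cl_in x y)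
    have "cl (te x a) \<in> span {cl x, cl y}" "cl (te y c) \<in> span {cl x, cl y}"
      using span_exp_closed[of "{cl x, cl y}"] span_incl[of "{cl x, cl y}"] x y ac
      unfolding exp_closed_def by blast+
    from S.m_closed[OF this] show "C \<in> span {cl x, cl y}"
      using cl_mult[OF te_M[OF x ac(1)] te_M[OF y ac(2)]] ac(3) by simp
  qed
qed

lemma span_single:
  assumes x: "x \<in> carrier M"
  shows "span {cl x} = {cl (te x a) |a. a \<in> R}"
proof -
  have one: "\<one>\<^bsub>RG\<^esub> \<in> carrier M" using M.one_closed by (simp add: M_one)
  have xR: "x \<in> carrier RG" using x M_RG by auto
  have te1: "te \<one>\<^bsub>RG\<^esub> c = \<one>\<^bsub>RG\<^esub>" for c
  proof -
    have z: "\<one>\<^bsub>RG\<^esub> \<ominus>\<^bsub>RG\<^esub> \<one>\<^bsub>RG\<^esub> = \<zero>\<^bsub>RG\<^esub>" by (simp add: a_minus_def RG.r_neg)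
    have zp: "(\<zero>\<^bsub>RG\<^esub> [^]\<^bsub>RG\<^esub> i) g = 0" if "i \<noteq> 0" for i :: nat and g
      unfolding RG.nat_pow_zero[OF that] by (simp add: RG_zero)
    have "te \<one>\<^bsub>RG\<^esub> c g = (\<Sum>i\<in>{0}. (c gchoose i) * (\<zero>\<^bsub>RG\<^esub> [^]\<^bsub>RG\<^esub> i) g)" for g
      unfolding trunc_exp_def z using p_gt_1
      by (intro sum.mono_neutral_right) (auto simp: zp)
    thus ?thesis by (simp add: fun_eq_iff)
  qed
  have "span {cl x} = span {cl x, cl \<one>\<^bsub>RG\<^esub>}"
  proof (rule subset_antisym)
    have *: "{cl x} \<subseteq> carrier TG" "{cl x, cl \<one>\<^bsub>RG\<^esub>} \<subseteq> carrier TG" using x one by (auto intro: cl_in)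
    show "span {cl x} \<subseteq> span {cl x, cl \<one>\<^bsub>RG\<^esub>}"
      by (rule span_mono_span[OF _ *(2)]) (use span_incl[of "{cl x, cl \<one>\<^bsub>RG\<^esub>}"] in blast)
    have "cl \<one>\<^bsub>RG\<^esub> \<in> span {cl x}" unfolding cl_one by (rule subgroup.one_closed[OF span_subgroup[OF *(1)]])
    thus "span {cl x, cl \<one>\<^bsub>RG\<^esub>} \<subseteq> span {cl x}"
      by (intro span_mono_span[OF _ *(1)]) (use span_incl[of "{cl x}"] in blast)
  qed
  also have "\<dots> = {cl (te x a) |a. a \<in> R}"
  proof -
    have eq: "cl (te x a \<otimes>\<^bsub>RG\<^esub> \<one>\<^bsub>RG\<^esub>) = cl (te x a)" if "a \<in> R" for a
      using te_closed[OF xR that] by simp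
    show ?thesis
      unfolding span_pair[OF x one] te1 by (intro Collect_cong) (use eq R_1 in metis)
  qed
  finally show ?thesis .
qed

lemma group_ring_of_M: assumes "g \<in> carrier G" shows "group_ring_of g \<in> carrier M"
  using A_gen[OF assms] group_ring_of_closed[OF assms] by (simp add: carrier_M)

text \<open>
  The class of \<open>\<gamma>\<close> is recovered from \<open>\<Theta> = \<gamma> \<sigma>^[\<omega>]\<close> by multiplying with \<open>\<sigma>^[- \<omega>]\<close>.
\<close>

lemma refined_group_generators:
  assumes g: "\<gamma> \<in> carrier G" and s: "\<sigma> \<in> carrier G" and gen: "generate G {\<gamma>, \<sigma>} = carrier G"
    and w: "\<omega> \<in> R"
  defines "\<theta> \<equiv> group_ring_of \<gamma> \<otimes>\<^bsub>RG\<^esub> te (group_ring_of \<sigma>) \<omega>"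
  shows "refined_group p R G = span {cl \<theta>, cl (group_ring_of \<sigma>)}"
proof -
  let ?S = "(\<lambda>g. cl (group_ring_of g)) ` carrier G" and ?T = "{cl \<theta>, cl (group_ring_of \<sigma>)}"
  have gM: "group_ring_of \<gamma> \<in> carrier M" and sM: "group_ring_of \<sigma> \<in> carrier M"
    and tM: "te (group_ring_of \<sigma>) \<omega> \<in> carrier M"
    using g s w by (auto intro: group_ring_of_M te_M)
  have \<theta>M: "\<theta> \<in> carrier M" unfolding \<theta>_def by (rule M_mult_closed[OF gM tM])
  have SC: "?S \<subseteq> carrier TG" and TC: "?T \<subseteq> carrier TG" using \<theta>M sM group_ring_of_M cl_in by auto
  interpret T: subgroup "span ?T" TG by (rule span_subgroup[OF TC])
  interpret S: subgroup "span ?S" TG by (rule span_subgroup[OF SC])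
  have \<theta>: "cl \<theta> = cl (group_ring_of \<gamma>) \<otimes>\<^bsub>TG\<^esub> cl (te (group_ring_of \<sigma>) \<omega>)"
    unfolding \<theta>_def by (rule cl_mult[OF gM tM, symmetric])
  have "?T \<subseteq> span ?S"
  proof -
    have 1: "cl (group_ring_of \<gamma>) \<in> span ?S" "cl (group_ring_of \<sigma>) \<in> span ?S"
      using span_incl[of ?S] g s by blast+
    hence "cl (te (group_ring_of \<sigma>) \<omega>) \<in> span ?S"
      using span_exp_closed[of ?S] sM w unfolding exp_closed_def by blast
    thus ?thesis using 1 \<theta> by simp
  qed
  hence a: "span ?T \<subseteq> span ?S" by (rule span_mono_span[OF _ SC])
  have sT: "cl (group_ring_of \<sigma>) \<in> span ?T" "cl \<theta> \<in> span ?T" using span_incl[of ?T] by blast+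
  hence tT: "cl (te (group_ring_of \<sigma>) \<omega>) \<in> span ?T"
    using span_exp_closed[of ?T] sM w unfolding exp_closed_def by blast
  have "cl (group_ring_of \<gamma>) = cl \<theta> \<otimes>\<^bsub>TG\<^esub> inv\<^bsub>TG\<^esub> cl (te (group_ring_of \<sigma>) \<omega>)"
    unfolding \<theta> using gM tM by (simp add: TG.m_assoc cl_in)
  hence gT: "cl (group_ring_of \<gamma>) \<in> span ?T" using sT tT by simp
  have cl_inv_of: "cl (group_ring_of (inv g)) = inv\<^bsub>TG\<^esub> cl (group_ring_of g)" if "g \<in> carrier G" for g
    using that group_ring_of_M cl_in
    by (intro TG.inv_equality[symmetric]) (simp_all add: cl_mult group_ring_of_mult group_ring_of_one cl_one)
  have "cl (group_ring_of h) \<in> span ?T" if "h \<in> generate G {\<gamma>, \<sigma>}" for h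
    using that
  proof (induction rule: generate.induct)
    case one show ?case by (simp add: group_ring_of_one cl_one)
  next
    case (incl h) thus ?case using gT sT by auto
  next
    case (inv h) thus ?case using gT sT g s by (auto simp: cl_inv_of)
  next
    case (eng h1 h2)
    hence "h1 \<in> carrier G" "h2 \<in> carrier G" using gen by auto
    hence "cl (group_ring_of (h1 \<otimes> h2)) = cl (group_ring_of h1) \<otimes>\<^bsub>TG\<^esub> cl (group_ring_of h2)"
      by (simp add: cl_mult group_ring_of_M group_ring_of_mult)
    thus ?case using eng by simp
  qed
  hence "?S \<subseteq> span ?T" using gen by auto
  hence "span ?S \<subseteq> span ?T" by (rule span_mono_span[OF _ TC])
  with a show ?thesis by (simp add: refined_group_def)
qed

end

section \<open>The refined ramification filtration\<close>

locale refined_base =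
  trunc_algebra \<Gamma> OT p + ramified v p e K f Qp "carrier \<Gamma>" b
  for \<Gamma> :: "('a::field_char_0 \<Rightarrow> 'a) monoid" (structure) and OT :: "'a set" and p :: nat
    and v :: "'a \<Rightarrow> ereal" and e :: int and K :: "'a set" and f :: nat and Qp :: "'a set" and b :: int +
  assumes \<Gamma>_mult: "\<And>g h. g \<otimes> h = g \<circ> h" and \<Gamma>_one: "\<one> = id"
    and OT_K: "OT \<subseteq> K" and OT_int: "\<And>x. x \<in> OT \<Longrightarrow> vge 0 x"
    and OT_p: "\<And>x. x \<in> OT \<Longrightarrow> vge 1 x \<Longrightarrow> \<exists>y\<in>OT. x = of_nat p * y"
    and teichmueller_OT: "\<And>x. x \<in> K \<Longrightarrow> x ^ q = x \<Longrightarrow> x \<in> OT"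

locale refined_setting =
  refined_base \<Gamma> OT p v e K f Qp b + ramified_triple v p e K f Qp "carrier \<Gamma>" b \<gamma> \<sigma> \<omega>
  for \<Gamma> :: "('a::field_char_0 \<Rightarrow> 'a) monoid" (structure) and OT :: "'a set" and p :: nat
    and v :: "'a \<Rightarrow> ereal" and e :: int and K :: "'a set" and f :: nat and Qp :: "'a set" and b :: int
    and \<gamma> \<sigma> :: "'a \<Rightarrow> 'a" and \<omega> :: 'a +
  assumes \<omega>_OT: "\<omega> \<in> OT"
    and generators: "generate \<Gamma> {\<gamma>, \<sigma>} = carrier \<Gamma>"
begin

abbreviation act :: "(('a \<Rightarrow> 'a) \<Rightarrow> 'a) \<Rightarrow> 'a \<Rightarrow> 'a" where
  "act \<equiv> group_ring_act \<Gamma>"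

lemma act_lincomb: "act (\<lambda>g. \<Sum>i\<in>J. c i * z i g) \<alpha> = (\<Sum>i\<in>J. c i * act (z i) \<alpha>)"
proof -
  have "act (\<lambda>g. \<Sum>i\<in>J. c i * z i g) \<alpha> = (\<Sum>g\<in>carrier \<Gamma>. \<Sum>i\<in>J. c i * (z i g * g \<alpha>))"
    by (simp add: group_ring_act_def sum_distrib_right mult.assoc)
  also have "\<dots> = (\<Sum>i\<in>J. \<Sum>g\<in>carrier \<Gamma>. c i * (z i g * g \<alpha>))" by (rule sum.swap)
  finally show ?thesis by (simp add: group_ring_act_def sum_distrib_left)
qed

lemma act_plus: "act (\<lambda>g. x g + y g) \<alpha> = act x \<alpha> + act y \<alpha>"
  by (simp add: group_ring_act_def distrib_right sum.distrib)

lemma act_minus: "act (\<lambda>g. x g - y g) \<alpha> = act x \<alpha> - act y \<alpha>"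
  by (simp add: group_ring_act_def left_diff_distrib sum_subtractf)

lemma act_of: "g \<in> carrier \<Gamma> \<Longrightarrow> act (group_ring_of g) \<alpha> = g \<alpha>"
  using G_card(1) by (simp add: group_ring_act_def group_ring_of_def if_distrib[of "\<lambda>u. u * _"] cong: if_cong)

lemma act_one: "act \<one>\<^bsub>RG\<^esub> \<alpha> = \<alpha>"
  using act_of[OF G_id, of \<alpha>] by (simp add: RG_one \<Gamma>_one group_ring_of_def)

lemma act_mult:
  assumes y: "y \<in> carrier RG"
  shows "act (x \<otimes>\<^bsub>RG\<^esub> y) \<alpha> = act x (act y \<alpha>)"
proof -
  have "act (x \<otimes>\<^bsub>RG\<^esub> y) \<alpha> = (\<Sum>g\<in>carrier \<Gamma>. \<Sum>h\<in>carrier \<Gamma>. x h * (y (inv h \<otimes> g) * g \<alpha>))"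
    by (simp add: group_ring_act_def RG_mult sum_distrib_right mult.assoc)
  also have "\<dots> = (\<Sum>h\<in>carrier \<Gamma>. \<Sum>g\<in>carrier \<Gamma>. x h * (y (inv h \<otimes> g) * g \<alpha>))" by (rule sum.swap)
  also have "\<dots> = (\<Sum>h\<in>carrier \<Gamma>. x h * h (act y \<alpha>))"
  proof (rule sum.cong[OF refl])
    fix h assume h: "h \<in> carrier \<Gamma>"
    have "(\<Sum>g\<in>carrier \<Gamma>. x h * (y (inv h \<otimes> g) * g \<alpha>)) =
        (\<Sum>m\<in>carrier \<Gamma>. x h * (y (inv h \<otimes> (h \<otimes> m)) * (h \<otimes> m) \<alpha>))"
      by (rule sum_translate[OF h])
    also have "\<dots> = (\<Sum>m\<in>carrier \<Gamma>. x h * (y m * h (m \<alpha>)))"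
    proof (rule sum.cong[OF refl])
      fix m assume m: "m \<in> carrier \<Gamma>"
      have "inv h \<otimes> (h \<otimes> m) = m" using h m by (simp add: m_assoc[symmetric])
      thus "x h * (y (inv h \<otimes> (h \<otimes> m)) * (h \<otimes> m) \<alpha>) = x h * (y m * h (m \<alpha>))"
        by (simp add: \<Gamma>_mult)
    qed
    also have "\<dots> = x h * h (act y \<alpha>)"
    proof -
      have yK: "h (y m) = y m" for m using RG_in[OF y] OT_K by (intro aut_K[OF h]) auto
      show ?thesis
        by (simp add: group_ring_act_def aut_sum[OF h] aut_mult[OF h] yK sum_distrib_left)
    qed
    finally show "(\<Sum>g\<in>carrier \<Gamma>. x h * (y (inv h \<otimes> g) * g \<alpha>)) = x h * h (act y \<alpha>)" .
  qed
  finally show ?thesis by (simp add: group_ring_act_def)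
qed

lemma act_power: assumes z: "z \<in> carrier RG" shows "act (z [^]\<^bsub>RG\<^esub> (n::nat)) \<alpha> = (act z ^^ n) \<alpha>"
proof (induction n)
  case (Suc n)
  have "act (z [^]\<^bsub>RG\<^esub> Suc n) \<alpha> = act (z \<otimes>\<^bsub>RG\<^esub> z [^]\<^bsub>RG\<^esub> n) \<alpha>" using z by (simp add: RG_mult_comm[of z])
  also have "\<dots> = act z (act (z [^]\<^bsub>RG\<^esub> n) \<alpha>)" using z by (intro act_mult) simp
  finally show ?case by (simp add: Suc)
qed (simp add: act_one)

lemma act_vge: assumes x: "x \<in> carrier RG" and \<alpha>: "vge n \<alpha>" shows "vge n (act x \<alpha>)"
  unfolding group_ring_act_def
proof (rule vge_sum)
  fix g assume g: "g \<in> carrier \<Gamma>"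
  show "vge n (x g * g \<alpha>)" by (rule vge_mult0[OF OT_int[OF RG_in[OF x]] aut_vge[OF g \<alpha>]])
qed

lemma act_gen: "g \<in> carrier \<Gamma> \<Longrightarrow> act (group_ring_of g \<ominus>\<^bsub>RG\<^esub> \<one>\<^bsub>RG\<^esub>) \<alpha> = g \<alpha> - \<alpha>"
  by (simp add: RG_minus act_minus act_of act_one)

lemma act_A:
  assumes "z \<in> A" "vge n \<alpha>"
  shows "vge (n + b) (act z \<alpha>)"
proof -
  have "\<forall>\<alpha>. vge n \<alpha> \<longrightarrow> vge (n + b) (act z \<alpha>)"
  proof (rule aug_ideal_induct[OF assms(1)])
    show "\<forall>\<alpha>. vge n \<alpha> \<longrightarrow> vge (n + b) (act (group_ring_of g \<ominus>\<^bsub>RG\<^esub> \<one>\<^bsub>RG\<^esub>) \<alpha>)" if "g \<in> carrier \<Gamma>" for g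
      using raise_b[OF that] by (simp add: act_gen[OF that])
  qed (auto simp: act_plus act_mult intro: vge_add act_vge)
  thus ?thesis using assms(2) by blast
qed

lemma act_A_dvd:
  assumes "z \<in> A" "int p dvd n" "vge n \<alpha>"
  shows "vge (n + b + 1) (act z \<alpha>)"
proof -
  have "\<forall>\<alpha>. vge n \<alpha> \<longrightarrow> vge (n + b + 1) (act z \<alpha>)"
  proof (rule aug_ideal_induct[OF assms(1)])
    fix g assume g: "g \<in> carrier \<Gamma>"
    show "\<forall>\<alpha>. vge n \<alpha> \<longrightarrow> vge (n + b + 1) (act (group_ring_of g \<ominus>\<^bsub>RG\<^esub> \<one>\<^bsub>RG\<^esub>) \<alpha>)"
    proof (intro allI impI)
      fix \<alpha> assume \<alpha>: "vge n \<alpha>"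
      show "vge (n + b + 1) (act (group_ring_of g \<ominus>\<^bsub>RG\<^esub> \<one>\<^bsub>RG\<^esub>) \<alpha>)"
      proof (cases "vge (n + 1) \<alpha>")
        case True
        have "vge (n + 1 + b) (g \<alpha> - \<alpha>)" by (rule raise_b[OF g True])
        thus ?thesis unfolding act_gen[OF g] by (rule vge_mono) simp
      next
        case False
        from raise_dvd[OF g vge_imp_veq[OF \<alpha> False] assms(2)] show ?thesis unfolding act_gen[OF g] .
      qed
    qed
  qed (auto simp: act_plus act_mult intro: vge_add act_vge)
  thus ?thesis using assms(3) by blast
qed

lemma act_Apow:
  assumes "z \<in> Apow k" "vge n \<alpha>"
  shows "vge (n + int k * b) (act z \<alpha>)"
  using assms
proof (induction k arbitrary: z n \<alpha>)
  case 0 thus ?case by (simp add: Apow_0 act_vge)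
next
  case (Suc k)
  from Suc.prems(1) have "z \<in> Apow k \<cdot>\<^bsub>RG\<^esub> A" by (simp add: Apow_Suc)
  thus ?case
  proof (induction rule: ideal_prod.induct)
    case (prod i j)
    from Suc.IH[OF prod(1) act_A[OF prod(2) Suc.prems(2)]] show ?case
      using act_mult[OF A_carrier[OF prod(2)], of i \<alpha>] by (simp add: algebra_simps)
  next
    case (sum s1 s2) thus ?case by (simp add: RG_add act_plus vge_add)
  qed
qed

text \<open>
  A product of \<open>p\<close> elements of the augmentation ideal raises \<open>\<rho>\<close> by \<open>p b\<close>, and once more: after
  \<open>p - 1\<close> factors the value is \<open>p b\<close>, a multiple of \<open>p\<close>, so the last factor raises by more than \<open>b\<close>.
\<close>

lemma act_I:
  assumes z: "z \<in> I" and \<alpha>: "vge b \<alpha>"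
  shows "vge (int p * b + b + 1) (act z \<alpha>)"
proof -
  have "z \<in> Apow (p - 1) \<cdot>\<^bsub>RG\<^esub> A" using z Apow_Suc[of "p - 1"] p_gt_1 by simp
  thus ?thesis
  proof (induction rule: ideal_prod.induct)
    case (prod i j)
    have "b + int (p - 1) * b = int p * b" using p_gt_1 by (simp add: of_nat_diff algebra_simps)
    hence "vge (int p * b) (act i \<alpha>)" using act_Apow[OF prod(1) \<alpha>] by simp
    hence "vge (int p * b + b + 1) (act j (act i \<alpha>))" by (intro act_A_dvd[OF prod(2)]) auto
    thus ?case using act_mult[OF Apow_carrier[OF prod(1)], of j \<alpha>] by (simp add: RG_mult_comm[of i j])
  next
    case (sum s1 s2) thus ?case by (simp add: RG_add act_plus vge_add)
  qed
qed

text \<open>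
  Truncated exponentiation is multiplication by the exponent to first order.
\<close>

lemma act_te_linear:
  assumes x: "x \<in> carrier M" and a: "a \<in> OT" and m: "vge m (act (x \<ominus>\<^bsub>RG\<^esub> \<one>\<^bsub>RG\<^esub>) \<alpha>)"
  shows "vge (m + b) (act (te x a) \<alpha> - \<alpha> - a * act (x \<ominus>\<^bsub>RG\<^esub> \<one>\<^bsub>RG\<^esub>) \<alpha>)"
proof -
  let ?s = "x \<ominus>\<^bsub>RG\<^esub> \<one>\<^bsub>RG\<^esub>"
  have sA: "?s \<in> A" using x by (simp add: carrier_M)
  have s: "?s \<in> carrier RG" by (rule A_carrier[OF sA])
  have pow: "vge (m + b) ((act ?s ^^ Suc (Suc i)) \<alpha>)" for i
  proof (induction i)
    case 0 show ?case using act_A[OF sA m] by simp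
  next
    case (Suc i)
    have "vge (m + b + b) (act ?s ((act ?s ^^ Suc (Suc i)) \<alpha>))" by (rule act_A[OF sA Suc])
    hence "vge (m + b) (act ?s ((act ?s ^^ Suc (Suc i)) \<alpha>))" by (rule vge_mono) (use b_ge_1 in simp)
    thus ?case by simp
  qed
  have "act (te x a) \<alpha> = (\<Sum>i<p. (a gchoose i) * (act ?s ^^ i) \<alpha>)"
    unfolding trunc_exp_def act_lincomb act_power[OF s] ..
  also have "{..<p} = insert 0 (insert 1 {2..<p})" using p_gt_1 by auto
  finally have "act (te x a) \<alpha> = \<alpha> + (a * act ?s \<alpha> + (\<Sum>i=2..<p. (a gchoose i) * (act ?s ^^ i) \<alpha>))"
    by simp
  moreover have "vge (m + b) (\<Sum>i=2..<p. (a gchoose i) * (act ?s ^^ i) \<alpha>)"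
  proof (rule vge_sum)
    fix i assume i: "i \<in> {2..<p}"
    have "vge 0 (a gchoose i)" using i by (intro OT_int binom_R a) auto
    moreover have "vge (m + b) ((act ?s ^^ i) \<alpha>)" using pow[of "i - 2"] i by (simp add: numeral_2_eq_2 Suc_diff_Suc del: funpow.simps)
    ultimately show "vge (m + b) ((a gchoose i) * (act ?s ^^ i) \<alpha>)" by (rule vge_mult0)
  qed
  ultimately show ?thesis by simp
qed

definition sg :: "('a \<Rightarrow> 'a) \<Rightarrow> 'a" where "sg = group_ring_of \<sigma>"
definition th :: "('a \<Rightarrow> 'a) \<Rightarrow> 'a" where "th = group_ring_of \<gamma> \<otimes>\<^bsub>RG\<^esub> te (group_ring_of \<sigma>) \<omega>"

lemma sg_M: "sg \<in> carrier M"
  unfolding sg_def by (rule group_ring_of_M[OF \<sigma>(1)])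

lemma th_M: "th \<in> carrier M"
  unfolding th_def by (intro M_mult_closed te_M group_ring_of_M \<gamma> \<sigma>(1) \<omega>_OT)

lemma th_RG: "th \<in> carrier RG" and sg_RG: "sg \<in> carrier RG"
  using th_M sg_M M_RG by auto

lemma act_sg: "act (sg \<ominus>\<^bsub>RG\<^esub> \<one>\<^bsub>RG\<^esub>) \<alpha> = \<sigma> \<alpha> - \<alpha>"
  unfolding sg_def by (rule act_gen[OF \<sigma>(1)])

lemma act_th: "act (th \<ominus>\<^bsub>RG\<^esub> \<one>\<^bsub>RG\<^esub>) \<alpha> = D \<alpha>"
proof -
  have s: "sg \<ominus>\<^bsub>RG\<^esub> \<one>\<^bsub>RG\<^esub> \<in> carrier RG" using sg_RG by simp
  have "act (sg \<ominus>\<^bsub>RG\<^esub> \<one>\<^bsub>RG\<^esub>) = (\<lambda>x. \<sigma> x - x)" by (rule ext) (rule act_sg)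
  hence "act (te sg \<omega>) \<alpha> = sexp \<omega> \<alpha>"
    by (simp add: trunc_exp_def act_lincomb act_power[OF s] sexp_def Y_def)
  moreover have "act th \<alpha> = \<gamma> (act (te sg \<omega>) \<alpha>)"
    unfolding th_def sg_def[symmetric] using te_closed[OF sg_RG \<omega>_OT] by (simp add: act_mult act_of[OF \<gamma>])
  ultimately show ?thesis by (simp add: RG_minus act_minus act_one D_def \<Theta>_def)
qed

end

locale refined_setting_rho = refined_setting +
  fixes \<rho> :: 'a and b' :: int
  assumes \<rho>: "veq b \<rho>" and b': "veq (b + b') (D \<rho>)" "b < b'" "b' \<le> int p * b"
begin

abbreviation rindex where "rindex \<equiv> refined_index p OT \<Gamma> v \<rho>"
abbreviation F where "F \<equiv> refined_filtration p OT \<Gamma> v \<rho>"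

lemma rindex_ge:
  assumes "x \<in> carrier M" "vge n (act (x \<ominus>\<^bsub>RG\<^esub> \<one>\<^bsub>RG\<^esub>) \<rho>)"
  shows "ereal (of_int n) \<le> rindex (cl x)"
proof -
  have "v (act (x \<ominus>\<^bsub>RG\<^esub> \<one>\<^bsub>RG\<^esub>) \<rho>) \<le> rindex (cl x)"
    unfolding refined_index_def by (rule Sup_upper) (use assms(1) in blast)
  thus ?thesis using assms(2) unfolding vge_def by (rule order_trans[rotated])
qed

lemma rindex_less:
  assumes "\<And>x. x \<in> carrier M \<Longrightarrow> cl x = C \<Longrightarrow> veq n (act (x \<ominus>\<^bsub>RG\<^esub> \<one>\<^bsub>RG\<^esub>) \<rho>)" and "n < m"
  shows "\<not> ereal (of_int m) \<le> rindex C"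
proof -
  have "rindex C \<le> ereal (of_int n)"
    unfolding refined_index_def by (rule Sup_least) (use assms(1) in \<open>auto simp: veq_def\<close>)
  also have "\<dots> < ereal (of_int m)" using assms(2) by simp
  finally show ?thesis by (simp add: not_le)
qed

lemma F_iff: "C \<in> F j \<longleftrightarrow> C \<in> refined_group p OT \<Gamma> \<and> ereal (of_int (b + j)) \<le> rindex C"
  using \<rho> by (simp add: refined_filtration_def veq_def)

lemma refined_group_eq: "refined_group p OT \<Gamma> = span {cl th, cl sg}"
  unfolding th_def sg_def by (rule refined_group_generators[OF \<gamma> \<sigma>(1) generators \<omega>_OT])

lemma refined_group_elem:
  assumes "C \<in> refined_group p OT \<Gamma>"
  obtains a c where "a \<in> OT" "c \<in> OT" "C = cl (te th a \<otimes>\<^bsub>RG\<^esub> te sg c)"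
  using assms unfolding refined_group_eq span_pair[OF th_M sg_M] by blast

lemma act_cong_I:
  assumes x: "x \<in> carrier M" and u: "u \<in> carrier M" and eq: "cl x = cl u"
  shows "vge (int p * b + b + 1) (act (x \<ominus>\<^bsub>RG\<^esub> \<one>\<^bsub>RG\<^esub>) \<rho> - (act u \<rho> - \<rho>))"
proof -
  have "(\<lambda>g. x g - u g) \<in> I" using eq cl_eq_iff[OF x u] by (simp add: eqI_def)
  from act_I[OF this veq_vge[OF \<rho>]] show ?thesis by (simp add: RG_minus act_minus act_one)
qed

text \<open>
  The contribution of \<open>\<Theta>\<close> is absorbed in the error because \<open>D\<close> raises \<open>\<rho>\<close> by more than \<open>b\<close>.
\<close>

lemma representative_linear:
  assumes x: "x \<in> carrier M" and ac: "a \<in> OT" "c \<in> OT" and eq: "cl x = cl (te th a \<otimes>\<^bsub>RG\<^esub> te sg c)"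
  shows "vge (2 * b + 1) (act (x \<ominus>\<^bsub>RG\<^esub> \<one>\<^bsub>RG\<^esub>) \<rho> - c * (\<sigma> \<rho> - \<rho>))"
proof -
  have uM: "te th a \<otimes>\<^bsub>RG\<^esub> te sg c \<in> carrier M" using ac by (intro M_mult_closed te_M th_M sg_M)
  have Yr: "vge (b + b) (\<sigma> \<rho> - \<rho>)" by (rule raise_b_veq[OF \<sigma>(1) \<rho>])
  have Dr: "vge (2 * b + 1) (D \<rho>)" by (rule vge_mono[OF veq_vge[OF b'(1)]]) (use b'(2) in simp)
  have b1: "2 * b + 1 \<le> b + b + b" using b_ge_1 by simp
  define w where "w = act (te sg c) \<rho> - \<rho>"
  have "vge (b + b + b) (act (te sg c) \<rho> - \<rho> - c * (\<sigma> \<rho> - \<rho>))"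
    using act_te_linear[OF sg_M ac(2), of "b + b" \<rho>] Yr by (simp add: act_sg)
  hence w1: "vge (2 * b + 1) (w - c * (\<sigma> \<rho> - \<rho>))" unfolding w_def by (rule vge_mono[OF _ b1])
  have "vge (b + b) (c * (\<sigma> \<rho> - \<rho>))" by (rule vge_mult0[OF OT_int[OF ac(2)] Yr])
  hence w2: "vge (b + b) w" using vge_add[OF _ vge_mono[OF w1, of "b + b"]] by fastforce
  have tA: "te th a \<ominus>\<^bsub>RG\<^esub> \<one>\<^bsub>RG\<^esub> \<in> A" using te_M[OF th_M ac(1)] by (simp add: carrier_M)
  have "vge (b + b + b) (act (te th a \<ominus>\<^bsub>RG\<^esub> \<one>\<^bsub>RG\<^esub>) w)" by (rule act_A[OF tA w2])
  hence t1: "vge (2 * b + 1) (act (te th a) w - w)"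
    unfolding RG_minus[OF RG.one_closed] act_minus act_one by (rule vge_mono[OF _ b1])
  have "vge (2 * b + 1 + b) (act (te th a) \<rho> - \<rho> - a * D \<rho>)"
    using act_te_linear[OF th_M ac(1), of "2 * b + 1" \<rho>] Dr by (simp add: act_th)
  hence "vge (2 * b + 1) (act (te th a) \<rho> - \<rho> - a * D \<rho>)" by (rule vge_mono) (use b_ge_1 in simp)
  from vge_add[OF this vge_mult0[OF OT_int[OF ac(1)] Dr]]
  have t2: "vge (2 * b + 1) (act (te th a) \<rho> - \<rho>)" by simp
  have "act (te th a \<otimes>\<^bsub>RG\<^esub> te sg c) \<rho> = act (te th a) (w + \<rho>)"
    using te_closed[OF sg_RG ac(2)] by (simp add: act_mult w_def)
  also have "\<dots> = act (te th a) w + act (te th a) \<rho>"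
    using te_closed[OF th_RG ac(1)] by (simp add: group_ring_act_def aut_add distrib_left sum.distrib)
  finally have u: "act (te th a \<otimes>\<^bsub>RG\<^esub> te sg c) \<rho> - \<rho> - c * (\<sigma> \<rho> - \<rho>) =
      (act (te th a) w - w) + (act (te th a) \<rho> - \<rho>) + (w - c * (\<sigma> \<rho> - \<rho>))" by simp
  have 1: "vge (2 * b + 1) (act (te th a \<otimes>\<^bsub>RG\<^esub> te sg c) \<rho> - \<rho> - c * (\<sigma> \<rho> - \<rho>))"
    unfolding u by (rule vge_add[OF vge_add[OF t1 t2] w1])
  have "1 * b \<le> int p * b" using p_gt_1 b_ge_1 by (intro mult_right_mono) auto
  hence 2: "vge (2 * b + 1) (act (x \<ominus>\<^bsub>RG\<^esub> \<one>\<^bsub>RG\<^esub>) \<rho> - (act (te th a \<otimes>\<^bsub>RG\<^esub> te sg c) \<rho> - \<rho>))"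
    by (intro vge_mono[OF act_cong_I[OF x uM eq]]) simp
  from vge_add[OF 2 1] show ?thesis by simp
qed

text \<open>
  Every representative of the class moves \<open>\<rho>\<close> by \<open>c (\<sigma> - 1) \<rho>\<close> to leading order.
\<close>

lemma rindex_transversal:
  assumes ac: "a \<in> OT" "c \<in> OT" and c: "veq 0 c" and m: "b < j"
  shows "cl (te th a \<otimes>\<^bsub>RG\<^esub> te sg c) \<notin> F j"
proof
  assume "cl (te th a \<otimes>\<^bsub>RG\<^esub> te sg c) \<in> F j"
  hence "ereal (of_int (b + j)) \<le> rindex (cl (te th a \<otimes>\<^bsub>RG\<^esub> te sg c))" by (simp only: F_iff)
  moreover have "\<not> ereal (of_int (b + j)) \<le> rindex (cl (te th a \<otimes>\<^bsub>RG\<^esub> te sg c))"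
  proof (rule rindex_less)
    fix x assume x: "x \<in> carrier M" "cl x = cl (te th a \<otimes>\<^bsub>RG\<^esub> te sg c)"
    have "veq (0 + (b + b)) (c * (\<sigma> \<rho> - \<rho>))"
      by (rule veq_mult[OF c raise_not_dvd[OF \<sigma> \<rho> not_dvd_b]])
    hence "veq (2 * b) (c * (\<sigma> \<rho> - \<rho>))" by simp
    thus "veq (2 * b) (act (x \<ominus>\<^bsub>RG\<^esub> \<one>\<^bsub>RG\<^esub>) \<rho>)" by (rule veq_cong[OF _ representative_linear[OF x(1) ac x(2)]])
  qed (use m in simp)
  ultimately show False by blast
qed

lemma OT_cases: assumes "x \<in> OT" obtains "veq 0 x" | y where "y \<in> OT" "x = of_nat p * y"
  using OT_p[OF assms] vge_imp_veq[OF OT_int[OF assms]] by auto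

lemma act_te_th: assumes a: "a \<in> OT" shows "vge (b + b' + 1) (act (te th a \<ominus>\<^bsub>RG\<^esub> \<one>\<^bsub>RG\<^esub>) \<rho> - a * D \<rho>)"
proof -
  have "vge (b + b' + b) (act (te th a) \<rho> - \<rho> - a * D \<rho>)"
    using act_te_linear[OF th_M a, of "b + b'" \<rho>] veq_vge[OF b'(1)] by (simp add: act_th)
  hence "vge (b + b' + 1) (act (te th a) \<rho> - \<rho> - a * D \<rho>)" by (rule vge_mono) (use b_ge_1 in simp)
  thus ?thesis unfolding RG_minus[OF RG.one_closed] act_minus act_one .
qed

text \<open>
  Every representative of the class moves \<open>\<rho>\<close> by \<open>a D \<rho>\<close> to leading order, since \<open>b' \<le> p b\<close> is below the
  indeterminacy \<open>act_cong_I\<close>.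
\<close>

lemma rindex_line:
  assumes a: "a \<in> OT" and a0: "veq 0 a" and j: "b' < j"
  shows "cl (te th a) \<notin> F j"
proof
  assume "cl (te th a) \<in> F j"
  hence "ereal (of_int (b + j)) \<le> rindex (cl (te th a))" by (simp only: F_iff)
  moreover have "\<not> ereal (of_int (b + j)) \<le> rindex (cl (te th a))"
  proof (rule rindex_less)
    fix x assume x: "x \<in> carrier M" "cl x = cl (te th a)"
    have "veq (0 + (b + b')) (a * D \<rho>)" by (rule veq_mult[OF a0 b'(1)])
    hence 1: "veq (b + b') (a * D \<rho>)" by simp
    have "vge (b + b' + 1) (act (x \<ominus>\<^bsub>RG\<^esub> \<one>\<^bsub>RG\<^esub>) \<rho> - (act (te th a) \<rho> - \<rho>))"
      by (rule vge_mono[OF act_cong_I[OF x(1) te_M[OF th_M a] x(2)]]) (use b'(3) in simp)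
    moreover have "vge (b + b' + 1) (act (te th a) \<rho> - \<rho> - a * D \<rho>)"
      using act_te_th[OF a] by (simp only: RG_minus[OF RG.one_closed] act_minus act_one)
    ultimately have "vge (b + b' + 1) ((act (x \<ominus>\<^bsub>RG\<^esub> \<one>\<^bsub>RG\<^esub>) \<rho> - (act (te th a) \<rho> - \<rho>)) +
        (act (te th a) \<rho> - \<rho> - a * D \<rho>))" by (rule vge_add)
    moreover have "t - (u - r) + (u - r - d) = t - d" for t u r d :: 'a by simp
    ultimately have "vge (b + b' + 1) (act (x \<ominus>\<^bsub>RG\<^esub> \<one>\<^bsub>RG\<^esub>) \<rho> - a * D \<rho>)" by (simp only:)
    thus "veq (b + b') (act (x \<ominus>\<^bsub>RG\<^esub> \<one>\<^bsub>RG\<^esub>) \<rho>)" by (rule veq_cong[OF 1])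
  qed (use j in simp)
  ultimately show False by blast
qed

lemma F_antimono: "i \<le> j \<Longrightarrow> F j \<subseteq> F i"
  unfolding F_iff subset_iff by (auto elim: order_trans[rotated])

lemma th_line_subset: "span {cl th} \<subseteq> refined_group p OT \<Gamma>"
  unfolding refined_group_eq
  by (rule span_mono_span) (use span_incl[of "{cl th, cl sg}"] th_M sg_M in \<open>auto intro: cl_in\<close>)

lemma F_low: assumes "j \<le> b" shows "F j = span {cl th, cl sg}"
proof -
  have "C \<in> F j" if C: "C \<in> refined_group p OT \<Gamma>" for C
  proof -
    obtain a c where ac: "a \<in> OT" "c \<in> OT" "C = cl (te th a \<otimes>\<^bsub>RG\<^esub> te sg c)"
      using refined_group_elem[OF C] .
    have x: "te th a \<otimes>\<^bsub>RG\<^esub> te sg c \<in> carrier M" using ac by (intro M_mult_closed te_M th_M sg_M)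
    hence "te th a \<otimes>\<^bsub>RG\<^esub> te sg c \<ominus>\<^bsub>RG\<^esub> \<one>\<^bsub>RG\<^esub> \<in> A" by (simp add: carrier_M)
    from act_A[OF this veq_vge[OF \<rho>]]
    have "vge (b + j) (act (te th a \<otimes>\<^bsub>RG\<^esub> te sg c \<ominus>\<^bsub>RG\<^esub> \<one>\<^bsub>RG\<^esub>) \<rho>)"
      by (rule vge_mono) (use assms in simp)
    from rindex_ge[OF x this] show ?thesis using C by (simp add: F_iff ac(3))
  qed
  thus ?thesis unfolding refined_group_eq[symmetric] by (auto simp: F_iff)
qed

lemma F_mid: assumes j: "b < j" "j \<le> b'" shows "F j = span {cl th}"
proof
  show "F j \<subseteq> span {cl th}"
  proof
    fix C assume C: "C \<in> F j"
    hence "C \<in> refined_group p OT \<Gamma>" by (simp add: F_iff)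
    then obtain a c where ac: "a \<in> OT" "c \<in> OT" "C = cl (te th a \<otimes>\<^bsub>RG\<^esub> te sg c)"
      using refined_group_elem by blast
    show "C \<in> span {cl th}"
    proof (rule OT_cases[OF ac(2)])
      assume "veq 0 c"
      thus ?thesis using rindex_transversal[OF ac(1,2) _ j(1)] C ac(3) by blast
    next
      fix y assume y: "y \<in> OT" "c = of_nat p * y"
      have "eqI (te th a \<otimes>\<^bsub>RG\<^esub> te sg c) (te th a \<otimes>\<^bsub>RG\<^esub> \<one>\<^bsub>RG\<^esub>)"
        unfolding y(2) by (intro eqI_mult eqI_refl te_p_mult sg_M y te_closed th_RG ac(1) sg_RG R_mult R_of_nat)
      hence "C = cl (te th a)"
        using cl_eq_iff[of "te th a \<otimes>\<^bsub>RG\<^esub> te sg c" "te th a"] ac te_M[OF th_M ac(1)] te_M[OF sg_M ac(2)]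
          te_closed[OF th_RG ac(1)] by (simp add: M_mult_closed)
      thus ?thesis unfolding span_single[OF th_M] using ac(1) by blast
    qed
  qed
  show "span {cl th} \<subseteq> F j"
  proof
    fix C assume C: "C \<in> span {cl th}"
    then obtain a where a: "a \<in> OT" "C = cl (te th a)" unfolding span_single[OF th_M] by blast
    have "vge (b + b') (a * D \<rho>)" by (rule vge_mult0[OF OT_int[OF a(1)] veq_vge[OF b'(1)]])
    from vge_add[OF this vge_mono[OF act_te_th[OF a(1)]]]
    have "vge (b + b') (act (te th a \<ominus>\<^bsub>RG\<^esub> \<one>\<^bsub>RG\<^esub>) \<rho>)" by simp
    hence "vge (b + j) (act (te th a \<ominus>\<^bsub>RG\<^esub> \<one>\<^bsub>RG\<^esub>) \<rho>)" by (rule vge_mono) (use j in simp)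
    from rindex_ge[OF te_M[OF th_M a(1)] this] show "C \<in> F j"
      using C th_line_subset by (auto simp: F_iff a(2))
  qed
qed

lemma F_high: assumes j: "b' < j" shows "F j = {\<one>\<^bsub>TG\<^esub>}"
proof
  show "F j \<subseteq> {\<one>\<^bsub>TG\<^esub>}"
  proof
    fix C assume C: "C \<in> F j"
    hence "C \<in> F b'" using F_antimono[of b' j] j by auto
    then obtain a where a: "a \<in> OT" "C = cl (te th a)"
      unfolding F_mid[OF b'(2) order_refl] span_single[OF th_M] by blast
    show "C \<in> {\<one>\<^bsub>TG\<^esub>}"
    proof (rule OT_cases[OF a(1)])
      assume "veq 0 a"
      thus ?thesis using rindex_line[OF a(1) _ j] C a(2) by blast
    next
      fix y assume y: "y \<in> OT" "a = of_nat p * y"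
      have "eqI (te th a) \<one>\<^bsub>RG\<^esub>" unfolding y(2) by (rule te_p_mult[OF th_M y(1)])
      hence "C = cl \<one>\<^bsub>RG\<^esub>" using cl_eq_iff[OF te_M[OF th_M a(1)] M.one_closed] a(2) by (simp add: M_one)
      thus ?thesis by (simp add: cl_one)
    qed
  qed
  have "\<one>\<^bsub>TG\<^esub> \<in> refined_group p OT \<Gamma>"
    unfolding refined_group_eq
    by (rule subgroup.one_closed[OF span_subgroup]) (use th_M sg_M in \<open>auto intro: cl_in\<close>)
  moreover have "ereal (of_int (b + j)) \<le> rindex (cl \<one>\<^bsub>RG\<^esub>)"
    by (rule rindex_ge) (use M.one_closed in \<open>simp_all add: M_one RG_minus group_ring_act_def\<close>)
  ultimately show "{\<one>\<^bsub>TG\<^esub>} \<subseteq> F j" by (simp add: F_iff cl_one)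
qed

lemma F_strict_b: "F (b + 1) \<subset> F b"
proof -
  have "cl sg = cl (te th 0 \<otimes>\<^bsub>RG\<^esub> te sg 1)" using sg_RG th_RG by (simp add: te_0 te_1)
  hence "cl sg \<notin> F (b + 1)" using rindex_transversal[OF R_0 R_1] by simp
  moreover have "cl sg \<in> F b" unfolding F_low[OF order_refl] using span_incl[of "{cl th, cl sg}"] by blast
  ultimately show ?thesis using F_antimono[of b "b + 1"] by auto
qed

lemma F_strict_b': "F (b' + 1) \<subset> F b'"
proof -
  have "cl th = cl (te th 1)" using th_RG by (simp add: te_1)
  hence "cl th \<notin> F (b' + 1)" using rindex_line[OF R_1] by simp
  moreover have "cl th \<in> F b'"
    unfolding F_mid[OF b'(2) order_refl] using span_incl[of "{cl th}"] by blast
  ultimately show ?thesis using F_antimono[of b' "b' + 1"] by auto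
qed

lemma breaks: "refined_breaks p OT \<Gamma> v \<rho> = {b, b'}"
proof -
  have "F (j + 1) \<subset> F j \<longleftrightarrow> j = b \<or> j = b'" for j
  proof -
    consider "j < b" | "j = b" | "b < j" "j < b'" | "j = b'" | "b' < j" by linarith
    thus ?thesis
    proof cases
      case 1 thus ?thesis using F_low[of j] F_low[of "j + 1"] b'(2) by simp
    next
      case 3 thus ?thesis using F_mid[of j] F_mid[of "j + 1"] by simp
    next
      case 5 thus ?thesis using F_high[of j] F_high[of "j + 1"] b'(2) by simp
    qed (use F_strict_b F_strict_b' in auto)
  qed
  thus ?thesis by (auto simp: refined_breaks_def)
qed

end

section \<open>The augmentation ideal over a complete valuation ring\<close>

locale complete_group_algebra =
  group_algebra G R + padic_valued v p e
  for G :: "('g, 'm) monoid_scheme" (structure) and R :: "'a::field_char_0 set"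
    and v :: "'a \<Rightarrow> ereal" and p :: nat and e :: int +
  fixes T :: "'a set"
  assumes T: "is_subfield T" "vcomplete T"
    and R_eq: "R = {x \<in> T. vge 0 x}"
    and exponent: "\<And>g. g \<in> carrier G \<Longrightarrow> g [^] p = \<one>"
begin

lemma R_iff: "x \<in> R \<longleftrightarrow> x \<in> T \<and> vge 0 x"
  using R_eq by blast

lemma RG_vge: "x \<in> carrier RG \<Longrightarrow> vge 0 (x g)"
  using RG_in[of x g] by (simp add: R_iff)

lemma vge_mult_coord:
  fixes z :: "'g \<Rightarrow> 'a"
  assumes x: "x \<in> carrier RG" and z: "\<And>g. vge n (z g)"
  shows "vge n ((x \<otimes>\<^bsub>RG\<^esub> z) g)"
proof (cases "g \<in> carrier G")
  case True
  have "vge n (\<Sum>h\<in>carrier G. x h * z (inv h \<otimes> g))"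
    by (rule vge_sum) (rule vge_mult0[OF RG_vge[OF x] z])
  thus ?thesis using True by (simp add: RG_mult)
qed (simp add: RG_mult)

text \<open>
  The powers of \<open>u\<close> tend to \<open>0\<close>, so the geometric series converges in the group ring.
\<close>

lemma geometric_inverse:
  assumes u: "u \<in> carrier RG" and w: "w \<in> carrier RG"
    and up: "u [^]\<^bsub>RG\<^esub> p = smult (of_nat p) w"
  shows "\<exists>y\<in>carrier RG. (\<one>\<^bsub>RG\<^esub> \<ominus>\<^bsub>RG\<^esub> u) \<otimes>\<^bsub>RG\<^esub> y = \<one>\<^bsub>RG\<^esub>"
proof -
  have pow: "u [^]\<^bsub>RG\<^esub> (p * n) = smult (of_nat p ^ n) (w [^]\<^bsub>RG\<^esub> n)" for n
  proof (induction n)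
    case 0 show ?case by (simp add: smult_def)
  next
    case (Suc n)
    have "u [^]\<^bsub>RG\<^esub> (p * Suc n) = u [^]\<^bsub>RG\<^esub> (p * n) \<otimes>\<^bsub>RG\<^esub> u [^]\<^bsub>RG\<^esub> p"
      using RG.nat_pow_mult[OF u, of "p * n" p] by (simp add: add.commute)
    thus ?case by (simp add: Suc up smult_mult mult_smult) (simp add: smult_def mult_ac)
  qed
  have small: "vge (int n) ((u [^]\<^bsub>RG\<^esub> (p * n + j)) g)" for n j g
  proof -
    have "u [^]\<^bsub>RG\<^esub> (p * n + j) = smult (of_nat p ^ n) (w [^]\<^bsub>RG\<^esub> n \<otimes>\<^bsub>RG\<^esub> u [^]\<^bsub>RG\<^esub> j)"
      using RG.nat_pow_mult[OF u, of "p * n" j] by (simp add: pow smult_mult)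
    moreover have "vge (int n * 1) (of_nat p ^ n)" by (rule vge_power[OF vge_p])
    moreover have "vge 0 ((w [^]\<^bsub>RG\<^esub> n \<otimes>\<^bsub>RG\<^esub> u [^]\<^bsub>RG\<^esub> j) g)" by (rule RG_vge) (simp add: u w)
    ultimately show ?thesis using vge_mult[of "int n" "of_nat p ^ n" 0] by (simp add: smult_def)
  qed
  define s where "s = (\<lambda>(n::nat) g. \<Sum>i<n. (u [^]\<^bsub>RG\<^esub> i) g)"
  have sT: "s n g \<in> T" for n g
  proof -
    have "(u [^]\<^bsub>RG\<^esub> i) g \<in> T" for i :: nat using RG_in[OF RG.nat_pow_closed[OF u]] by (simp add: R_iff)
    thus ?thesis unfolding s_def by (intro is_subfield_sum[OF T(1)])
  qed
  have step: "vge (int n) (s (p * Suc n) g - s (p * n) g)" for n g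
  proof -
    have "s (p * n + k) g = s (p * n) g + (\<Sum>j<k. (u [^]\<^bsub>RG\<^esub> (p * n + j)) g)" for k
      by (induction k) (simp_all add: s_def)
    from this[of p] have "s (p * Suc n) g = s (p * n) g + (\<Sum>j<p. (u [^]\<^bsub>RG\<^esub> (p * n + j)) g)"
      by (simp add: add.commute)
    moreover have "vge (int n) (\<Sum>j<p. (u [^]\<^bsub>RG\<^esub> (p * n + j)) g)" by (rule vge_sum) (rule small)
    ultimately show ?thesis by simp
  qed
  have "\<exists>l. l \<in> T \<and> (\<forall>n. vge (int n) (s (p * n) g - l))" for g
    by (rule vcomplete_geometric[OF T(2), of "\<lambda>n. s (p * n) g", OF sT step]) blast
  then obtain l where l: "\<And>g. l g \<in> T" "\<And>g n. vge (int n) (s (p * n) g - l g)" by metis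
  define y where "y = (\<lambda>g. if g \<in> carrier G then l g else 0)"
  have y: "y \<in> carrier RG"
  proof (rule RG_I)
    fix g assume "g \<in> carrier G"
    thus "y g \<in> R" using l(1)[of g] l(2)[of 0 g] by (simp add: y_def R_iff s_def)
  qed (simp add: y_def)
  have s_RG: "s n \<in> carrier RG" for n
    using RG_lincomb[of "{..<n}" "\<lambda>_. 1" "\<lambda>i. u [^]\<^bsub>RG\<^esub> i"] u by (simp add: s_def R_1)
  have sy: "vge (int n) (y g - s (p * n) g)" for n g
    using l(2)[of n g] RG_out[OF s_RG, of g "p * n"]
    by (cases "g \<in> carrier G") (simp_all add: y_def vge_minus_commute)
  let ?d = "\<one>\<^bsub>RG\<^esub> \<ominus>\<^bsub>RG\<^esub> u"
  have d: "?d \<in> carrier RG" using u by simp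
  have telescope: "(?d \<otimes>\<^bsub>RG\<^esub> s n) g = \<one>\<^bsub>RG\<^esub> g - (u [^]\<^bsub>RG\<^esub> n) g" for n g
  proof -
    have "(?d \<otimes>\<^bsub>RG\<^esub> u [^]\<^bsub>RG\<^esub> i) g = (u [^]\<^bsub>RG\<^esub> i) g - (u [^]\<^bsub>RG\<^esub> Suc i) g" for i
    proof -
      have "?d \<otimes>\<^bsub>RG\<^esub> u [^]\<^bsub>RG\<^esub> i = u [^]\<^bsub>RG\<^esub> i \<ominus>\<^bsub>RG\<^esub> u [^]\<^bsub>RG\<^esub> Suc i"
        using u by (simp add: a_minus_def RG.l_distr RG.l_minus RG_mult_comm[of u])
      also have "\<dots> = (\<lambda>g. (u [^]\<^bsub>RG\<^esub> i) g - (u [^]\<^bsub>RG\<^esub> Suc i) g)"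
        by (rule RG_minus) (simp add: u)
      finally show ?thesis by simp
    qed
    hence "(\<Sum>i<n. (?d \<otimes>\<^bsub>RG\<^esub> u [^]\<^bsub>RG\<^esub> i) g) = \<one>\<^bsub>RG\<^esub> g - (u [^]\<^bsub>RG\<^esub> n) g"
      by (induction n) simp_all
    thus ?thesis unfolding s_def mult_sum .
  qed
  have "?d \<otimes>\<^bsub>RG\<^esub> y = \<one>\<^bsub>RG\<^esub>"
  proof
    fix g
    have "vge (int n) ((?d \<otimes>\<^bsub>RG\<^esub> y) g - \<one>\<^bsub>RG\<^esub> g)" for n
    proof -
      have "?d \<otimes>\<^bsub>RG\<^esub> y = ?d \<otimes>\<^bsub>RG\<^esub> (s (p * n) \<oplus>\<^bsub>RG\<^esub> (\<lambda>g. y g - s (p * n) g))"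
        by (simp add: RG_add)
      also have "\<dots> = ?d \<otimes>\<^bsub>RG\<^esub> s (p * n) \<oplus>\<^bsub>RG\<^esub> ?d \<otimes>\<^bsub>RG\<^esub> (\<lambda>g. y g - s (p * n) g)"
        using RG.minus_closed[OF y s_RG[of "p * n"]] unfolding RG_minus[OF s_RG]
        by (intro RG.r_distr d s_RG)
      finally have "(?d \<otimes>\<^bsub>RG\<^esub> y) g - \<one>\<^bsub>RG\<^esub> g =
          (?d \<otimes>\<^bsub>RG\<^esub> (\<lambda>g. y g - s (p * n) g)) g - (u [^]\<^bsub>RG\<^esub> (p * n)) g"
        by (simp add: RG_add telescope)
      moreover have "vge (int n) ((?d \<otimes>\<^bsub>RG\<^esub> (\<lambda>g. y g - s (p * n) g)) g)"
        by (rule vge_mult_coord[OF d sy])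
      moreover have "vge (int n) ((u [^]\<^bsub>RG\<^esub> (p * n)) g)" using small[of n 0 g] by simp
      ultimately show ?thesis by (simp only: vge_diff)
    qed
    hence "(?d \<otimes>\<^bsub>RG\<^esub> y) g - \<one>\<^bsub>RG\<^esub> g = 0"
      by (intro vge_all_imp_0) (metis vge_mono int_nat_eq nat_le_iff linorder_le_cases)
    thus "(?d \<otimes>\<^bsub>RG\<^esub> y) g = \<one>\<^bsub>RG\<^esub> g" by simp
  qed
  thus ?thesis using y by blast
qed

text \<open>
  In \<open>(1 + s) ^ p = 1\<close> all terms except \<open>s ^ p\<close> are divisible by \<open>p\<close>.
\<close>

lemma gen_power_p:
  assumes g: "g \<in> carrier G"
  shows "\<exists>w\<in>carrier RG. (group_ring_of g \<ominus>\<^bsub>RG\<^esub> \<one>\<^bsub>RG\<^esub>) [^]\<^bsub>RG\<^esub> p = smult (of_nat p) w"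
proof -
  define s where "s = group_ring_of g \<ominus>\<^bsub>RG\<^esub> \<one>\<^bsub>RG\<^esub>"
  have s: "s \<in> carrier RG" using g group_ring_of_closed by (simp add: s_def)
  define c where "c = (\<lambda>i. - of_nat ((p choose i) div p) :: 'a)"
  have cp: "of_nat p * c i = - of_nat (p choose i)" if "i \<in> {1..<p}" for i
  proof -
    have "p dvd (p choose i)" using p that by (intro dvd_choose_prime) auto
    hence "of_nat (p * ((p choose i) div p)) = (of_nat (p choose i) :: 'a)" by simp
    thus ?thesis by (simp add: c_def)
  qed
  have p1: "1 < p" using prime_gt_1_nat[OF p] .
  have "\<one>\<^bsub>RG\<^esub> = group_ring_of g [^]\<^bsub>RG\<^esub> p"
    by (simp add: group_ring_of_pow[OF g] exponent[OF g] group_ring_of_one)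
  also have "\<dots> = (\<lambda>h. \<Sum>i<Suc p. of_nat (p choose i) * (s [^]\<^bsub>RG\<^esub> i) h)"
    unfolding s_def by (rule newton_RG[OF group_ring_of_closed[OF g]]) simp
  also have "{..<Suc p} = insert 0 (insert p {1..<p})" using p1 by auto
  finally have "\<one>\<^bsub>RG\<^esub> h = \<one>\<^bsub>RG\<^esub> h + ((s [^]\<^bsub>RG\<^esub> p) h + (\<Sum>i=1..<p. of_nat (p choose i) * (s [^]\<^bsub>RG\<^esub> i) h))" for h
    using p1 by (simp add: fun_eq_iff)
  hence "(s [^]\<^bsub>RG\<^esub> p) h = - (\<Sum>i=1..<p. of_nat (p choose i) * (s [^]\<^bsub>RG\<^esub> i) h)" for h
    by (simp add: eq_neg_iff_add_eq_0)
  also have "- (\<Sum>i=1..<p. of_nat (p choose i) * (s [^]\<^bsub>RG\<^esub> i) h) =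
      of_nat p * (\<Sum>i=1..<p. c i * (s [^]\<^bsub>RG\<^esub> i) h)" for h
    unfolding sum_distrib_left sum_negf[symmetric]
    by (rule sum.cong[OF refl]) (simp add: cp mult.assoc[symmetric])
  finally have "s [^]\<^bsub>RG\<^esub> p = smult (of_nat p) (\<lambda>h. \<Sum>i=1..<p. c i * (s [^]\<^bsub>RG\<^esub> i) h)"
    by (simp add: smult_def fun_eq_iff)
  moreover have "(\<lambda>h. \<Sum>i=1..<p. c i * (s [^]\<^bsub>RG\<^esub> i) h) \<in> carrier RG"
    using s by (intro RG_lincomb) (simp_all add: c_def R_uminus R_of_nat)
  ultimately show ?thesis unfolding s_def by blast
qed

text \<open>
  The augmentation ideal lies in the Jacobson radical.  The condition is put in the form
  \<open>\<one> + r z\<close> invertible for all \<open>r\<close> because that form is inherited by sums.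
\<close>

lemma aug_ideal_one_plus_invertible:
  assumes z: "z \<in> aug_ideal R G"
  shows "\<exists>y\<in>carrier RG. (\<one>\<^bsub>RG\<^esub> \<oplus>\<^bsub>RG\<^esub> z) \<otimes>\<^bsub>RG\<^esub> y = \<one>\<^bsub>RG\<^esub>"
proof -
  define Q where "Q = (\<lambda>z. z \<in> carrier RG \<and>
      (\<forall>r\<in>carrier RG. \<exists>y\<in>carrier RG. (\<one>\<^bsub>RG\<^esub> \<oplus>\<^bsub>RG\<^esub> r \<otimes>\<^bsub>RG\<^esub> z) \<otimes>\<^bsub>RG\<^esub> y = \<one>\<^bsub>RG\<^esub>))"
  have "Q z"
  proof (rule aug_ideal_induct[OF z])
    fix g assume g: "g \<in> carrier G"
    let ?s = "group_ring_of g \<ominus>\<^bsub>RG\<^esub> \<one>\<^bsub>RG\<^esub>"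
    have s: "?s \<in> carrier RG" using group_ring_of_closed[OF g] by simp
    obtain w where w: "w \<in> carrier RG" "?s [^]\<^bsub>RG\<^esub> p = smult (of_nat p) w" using gen_power_p[OF g] by blast
    show "Q ?s"
      unfolding Q_def
    proof (intro conjI ballI)
      show "?s \<in> carrier RG" by (rule s)
    next
      fix r assume r: "r \<in> carrier RG"
      let ?u = "(\<ominus>\<^bsub>RG\<^esub> r) \<otimes>\<^bsub>RG\<^esub> ?s"
      have "?u [^]\<^bsub>RG\<^esub> p = smult (of_nat p) ((\<ominus>\<^bsub>RG\<^esub> r) [^]\<^bsub>RG\<^esub> p \<otimes>\<^bsub>RG\<^esub> w)"
        using r s by (simp add: RG.nat_pow_distrib w(2) mult_smult)
      moreover have "?u \<in> carrier RG" "(\<ominus>\<^bsub>RG\<^esub> r) [^]\<^bsub>RG\<^esub> p \<otimes>\<^bsub>RG\<^esub> w \<in> carrier RG" using r s w by simp_all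
      ultimately have "\<exists>y\<in>carrier RG. (\<one>\<^bsub>RG\<^esub> \<ominus>\<^bsub>RG\<^esub> ?u) \<otimes>\<^bsub>RG\<^esub> y = \<one>\<^bsub>RG\<^esub>" by (intro geometric_inverse)
      moreover have "\<one>\<^bsub>RG\<^esub> \<ominus>\<^bsub>RG\<^esub> ?u = \<one>\<^bsub>RG\<^esub> \<oplus>\<^bsub>RG\<^esub> r \<otimes>\<^bsub>RG\<^esub> ?s"
        using r s by (simp add: a_minus_def RG.l_minus)
      ultimately show "\<exists>y\<in>carrier RG. (\<one>\<^bsub>RG\<^esub> \<oplus>\<^bsub>RG\<^esub> r \<otimes>\<^bsub>RG\<^esub> ?s) \<otimes>\<^bsub>RG\<^esub> y = \<one>\<^bsub>RG\<^esub>" by simp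
    qed
  next
    fix x y assume x: "Q x" and y: "Q y"
    have xy: "x \<in> carrier RG" "y \<in> carrier RG" using x y by (simp_all add: Q_def)
    have "Q (x \<oplus>\<^bsub>RG\<^esub> y)"
      unfolding Q_def
    proof (intro conjI ballI)
      fix r assume r: "r \<in> carrier RG"
      let ?U = "\<one>\<^bsub>RG\<^esub> \<oplus>\<^bsub>RG\<^esub> r \<otimes>\<^bsub>RG\<^esub> x"
      have U: "?U \<in> carrier RG" using r xy by simp
      obtain z1 where z1: "z1 \<in> carrier RG" "?U \<otimes>\<^bsub>RG\<^esub> z1 = \<one>\<^bsub>RG\<^esub>" using x r by (auto simp: Q_def)
      let ?V = "\<one>\<^bsub>RG\<^esub> \<oplus>\<^bsub>RG\<^esub> (z1 \<otimes>\<^bsub>RG\<^esub> r) \<otimes>\<^bsub>RG\<^esub> y"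
      have V: "?V \<in> carrier RG" using r z1 xy by simp
      have "z1 \<otimes>\<^bsub>RG\<^esub> r \<in> carrier RG" using z1 r by simp
      then obtain z2 where z2: "z2 \<in> carrier RG" "?V \<otimes>\<^bsub>RG\<^esub> z2 = \<one>\<^bsub>RG\<^esub>" using y unfolding Q_def by blast
      have "?U \<otimes>\<^bsub>RG\<^esub> ?V = ?U \<oplus>\<^bsub>RG\<^esub> (?U \<otimes>\<^bsub>RG\<^esub> z1) \<otimes>\<^bsub>RG\<^esub> (r \<otimes>\<^bsub>RG\<^esub> y)"
        using U z1(1) r xy by (simp add: RG.r_distr RG.m_assoc del: RG.l_distr)
      also have "\<dots> = \<one>\<^bsub>RG\<^esub> \<oplus>\<^bsub>RG\<^esub> r \<otimes>\<^bsub>RG\<^esub> (x \<oplus>\<^bsub>RG\<^esub> y)"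
        unfolding z1(2) using r xy by (simp add: RG.r_distr RG.a_assoc)
      finally have UV: "\<one>\<^bsub>RG\<^esub> \<oplus>\<^bsub>RG\<^esub> r \<otimes>\<^bsub>RG\<^esub> (x \<oplus>\<^bsub>RG\<^esub> y) = ?U \<otimes>\<^bsub>RG\<^esub> ?V" ..
      have "(?U \<otimes>\<^bsub>RG\<^esub> ?V) \<otimes>\<^bsub>RG\<^esub> (z2 \<otimes>\<^bsub>RG\<^esub> z1) = ?U \<otimes>\<^bsub>RG\<^esub> ((?V \<otimes>\<^bsub>RG\<^esub> z2) \<otimes>\<^bsub>RG\<^esub> z1)"
        by (simp only: RG_mult_assoc)
      also have "\<dots> = \<one>\<^bsub>RG\<^esub>" unfolding z2(2) RG.l_one[OF z1(1)] by (rule z1(2))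
      finally show "\<exists>y'\<in>carrier RG. (\<one>\<^bsub>RG\<^esub> \<oplus>\<^bsub>RG\<^esub> r \<otimes>\<^bsub>RG\<^esub> (x \<oplus>\<^bsub>RG\<^esub> y)) \<otimes>\<^bsub>RG\<^esub> y' = \<one>\<^bsub>RG\<^esub>"
        unfolding UV using RG.m_closed[OF z2(1) z1(1)] by blast
    qed (use xy in simp)
    thus "Q (\<lambda>g. x g + y g)" by (simp add: RG_add)
  next
    fix x y assume x: "x \<in> carrier RG" and y: "Q y"
    show "Q (x \<otimes>\<^bsub>RG\<^esub> y)"
      unfolding Q_def RG_mult_assoc[symmetric] using x y RG.m_closed[OF _ x] by (auto simp: Q_def)
  qed
  hence "z \<in> carrier RG" "\<exists>y\<in>carrier RG. (\<one>\<^bsub>RG\<^esub> \<oplus>\<^bsub>RG\<^esub> \<one>\<^bsub>RG\<^esub> \<otimes>\<^bsub>RG\<^esub> z) \<otimes>\<^bsub>RG\<^esub> y = \<one>\<^bsub>RG\<^esub>"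
    unfolding Q_def using RG.one_closed by blast+
  thus ?thesis by simp
qed

end

section \<open>The second refined break\<close>

lemma (in valued) v_greater_iff: "v x > ereal (of_int n) \<longleftrightarrow> vge (n + 1) x"
proof (cases "x = 0")
  case False
  then obtain m where m: "veq m x" using ex_veq by blast
  show ?thesis unfolding vge_veq_iff[OF m] using m by (simp add: veq_def) linarith
qed (use nv in \<open>simp add: normalized_valuation_def\<close>)

context ramified_pair
begin

text \<open>
  As \<open>p\<close> does not divide \<open>b = v \<rho>\<close>, nontrivial elements raise \<open>\<rho>\<close> by exactly \<open>b\<close>.
\<close>

lemma veq_generators: assumes \<rho>: "veq b \<rho>" shows "veq (2 * b) (\<gamma> \<rho> - \<rho>)" "veq (2 * b) (\<sigma> \<rho> - \<rho>)"
  using raise_not_dvd[OF \<gamma> \<gamma>_not_id \<rho> not_dvd_b] raise_not_dvd[OF \<sigma> \<rho> not_dvd_b] by simp_all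

text \<open>
  The Teichmueller representative of \<open>- (\<gamma> \<rho> - \<rho>) / (\<sigma> \<rho> - \<rho>)\<close>; total ramification puts its residue
  class into \<open>K\<close>.
\<close>

lemma omega_exists:
  assumes \<rho>: "veq b \<rho>"
  obtains \<omega> where "\<omega> \<in> K" "\<omega> ^ (q - 1) = 1" "vge (2 * b + 1) ((\<gamma> \<rho> - \<rho>) + \<omega> * (\<sigma> \<rho> - \<rho>))"
proof -
  note val = veq_generators[OF \<rho>]
  define r where "r = - ((\<gamma> \<rho> - \<rho>) / (\<sigma> \<rho> - \<rho>))"
  have s0: "\<sigma> \<rho> - \<rho> \<noteq> 0" using val(2) veq_nonzero by blast
  have r: "veq 0 r" using veq_divide[OF val] unfolding r_def by (simp add: veq_def v_uminus)
  obtain \<kappa> where \<kappa>: "\<kappa> \<in> K" "vge 0 \<kappa>" "vge 1 (r - \<kappa>)" using tot[OF veq_vge[OF r]] by blast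
  obtain \<omega> where \<omega>: "\<omega> \<in> K" "\<omega> ^ q = \<omega>" "vge 1 (\<omega> - \<kappa>)" by (rule teichmueller_exists[OF \<kappa>(1,2)])
  have "vge 1 ((\<omega> - \<kappa>) - (r - \<kappa>))" by (rule vge_diff[OF \<omega>(3) \<kappa>(3)])
  hence \<omega>r: "vge 1 (\<omega> - r)" by simp
  have "\<omega> \<noteq> 0"
  proof
    assume "\<omega> = 0"
    hence "vge 1 r" using \<omega>r by simp
    thus False using r by (simp add: veq_iff)
  qed
  moreover have "vge (1 + 2 * b) ((\<omega> - r) * (\<sigma> \<rho> - \<rho>))" by (rule vge_mult[OF \<omega>r veq_vge[OF val(2)]])
  moreover have "(\<omega> - r) * (\<sigma> \<rho> - \<rho>) = (\<gamma> \<rho> - \<rho>) + \<omega> * (\<sigma> \<rho> - \<rho>)"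
  proof -
    have "r * (\<sigma> \<rho> - \<rho>) = - (\<gamma> \<rho> - \<rho>)" using s0 by (simp add: r_def)
    thus ?thesis unfolding left_diff_distrib by simp
  qed
  ultimately show thesis
    using that[OF \<omega>(1) teichmueller_root_of_unity[OF \<omega>(2)]] by (simp add: add.commute)
qed

lemma omega_unique:
  assumes \<rho>: "veq b \<rho>"
    and \<omega>: "\<omega> ^ (q - 1) = 1" "vge (2 * b + 1) ((\<gamma> \<rho> - \<rho>) + \<omega> * (\<sigma> \<rho> - \<rho>))"
    and \<omega>': "\<omega>' ^ (q - 1) = 1" "vge (2 * b + 1) ((\<gamma> \<rho> - \<rho>) + \<omega>' * (\<sigma> \<rho> - \<rho>))"
  shows "\<omega> = \<omega>'"
proof (rule teichmueller_unique)
  show "\<omega> ^ q = \<omega>" by (rule root_of_unity_teichmueller(1)[OF \<omega>(1)])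
  show "\<omega>' ^ q = \<omega>'" by (rule root_of_unity_teichmueller(1)[OF \<omega>'(1)])
  have "vge (2 * b + 1) ((\<sigma> \<rho> - \<rho>) * (\<omega> - \<omega>'))"
    using vge_diff[OF \<omega>(2) \<omega>'(2)] by (simp add: algebra_simps)
  thus "vge 1 (\<omega> - \<omega>')" by (rule vge_cancel[OF veq_generators(2)[OF \<rho>]])
qed

text \<open>
  If \<open>\<omega>\<close> were congruent to an integer \<open>m\<close>, then \<open>\<gamma> \<sigma> ^^ m\<close> would raise values by more than \<open>b\<close>.
\<close>

lemma omega_not_in_prime_field:
  assumes \<rho>: "veq b \<rho>" and \<omega>: "vge 0 \<omega>" "vge (2 * b + 1) ((\<gamma> \<rho> - \<rho>) + \<omega> * (\<sigma> \<rho> - \<rho>))"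
  shows "veq 0 (\<omega> - of_nat m)"
proof (rule vge_imp_veq)
  show "vge 0 (\<omega> - of_nat m)" by (rule vge_diff[OF \<omega>(1) vge_of_nat])
  show "\<not> vge (0 + 1) (\<omega> - of_nat m)"
  proof
    assume "vge (0 + 1) (\<omega> - of_nat m)"
    hence "vge (1 + 2 * b) ((\<omega> - of_nat m) * (\<sigma> \<rho> - \<rho>))"
      using vge_mult[of 1 "\<omega> - of_nat m" "2 * b"] veq_vge[OF veq_generators(2)[OF \<rho>]] by simp
    hence "vge (2 * b + 1) ((\<omega> - of_nat m) * (\<sigma> \<rho> - \<rho>))" by (simp only: add.commute)
    from vge_diff[OF \<omega>(2) this] have "vge (b + b + 1) ((\<gamma> \<rho> - \<rho>) + of_nat m * (\<sigma> \<rho> - \<rho>))"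
      by (simp add: algebra_simps)
    thus False using combination_raise[OF \<rho> not_dvd_b] by blast
  qed
qed

end

context ramified_triple
begin

lemma vge_D_iff_linear:
  assumes \<rho>: "veq b \<rho>"
  shows "vge (2 * b + 1) (D \<rho>) \<longleftrightarrow> vge (2 * b + 1) ((\<gamma> \<rho> - \<rho>) + \<omega> * (\<sigma> \<rho> - \<rho>))"
proof -
  define L where "L = (\<gamma> \<rho> - \<rho>) + \<omega> * (\<sigma> \<rho> - \<rho>)"
  have d: "vge (2 * b + 1) (D \<rho> - L)"
    unfolding L_def by (rule vge_mono[OF D_linear_part[OF veq_vge[OF \<rho>]]]) (use b_ge_1 in simp)
  show ?thesis
    unfolding L_def[symmetric] using vge_add[OF d, of L] vge_diff[OF _ d, of "D \<rho>"] by auto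
qed

text \<open>
  The same \<open>\<omega>\<close> serves all \<open>z\<close> of value \<open>b\<close>: by \<open>vge_D_all\<close>, used from \<open>\<rho>\<close> to \<open>z\<close> and from \<open>z\<close> back to
  \<open>\<rho>\<close>, they are raised by the same amount.
\<close>

lemma second_break:
  assumes \<rho>: "veq b \<rho>" "vge (2 * b + 1) ((\<gamma> \<rho> - \<rho>) + \<omega> * (\<sigma> \<rho> - \<rho>))"
  obtains b' where "b < b'" "b' \<le> int p * b" "\<And>z. veq b z \<Longrightarrow> veq (b + b') (D z)"
proof -
  have \<omega>_m: "veq 0 (\<omega> - of_nat m)" for m by (rule omega_not_in_prime_field[OF \<rho>(1) \<omega>(2) \<rho>(2)])
  note bound = D_bound[OF \<omega>_m]
  have "D \<rho> \<noteq> 0" using bound[OF \<rho>(1)] by auto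
  then obtain n where n: "veq n (D \<rho>)" using ex_veq by blast
  define b' where "b' = n - b"
  have b': "veq (b + b') (D \<rho>)" using n by (simp add: b'_def)
  have "vge (2 * b + 1) (D \<rho>)" using \<rho> by (simp add: vge_D_iff_linear)
  hence lo: "b < b'" using vge_veq_iff[OF b'] by simp
  have hi: "b' \<le> int p * b" using bound[OF \<rho>(1)] vge_veq_iff[OF b'] by simp
  have "veq (b + b') (D z)" if z: "veq b z" for z
  proof (rule vge_imp_veq)
    show Dz: "vge (b + b') (D z)"
      by (rule vge_D_all[OF _ hi \<rho>(1) veq_vge[OF b'] veq_vge[OF z]]) (use lo b_ge_1 in simp)
    show "\<not> vge (b + b' + 1) (D z)"
    proof
      assume r: "vge (b + b' + 1) (D z)"
      show False
      proof (cases "b' = int p * b")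
        case True thus False using bound[OF z] r by simp
      next
        case False
        have "vge (b + (b' + 1)) (D \<rho>)"
          by (rule vge_D_all[OF _ _ z _ veq_vge[OF \<rho>(1)]]) (use False lo hi b_ge_1 r in \<open>simp_all add: add.assoc\<close>)
        thus False using vge_veq_iff[OF b'] by simp
      qed
    qed
  qed
  with lo hi show thesis by (rule that)
qed

end

context refined_base
begin

lemma pow_eq_funpow: "g [^] (n::nat) = g ^^ n"
  by (induction n) (simp_all add: \<Gamma>_one \<Gamma>_mult funpow_Suc_right del: funpow.simps(2))

text \<open>
  A cyclic subgroup has at most \<open>p\<close> elements.
\<close>

lemma not_cyclic: assumes "\<tau> \<in> carrier \<Gamma>" shows "\<not> carrier \<Gamma> \<subseteq> generate \<Gamma> {\<tau>}"
proof
  assume "carrier \<Gamma> \<subseteq> generate \<Gamma> {\<tau>}"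
  moreover have "generate \<Gamma> {\<tau>} \<subseteq> carrier \<Gamma>" using assms by (intro generate_incl) simp
  ultimately have "card (generate \<Gamma> {\<tau>}) = p ^ 2" using G_card(2) by simp
  hence "ord \<tau> = p ^ 2" using generate_pow_card[OF assms] by simp
  moreover have "ord \<tau> dvd p" using exponent_p[OF assms] pow_eq_id[OF assms] by simp
  ultimately have "p ^ 2 \<le> p" using p_gt_1 by (auto dest: dvd_imp_le)
  thus False using p_gt_1 by (simp add: power2_eq_square)
qed

lemma generating_pair:
  assumes \<gamma>: "\<gamma> \<in> carrier \<Gamma>" and \<sigma>: "\<sigma> \<in> carrier \<Gamma>" and gen: "generate \<Gamma> {\<gamma>, \<sigma>} = carrier \<Gamma>"
  shows "ramified_pair v p e K f Qp (carrier \<Gamma>) b \<gamma> \<sigma>"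
proof unfold_locales
  have no: "\<not> {\<gamma>, \<sigma>} \<subseteq> generate \<Gamma> {\<tau>}" if t: "\<tau> \<in> carrier \<Gamma>" for \<tau>
  proof
    assume "{\<gamma>, \<sigma>} \<subseteq> generate \<Gamma> {\<tau>}"
    moreover have "subgroup (generate \<Gamma> {\<tau>}) \<Gamma>" using t by (intro generate_is_subgroup) simp
    ultimately have "generate \<Gamma> {\<gamma>, \<sigma>} \<subseteq> generate \<Gamma> {\<tau>}" by (rule generate_subgroup_incl)
    thus False using not_cyclic[OF t] gen by simp
  qed
  show "\<sigma> \<noteq> id"
  proof
    assume "\<sigma> = id"
    hence "\<sigma> \<in> generate \<Gamma> {\<gamma>}" using generate.one[of \<Gamma> "{\<gamma>}"] by (simp add: \<Gamma>_one)
    moreover have "\<gamma> \<in> generate \<Gamma> {\<gamma>}" by (rule generate.incl) simp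
    ultimately show False using no[OF \<gamma>] by simp
  qed
  show "\<gamma> \<circ> \<sigma> ^^ m \<noteq> id" for m
  proof
    assume "\<gamma> \<circ> \<sigma> ^^ m = id"
    hence "\<gamma> \<otimes> \<sigma> [^] m = \<one>" by (simp add: \<Gamma>_mult \<Gamma>_one pow_eq_funpow)
    hence "inv (\<sigma> [^] m) = \<gamma>" using \<gamma> \<sigma> by (intro inv_equality) auto
    hence "\<gamma> = inv (\<sigma> [^] m)" ..
    also have "\<dots> = \<sigma> [^] (- int m)" using \<sigma> by (simp add: int_pow_neg int_pow_int)
    also have "\<dots> \<in> generate \<Gamma> {\<sigma>}" using generate_pow[OF \<sigma>] by blast
    finally have "\<gamma> \<in> generate \<Gamma> {\<sigma>}" .
    moreover have "\<sigma> \<in> generate \<Gamma> {\<sigma>}" by (rule generate.incl) simp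
    ultimately show False using no[OF \<sigma>] by simp
  qed
qed (fact \<gamma> \<sigma>)+

text \<open>
  The statement to be proved, for one pair of generators and one element \<open>\<rho>\<close>.
\<close>

definition refined_structure :: "('a \<Rightarrow> 'a) \<Rightarrow> ('a \<Rightarrow> 'a) \<Rightarrow> 'a \<Rightarrow> int \<Rightarrow> bool" where
  "refined_structure \<gamma> \<sigma> \<rho> b' \<longleftrightarrow>
     (\<exists>!\<omega>. \<omega> ^ (p ^ f - 1) = 1 \<and>
           v ((\<gamma> \<rho> - \<rho>) + \<omega> * (\<sigma> \<rho> - \<rho>)) > ereal (of_int (2 * b))) \<and>
     (\<forall>\<omega>. \<omega> ^ (p ^ f - 1) = 1 \<and>
           v ((\<gamma> \<rho> - \<rho>) + \<omega> * (\<sigma> \<rho> - \<rho>)) > ereal (of_int (2 * b)) \<longrightarrow>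
        \<omega> \<in> OT \<and>
        (let \<Theta> = group_ring_of \<gamma> \<otimes>\<^bsub>group_ring OT \<Gamma>\<^esub> trunc_exp p OT \<Gamma> (group_ring_of \<sigma>) \<omega>
         in \<Theta> \<in> carrier (group_ring OT \<Gamma>) \<and>
            v (group_ring_act \<Gamma> (\<Theta> \<ominus>\<^bsub>group_ring OT \<Gamma>\<^esub> \<one>\<^bsub>group_ring OT \<Gamma>\<^esub>) \<rho>) - v \<rho>
              = ereal (of_int b') \<and>
            refined_breaks p OT \<Gamma> v \<rho> = {b, b'} \<and>
            refined_group p OT \<Gamma> = local.span {cl \<Theta>, cl (group_ring_of \<sigma>)} \<and>
            local.span {cl \<Theta>, cl (group_ring_of \<sigma>)} = refined_filtration p OT \<Gamma> v \<rho> b \<and>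
            refined_filtration p OT \<Gamma> v \<rho> (b + 1) \<subset> refined_filtration p OT \<Gamma> v \<rho> b \<and>
            refined_filtration p OT \<Gamma> v \<rho> (b + 1) = local.span {cl \<Theta>} \<and>
            local.span {cl \<Theta>} = refined_filtration p OT \<Gamma> v \<rho> b' \<and>
            refined_filtration p OT \<Gamma> v \<rho> (b' + 1) \<subset> refined_filtration p OT \<Gamma> v \<rho> b' \<and>
            refined_filtration p OT \<Gamma> v \<rho> (b' + 1) = {\<one>\<^bsub>trunc_group p OT \<Gamma>\<^esub>}))"

lemma refined_structure_breaks:
  assumes "refined_structure \<gamma> \<sigma> \<rho> b'"
  shows "refined_breaks p OT \<Gamma> v \<rho> = {b, b'}"
proof -
  note r = assms[unfolded refined_structure_def]
  from ex1_implies_ex[OF conjunct1[OF r]] obtain \<omega> where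
    \<omega>: "\<omega> ^ (p ^ f - 1) = 1 \<and> v ((\<gamma> \<rho> - \<rho>) + \<omega> * (\<sigma> \<rho> - \<rho>)) > ereal (of_int (2 * b))" by (rule exE)
  show ?thesis using mp[OF spec[OF conjunct2[OF r]] \<omega>] unfolding Let_def by (elim conjE)
qed

lemma refined_structure_pair:
  assumes \<gamma>: "\<gamma> \<in> carrier \<Gamma>" and \<sigma>: "\<sigma> \<in> carrier \<Gamma>" and gen: "generate \<Gamma> {\<gamma>, \<sigma>} = carrier \<Gamma>"
  obtains b' where "b < b'" "b' \<le> int p * b" "\<And>\<rho>. veq b \<rho> \<Longrightarrow> refined_structure \<gamma> \<sigma> \<rho> b'"
proof -
  interpret P: ramified_pair v p e K f Qp "carrier \<Gamma>" b \<gamma> \<sigma> by (rule generating_pair[OF assms])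
  obtain \<rho>0 where \<rho>0: "veq b \<rho>0" using veq_surj by blast
  obtain \<omega> where \<omega>: "\<omega> \<in> K" "\<omega> ^ (q - 1) = 1"
    "vge (2 * b + 1) ((\<gamma> \<rho>0 - \<rho>0) + \<omega> * (\<sigma> \<rho>0 - \<rho>0))" by (rule P.omega_exists[OF \<rho>0])
  have \<omega>0: "vge 0 \<omega>" by (rule veq_vge[OF root_of_unity_teichmueller(2)[OF \<omega>(2)]])
  have \<omega>_OT: "\<omega> \<in> OT" by (rule teichmueller_OT[OF \<omega>(1) root_of_unity_teichmueller(1)[OF \<omega>(2)]])
  interpret S: refined_setting \<Gamma> OT p v e K f Qp b \<gamma> \<sigma> \<omega>
    by unfold_locales (fact \<omega>(1) \<omega>0 \<omega>_OT gen)+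
  obtain b' where b': "b < b'" "b' \<le> int p * b" "\<And>z. veq b z \<Longrightarrow> veq (b + b') (S.D z)"
    by (rule S.second_break[OF \<rho>0 \<omega>(3)]) (rule that)
  have "refined_structure \<gamma> \<sigma> \<rho> b'" if \<rho>: "veq b \<rho>" for \<rho>
  proof -
    interpret R: refined_setting_rho \<Gamma> OT p v e K f Qp b \<gamma> \<sigma> \<omega> \<rho> b'
      by unfold_locales (fact \<rho> b'(3)[OF \<rho>] b'(1,2))+
    have "vge (2 * b + 1) (S.D \<rho>)" by (rule vge_mono[OF veq_vge[OF b'(3)[OF \<rho>]]]) (use b'(1) in simp)
    hence lin: "vge (2 * b + 1) ((\<gamma> \<rho> - \<rho>) + \<omega> * (\<sigma> \<rho> - \<rho>))" by (simp add: S.vge_D_iff_linear[OF \<rho>])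
    have the_omega: "\<omega>' ^ (p ^ f - 1) = 1 \<and>
        v ((\<gamma> \<rho> - \<rho>) + \<omega>' * (\<sigma> \<rho> - \<rho>)) > ereal (of_int (2 * b)) \<longleftrightarrow> \<omega>' = \<omega>" for \<omega>'
      unfolding v_greater_iff q_def[symmetric]
    proof
      assume "\<omega>' ^ (q - 1) = 1 \<and> vge (2 * b + 1) ((\<gamma> \<rho> - \<rho>) + \<omega>' * (\<sigma> \<rho> - \<rho>))"
      thus "\<omega>' = \<omega>" by (elim conjE) (rule P.omega_unique[OF \<rho> _ _ \<omega>(2) lin])
    next
      assume eq: "\<omega>' = \<omega>"
      show "\<omega>' ^ (q - 1) = 1 \<and> vge (2 * b + 1) ((\<gamma> \<rho> - \<rho>) + \<omega>' * (\<sigma> \<rho> - \<rho>))"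
        unfolding eq by (rule conjI[OF \<omega>(2) lin])
    qed
    have index: "v (S.act (S.th \<ominus>\<^bsub>RG\<^esub> \<one>\<^bsub>RG\<^esub>) \<rho>) - v \<rho> = ereal (of_int b')"
      using b'(3)[OF \<rho>] \<rho> by (simp add: S.act_th veq_def)
    have line: "R.F (b + 1) = local.span {cl S.th}" "local.span {cl S.th} = R.F b'"
      using R.F_mid[of "b + 1"] R.F_mid[of b'] b'(1) by simp_all
    have trivial: "R.F (b' + 1) = {\<one>\<^bsub>TG\<^esub>}" by (rule R.F_high) simp
    show ?thesis
      unfolding refined_structure_def the_omega
    proof (intro conjI allI impI)
      show "\<exists>!\<omega>'. \<omega>' = \<omega>" by simp
      fix \<omega>' assume eq: "\<omega>' = \<omega>"
      show "\<omega>' \<in> OT" unfolding eq by (rule \<omega>_OT)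
      note concl = index line trivial S.th_RG R.breaks R.refined_group_eq R.F_low[OF order_refl, symmetric]
        R.F_strict_b R.F_strict_b'
      show "let \<Theta> = group_ring_of \<gamma> \<otimes>\<^bsub>RG\<^esub> te (group_ring_of \<sigma>) \<omega>'
         in \<Theta> \<in> carrier RG \<and> v (S.act (\<Theta> \<ominus>\<^bsub>RG\<^esub> \<one>\<^bsub>RG\<^esub>) \<rho>) - v \<rho> = ereal (of_int b') \<and>
            refined_breaks p OT \<Gamma> v \<rho> = {b, b'} \<and>
            refined_group p OT \<Gamma> = local.span {cl \<Theta>, cl (group_ring_of \<sigma>)} \<and>
            local.span {cl \<Theta>, cl (group_ring_of \<sigma>)} = R.F b \<and> R.F (b + 1) \<subset> R.F b \<and>
            R.F (b + 1) = local.span {cl \<Theta>} \<and> local.span {cl \<Theta>} = R.F b' \<and>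
            R.F (b' + 1) \<subset> R.F b' \<and> R.F (b' + 1) = {\<one>\<^bsub>TG\<^esub>}"
        unfolding Let_def eq by (intro conjI concl[unfolded S.th_def S.sg_def])
    qed
  qed
  with b'(1,2) show thesis by (rule that)
qed

text \<open>
  The set of refined breaks does not mention generators, so different pairs of generators give the
  same second break.
\<close>

theorem refined_structure_uniform:
  "\<exists>b'. b < b' \<and> b' \<le> int p * b \<and>
    (\<forall>\<gamma>\<in>carrier \<Gamma>. \<forall>\<sigma>\<in>carrier \<Gamma>. \<forall>\<rho>. generate \<Gamma> {\<gamma>, \<sigma>} = carrier \<Gamma> \<and> veq b \<rho> \<longrightarrow>
       refined_structure \<gamma> \<sigma> \<rho> b')"
proof (cases "\<exists>\<gamma>\<in>carrier \<Gamma>. \<exists>\<sigma>\<in>carrier \<Gamma>. generate \<Gamma> {\<gamma>, \<sigma>} = carrier \<Gamma>")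
  case True
  then obtain \<gamma>0 \<sigma>0 where g0: "\<gamma>0 \<in> carrier \<Gamma>" "\<sigma>0 \<in> carrier \<Gamma>" "generate \<Gamma> {\<gamma>0, \<sigma>0} = carrier \<Gamma>"
    by blast
  obtain b' where b': "b < b'" "b' \<le> int p * b" "\<And>\<rho>. veq b \<rho> \<Longrightarrow> refined_structure \<gamma>0 \<sigma>0 \<rho> b'"
    by (rule refined_structure_pair[OF g0]) (rule that)
  have "refined_structure \<gamma> \<sigma> \<rho> b'"
    if g: "\<gamma> \<in> carrier \<Gamma>" "\<sigma> \<in> carrier \<Gamma>" "generate \<Gamma> {\<gamma>, \<sigma>} = carrier \<Gamma>" and \<rho>: "veq b \<rho>" for \<gamma> \<sigma> \<rho>
  proof -
    obtain b1 where b1: "b < b1" "\<And>\<rho>. veq b \<rho> \<Longrightarrow> refined_structure \<gamma> \<sigma> \<rho> b1"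
      by (rule refined_structure_pair[OF g]) (rule that)
    have "{b, b1} = {b, b'}"
      using refined_structure_breaks[OF b1(2)[OF \<rho>]] refined_structure_breaks[OF b'(3)[OF \<rho>]] by simp
    hence "b1 = b'" using b1(1) b'(1) by (auto simp: doubleton_eq_iff)
    thus ?thesis using b1(2)[OF \<rho>] by simp
  qed
  thus ?thesis using b'(1,2) by blast
next
  case False
  \<comment> \<open>only the bounds on \<open>b'\<close> have to be met, since there is no pair to consider\<close>
  have "2 * b \<le> int p * b" by (rule mult_right_mono) (use p_gt_1 b_ge_1 in simp_all)
  hence "b + 1 \<le> int p * b" using b_ge_1 by linarith
  thus ?thesis using False by (intro exI[of _ "b + 1"]) auto
qed

end

section \<open>Elementary abelian Galois groups\<close>

lemma carrier_galois_group:
  "g \<in> carrier (galois_group K) \<longleftrightarrow>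
     bij g \<and> (\<forall>x y. g (x + y) = g x + g y) \<and> (\<forall>x y. g (x * y) = g x * g y) \<and> g 1 = 1 \<and> (\<forall>x\<in>K. g x = x)"
  by (auto simp: galois_group_def ring_iso_def ring_hom_def)

lemma mult_galois_group: "g \<otimes>\<^bsub>galois_group K\<^esub> h = g \<circ> h"
  by (simp add: galois_group_def)

lemma one_galois_group: "\<one>\<^bsub>galois_group K\<^esub> = id"
  by (simp add: galois_group_def)

lemma group_galois_group:
  fixes K :: "'a::field set"
  shows "group (galois_group K)"
proof (rule groupI)
  fix g :: "'a \<Rightarrow> 'a" assume g: "g \<in> carrier (galois_group K)"
  hence bij: "bij g" by (simp add: carrier_galois_group)
  have left: "inv_into UNIV g y = x" if "g x = y" for x y using bij that by (auto simp: bij_def)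
  have g_inv: "g (inv_into UNIV g x) = x" for x using bij by (simp add: bij_def surj_f_inv_f)
  have "inv_into UNIV g \<in> carrier (galois_group K)"
    using g by (auto simp: carrier_galois_group g_inv bij_imp_bij_inv intro!: left)
  moreover have "inv_into UNIV g \<circ> g = id" using bij by (simp add: bij_def)
  ultimately show "\<exists>h\<in>carrier (galois_group K). h \<otimes>\<^bsub>galois_group K\<^esub> g = \<one>\<^bsub>galois_group K\<^esub>"
    unfolding mult_galois_group one_galois_group by blast
qed (auto simp: mult_galois_group one_galois_group carrier_galois_group bij_comp comp_assoc)

lemma (in group) elementary_abelian_iso:
  assumes iso: "G \<cong> integer_mod_group p \<times>\<times> integer_mod_group p" and p: "0 < p"
  shows "comm_group G" "finite (carrier G)" "card (carrier G) = p ^ 2"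
    and "\<And>g. g \<in> carrier G \<Longrightarrow> g [^] p = \<one>"
proof -
  let ?Z = "integer_mod_group p \<times>\<times> integer_mod_group p"
  obtain h where h: "h \<in> iso G ?Z" using iso by (auto simp: is_iso_def)
  have hom: "h \<in> hom G ?Z" and inj: "inj_on h (carrier G)" using h by (auto simp: iso_def bij_betw_def)
  have Z: "group ?Z" by (intro DirProd_group) simp_all
  have comm: "x \<otimes>\<^bsub>?Z\<^esub> y = y \<otimes>\<^bsub>?Z\<^esub> x" for x y
    by (cases x; cases y) (simp add: add.commute)
  show "comm_group G"
  proof (rule group_comm_groupI)
    fix x y assume xy: "x \<in> carrier G" "y \<in> carrier G"
    have "h (x \<otimes> y) = h (y \<otimes> x)" using xy by (simp add: hom_mult[OF hom] comm[of "h x"])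
    thus "x \<otimes> y = y \<otimes> x" using xy by (intro inj_onD[OF inj]) auto
  qed
  have "card (carrier ?Z) = p ^ 2"
    using p by (simp add: carrier_integer_mod_group card_cartesian_product power2_eq_square)
  thus card: "card (carrier G) = p ^ 2" using iso_same_card[OF iso] by simp
  show "finite (carrier G)" using card p by (intro card_ge_0_finite) simp
  show "g [^] p = \<one>" if g: "g \<in> carrier G" for g
  proof -
    have pow: "(x, y) [^]\<^bsub>?Z\<^esub> n = (x [^]\<^bsub>integer_mod_group p\<^esub> n, y [^]\<^bsub>integer_mod_group p\<^esub> n)"
      for x y and n :: nat
      by (induction n) (simp_all del: pow_integer_mod_group add: nat_pow_def)
    have "h (g [^] p) = h g [^]\<^bsub>?Z\<^esub> p" by (rule hom_nat_pow[OF hom g group_axioms Z])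
    also have "\<dots> = (0, 0)" by (cases "h g") (simp add: pow)
    also have "\<dots> = h \<one>" using hom_one[OF hom group_axioms Z] by simp
    finally show ?thesis using g by (intro inj_onD[OF inj]) auto
  qed
qed

lemma (in complete_group_algebra) trunc_algebra: "trunc_algebra G R p"
proof unfold_locales
  show "prime p" by (rule p)
  show "(a gchoose k) \<in> R" if "a \<in> R" "k < p" for a k
    using that vge_gbinomial[of a k] is_subfield_gbinomial[OF T(1), of a k] by (simp add: R_iff)
  show "trunc_defect_coeff p a i j \<in> R" if "a \<in> R" "i < p" "j < p" for a i j
  proof -
    have "trunc_defect_coeff p a i j \<in> T"
      unfolding trunc_defect_coeff_def
      by (intro is_subfield_sum is_subfieldD(4) is_subfield_gbinomial is_subfield_of_nat T(1))
        (use that in \<open>simp add: R_iff\<close>)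
    thus ?thesis using that vge_trunc_defect_coeff[of a i j] by (simp add: R_iff)
  qed
  show "1 / of_nat i \<in> R" if "0 < i" "i < p" for i
  proof -
    have "\<not> p dvd i" using that by (auto dest: dvd_imp_le)
    hence "veq (0 - 0) (1 / of_nat i)" using veq_of_nat[of 1] veq_of_nat[of i] prime_gt_1_nat[OF p]
      by (intro veq_divide) auto
    moreover have "1 / of_nat i \<in> T"
      by (intro is_subfieldD(8)[OF T(1)] is_subfieldD(2)[OF T(1)] is_subfield_of_nat[OF T(1)])
    ultimately show ?thesis using veq_vge[of 0 "1 / of_nat i"] by (simp add: R_iff)
  qed
qed (fact exponent aug_ideal_one_plus_invertible)+

lemma (in padic_base) galois_ramified:
  assumes N: "galois_ext K" and tot_ram: "totally_ramified_ext v K UNIV"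
    and G: "G = galois_group K" "G \<cong> integer_mod_group p \<times>\<times> integer_mod_group p"
    and break: "ramification_group v K b = carrier G" "ramification_group v K (b + 1) = {\<one>\<^bsub>G\<^esub>}"
  shows "ramified v p e K f Qp (carrier G) b"
proof -
  have grp: "group G" unfolding G(1) by (rule group_galois_group)
  interpret group G by (rule grp)
  note el = elementary_abelian_iso[OF G(2) prime_gt_0_nat[OF p]]
  interpret comm_group G by (rule el(1))
  have G_mult: "g \<otimes>\<^bsub>G\<^esub> h = g \<circ> h" for g h by (simp add: G(1) mult_galois_group)
  have G_one: "\<one>\<^bsub>G\<^esub> = id" by (simp add: G(1) one_galois_group)
  have pow: "g [^]\<^bsub>G\<^esub> (n::nat) = g ^^ n" for g n
    by (induction n) (simp_all add: G_one G_mult funpow_Suc_right del: funpow.simps(2))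
  note cG = carrier_galois_group[of _ K, folded G(1)]
  have fin: "is_finite_ext K UNIV" using N by (simp add: galois_ext_def)
  have pos: "0 < v x \<longleftrightarrow> vge 1 x" for x using v_greater_iff[of 0 x] by (simp add: zero_ereal_def)
  have nonneg: "0 \<le> v x \<longleftrightarrow> vge 0 x" for x by (simp add: vge_def zero_ereal_def)
  show ?thesis
  proof unfold_locales
    fix x :: 'a assume "vge 0 x"
    hence "x \<in> val_ring v UNIV" by (simp add: val_ring_def nonneg)
    then obtain y where "y \<in> val_ring v K" "x - y \<in> val_max_ideal v UNIV"
      using tot_ram unfolding totally_ramified_ext_def by blast
    thus "\<exists>y\<in>K. vge 0 y \<and> vge 1 (x - y)" by (auto simp: val_ring_def val_max_ideal_def pos nonneg)
  next
    fix g x assume g: "g \<in> carrier G" and x: "vge 1 x"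
    have "g \<in> ramification_group v K b" using g break(1) by simp
    thus "vge (b + 1) (g x - x)" using x by (simp add: ramification_group_def val_max_ideal_def pos vge_def)
  next
    fix g assume g: "g \<in> carrier G" and r: "\<And>x. vge 1 x \<Longrightarrow> vge (b + 2) (g x - x)"
    have "ereal (of_int (b + 1 + 1)) \<le> v (g x - x)" if "x \<in> val_max_ideal v UNIV" for x
      using r[of x] that by (simp add: val_max_ideal_def pos vge_def add.commute)
    hence "g \<in> ramification_group v K (b + 1)"
      using g unfolding ramification_group_def G(1) by blast
    thus "g = id" using break(2) by (simp add: G_one)
  next
    fix g x and n :: int assume g: "g \<in> carrier G" and x: "vge n x"
    show "vge n (g x)"
      by (rule finite_ext_aut_vge[OF K fin _ _ _ _ x]) (use g in \<open>simp_all add: cG\<close>)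
  next
    fix x assume "\<And>g. g \<in> carrier G \<Longrightarrow> g x = x"
    thus "x \<in> K" using N unfolding galois_ext_def G(1) by blast
  next
    fix g assume g: "g \<in> carrier G"
    show "\<exists>h\<in>carrier G. h \<circ> g = id \<and> g \<circ> h = id"
      using g by (intro bexI[of _ "inv\<^bsub>G\<^esub> g"]) (simp_all add: G_mult[symmetric] G_one[symmetric])
    show "g ^^ p = id" using el(4)[OF g] by (simp add: pow G_one)
  next
    fix g h assume "g \<in> carrier G" "h \<in> carrier G"
    thus "g \<circ> h \<in> carrier G" "g \<circ> h = h \<circ> g" using m_comm[of g h] by (simp_all add: G_mult[symmetric])
  next
    show "id \<in> carrier G" using one_closed by (simp add: G_one)
  qed (simp_all add: cG el(2,3))
qed

lemma (in valued) residue_card_neq_1: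
  assumes "is_subfield K"
  shows "card (carrier (residue_field v K)) \<noteq> 1"
proof
  assume "card (carrier (residue_field v K)) = 1"
  then obtain C where C: "carrier (residue_field v K) = {C}" by (rule card_1_singletonE)
  have v1: "v 1 = 0" using veq_1 by (simp add: veq_def zero_ereal_def)
  have coset: "(\<lambda>i. i + a) ` val_max_ideal v K = C" if "a \<in> val_ring v K" for a
  proof -
    have "(\<lambda>i. i + a) ` val_max_ideal v K \<in> carrier (residue_field v K)"
      unfolding carrier_residue_field using that by (rule imageI)
    thus ?thesis unfolding C by (rule singletonD)
  qed
  have "0 \<in> val_ring v K" "1 \<in> val_ring v K"
    using is_subfieldD(1,2)[OF assms] v1 by (simp_all add: val_ring_def)
  hence eq: "(\<lambda>i. i + 1) ` val_max_ideal v K = (\<lambda>i. i + 0) ` val_max_ideal v K"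
    by (simp only: coset)
  have "0 \<in> val_max_ideal v K" using is_subfieldD(1)[OF assms] by (simp add: val_max_ideal_def)
  from imageI[OF this, of "\<lambda>i. i + 1"]
  have "0 + 1 \<in> (\<lambda>i. i + 0) ` val_max_ideal v K" unfolding eq .
  then obtain i where "i \<in> val_max_ideal v K" "0 + 1 = i + 0" by (rule imageE)
  hence "1 \<in> val_max_ideal v K" by simp
  thus False using v1 by (simp add: val_max_ideal_def)
qed

theorem theorem4:
  fixes p f :: nat and b :: int
    and Qp K T OT :: "'a::field_char_0 set"
    and w v :: "'a \<Rightarrow> ereal"
    and G :: "('a \<Rightarrow> 'a) monoid"
  assumes p: "prime p"
    and Qp: "padic_numbers p Qp w"
    and K: "is_subfield K" "Qp \<subseteq> K" "is_finite_ext Qp K"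
    and N: "galois_ext K"
    and v: "normalized_valuation UNIV v" "\<exists>e::nat. e > 0 \<and> (\<forall>x\<in>Qp. v x = ereal (real e) * w x)"
    and f: "card (carrier (residue_field v K)) = p ^ f"
    and T: "max_unramified_ext v Qp K T"
    and OT: "OT = val_ring v T"
    and tot_ram: "totally_ramified_ext v K UNIV"
    and G: "G = galois_group K" "G \<cong> integer_mod_group p \<times>\<times> integer_mod_group p"
    and break: "ramification_group v K b = carrier G" "ramification_group v K (b + 1) = {\<one>\<^bsub>G\<^esub>}"
  shows "\<exists>b'::int. b < b' \<and> b' \<le> int p * b \<and>
    (\<forall>\<gamma>\<in>carrier G. \<forall>\<sigma>\<in>carrier G. \<forall>\<rho>::'a.
       generate G {\<gamma>, \<sigma>} = carrier G \<and> v \<rho> = ereal (of_int b) \<longrightarrow>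
       (\<exists>!\<omega>. \<omega> ^ (p ^ f - 1) = 1 \<and>
             v ((\<gamma> \<rho> - \<rho>) + \<omega> * (\<sigma> \<rho> - \<rho>)) > ereal (of_int (2 * b))) \<and>
       (\<forall>\<omega>. \<omega> ^ (p ^ f - 1) = 1 \<and>
             v ((\<gamma> \<rho> - \<rho>) + \<omega> * (\<sigma> \<rho> - \<rho>)) > ereal (of_int (2 * b)) \<longrightarrow>
          \<omega> \<in> OT \<and>
          (let \<Theta> = group_ring_of \<gamma> \<otimes>\<^bsub>group_ring OT G\<^esub> trunc_exp p OT G (group_ring_of \<sigma>) \<omega>;
               cl = trunc_class p OT G;
               span = trunc_span p OT G;
               F = refined_filtration p OT G v \<rho>
           in \<Theta> \<in> carrier (group_ring OT G) \<and>
              v (group_ring_act G (\<Theta> \<ominus>\<^bsub>group_ring OT G\<^esub> \<one>\<^bsub>group_ring OT G\<^esub>) \<rho>) - v \<rho>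
                = ereal (of_int b') \<and>
              refined_breaks p OT G v \<rho> = {b, b'} \<and>
              refined_group p OT G = span {cl \<Theta>, cl (group_ring_of \<sigma>)} \<and>
              span {cl \<Theta>, cl (group_ring_of \<sigma>)} = F b \<and>
              F (b + 1) \<subset> F b \<and>
              F (b + 1) = span {cl \<Theta>} \<and>
              span {cl \<Theta>} = F b' \<and>
              F (b' + 1) \<subset> F b' \<and>
              F (b' + 1) = {\<one>\<^bsub>trunc_group p OT G\<^esub>})))"
proof -
  interpret valued v by unfold_locales (rule v(1))
  obtain e :: nat where e: "e > 0" "\<forall>x\<in>Qp. v x = ereal (real e) * w x" using v(2) by blast
  note Qp_facts = padic_numbers_facts[OF p Qp e]
  have Qp_sub: "is_subfield Qp" using Qp by (simp add: padic_numbers_def)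
  have K_complete: "vcomplete K" by (rule vcomplete_finite_ext[OF Qp_sub Qp_facts(2) K(3)])
  have f0: "0 < f" using residue_card_neq_1[OF K(1)] f by (cases f) auto
  have q0: "p ^ f \<noteq> 0" using prime_gt_0_nat[OF p] by simp
  interpret padic_base v p "int e" K f Qp
  proof (intro padic_base.intro padic_base_axioms.intro teichmueller.intro teichmueller_axioms.intro
      padic_valued.intro padic_valued_axioms.intro valued_axioms p K Qp_facts Qp_sub K_complete f0)
    show "vge 1 (a ^ p ^ f - a)" if "a \<in> K" "vge 0 a" for a
      by (rule residue_power_card[OF K(1) f q0 that])
  qed (use e in simp)
  have T_sub: "is_subfield T" and TK: "T \<subseteq> K" using T by (simp_all add: max_unramified_ext_def)
  have OT_eq: "OT = {x \<in> T. vge 0 x}" by (auto simp: OT val_ring_def vge_def zero_ereal_def)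
  have "group G" unfolding G(1) by (rule group_galois_group)
  note el = group.elementary_abelian_iso[OF this G(2) prime_gt_0_nat[OF p]]
  interpret C: complete_group_algebra G OT v p "int e" T
  proof (intro complete_group_algebra.intro complete_group_algebra_axioms.intro group_algebra.intro
      group_algebra_axioms.intro el(1,2,4) padic_valued_axioms T_sub OT_eq max_unramified_complete[OF T])
  qed (auto simp: OT_eq is_subfieldD[OF T_sub] intro: vge_add vge_mult0)
  interpret trunc_algebra G OT p by (rule C.trunc_algebra)
  interpret ramified v p "int e" K f Qp "carrier G" b by (rule galois_ramified[OF N tot_ram G break])
  interpret refined_base G OT p v "int e" K f Qp b
  proof (intro refined_base.intro refined_base_axioms.intro trunc_algebra_axioms ramified_axioms)
    show "\<exists>y\<in>OT. x = of_nat p * y" if x: "x \<in> OT" "vge 1 x" for x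
    proof (rule bexI[of _ "x / of_nat p"])
      have xT: "x \<in> T" using x(1) by (simp add: OT_eq)
      have "vge (int e - int e) (x / of_nat p)"
        by (rule vge_divide[OF max_unramified_vge[OF T xT x(2)] veq_p])
      thus "x / of_nat p \<in> OT"
        using is_subfieldD(8)[OF T_sub xT is_subfield_of_nat[OF T_sub]] by (simp add: OT_eq)
      show "x = of_nat p * (x / of_nat p)" using prime_gt_0_nat[OF p] by simp
    qed
    show "x \<in> OT" if x: "x \<in> K" "x ^ q = x" for x
      using teichmueller_in_max_unramified[OF T x] vge_0_if_power_q[OF x(2)] by (simp add: OT_eq)
  qed (use TK in \<open>auto simp: OT_eq G(1) mult_galois_group one_galois_group\<close>)
  show ?thesis
    using refined_structure_uniform unfolding refined_structure_def veq_def Let_def .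
qed

end
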